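(* Let $g_1, g_2 \in F$ be two coefficients, and let $u_1, u_2 \in V$ be the corresponding solutions of the variational inequality $$a(u_i, v-u_i) + j(g_i,v) - j(g_i,u_i) \ge \langle f, v-u_i\rangle \qquad \forall v\in V \quad (i=1,2),$$ with the same datum $f$. Assume that for $i=1,2$ the set $\{x\in\Gamma_f : u_i|_{\Gamma_f}(x)=0\}$ has measure zero. If $u_1=u_2$ on $\Gamma_f$, then $g_1=g_2$ a.e. on $\Gamma_f$.
   Context: Let $\Omega\subset\mathbb{R}^n$, $n\in\{2,3\}$, be an open bounded domain with Lipschitz boundary $\Gamma$. Let $\Gamma_0\subset\Gamma$ be a relatively open subset, possibly empty, and $\Gamma_f:=\Gamma\setminus\Gamma_0$. Set $V:=\{v\in H^1(\Omega): v=0 \text{ a.e. on }\Gamma_0\}$, where boundary values are understood in the sense of the Sobolev trace; the trace of $v$ is also denoted $v$. Let $f\in L^2(\Omega)$ and define $$a(u,v):=\int_\Omega(\nabla u\cdot\nabla v+uv)\,dx,\qquad j(g,v):=\int_{\Gamma_f} g|v|\,ds,\qquad \langle f,v\rangle:=\int_\Omega fv\,dx .$$ Coefficients $g$ are assumed to satisfy $g>0$ a.e. on $\Gamma_f$; for such $g$ the variational inequality has a unique solution in $V$. For a given $g_0>0$, the set of admissible coefficients is $$F:=\{g\in H^1(\Gamma_f): g>0 \text{ a.e. on } \Gamma_f,\ \|g\|_{L^2(\Gamma_f)}\le g_0\}.$$ Measure on $\Gamma_f$ is surface measure. *)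

theory Defs
  imports "HOL-Analysis.Analysis"
begin

section \<open>Surface measure\<close>

text \<open>
  Hausdorff measure of dimension \<open>d > 0\<close>, with the factor \<open>unit_ball_vol d / 2 ^ d\<close> that makes it agree
  with Lebesgue measure on \<open>d\<close>-dimensional Euclidean space and with the usual surface measure on
  Lipschitz hypersurfaces. Boundedness of the covering sets is required because \<^const>\<open>diameter\<close> is
  unspecified on unbounded sets. For \<open>d = 0\<close> the formula is not meaningful, since \<open>0 ^ 0 = 1\<close>.
\<close>

definition hausdorff_outer :: "nat \<Rightarrow> 'a::euclidean_space set \<Rightarrow> ennreal" where
  "hausdorff_outer d A =
    (SUP \<delta>\<in>{0::real<..}.
      INF C\<in>{C :: nat \<Rightarrow> 'a set. A \<subseteq> (\<Union>i. C i) \<and> (\<forall>i. bounded (C i) \<and> diameter (C i) \<le> \<delta>)}.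
        \<Sum>i. ennreal (unit_ball_vol (real d) * (diameter (C i) / 2) ^ d))"

text \<open>The measure lives on the Caratheodory-measurable sets of the outer measure.\<close>

definition hausdorff_measure :: "nat \<Rightarrow> 'a::euclidean_space measure" where
  "hausdorff_measure d =
    measure_of UNIV (lambda_system UNIV (Pow UNIV) (hausdorff_outer d)) (hausdorff_outer d)"

definition surface :: "'a::euclidean_space measure" where
  "surface = hausdorff_measure (DIM('a) - 1)"

abbreviation surface_on :: "'a::euclidean_space set \<Rightarrow> 'a measure" where
  "surface_on S \<equiv> restrict_space surface S"


section \<open>The spaces \<open>L\<^sup>2\<close> and \<open>H\<^sup>1\<close>\<close>

text \<open>Elements are functions rather than classes modulo null sets; only their values on the
  underlying space of the measure matter.\<close>

definition L2 :: "'a measure \<Rightarrow> ('a \<Rightarrow> real) set" where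
  "L2 M = {u \<in> borel_measurable M. integrable M (\<lambda>x. (u x)\<^sup>2)}"

definition L2_norm :: "'a measure \<Rightarrow> ('a \<Rightarrow> real) \<Rightarrow> real" where
  "L2_norm M u = sqrt (LINT x|M. (u x)\<^sup>2)"

fun Ck :: "nat \<Rightarrow> ('a::euclidean_space \<Rightarrow> real) \<Rightarrow> bool" where
  "Ck 0 f \<longleftrightarrow> continuous_on UNIV f"
| "Ck (Suc k) f \<longleftrightarrow>
    (\<exists>D. (\<forall>x. GDERIV f x :> D x) \<and> (\<forall>b\<in>Basis. Ck k (\<lambda>x. D x \<bullet> b)))"

definition smooth :: "('a::euclidean_space \<Rightarrow> real) \<Rightarrow> bool" where
  "smooth f \<longleftrightarrow> (\<forall>k. Ck k f)"

definition test_fun :: "'a::euclidean_space set \<Rightarrow> ('a \<Rightarrow> real) \<Rightarrow> bool" where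
  "test_fun U \<phi> \<longleftrightarrow>
    smooth \<phi> \<and> compact (closure {x. \<phi> x \<noteq> 0}) \<and> closure {x. \<phi> x \<noteq> 0} \<subseteq> U"

definition weak_gradient ::
  "'a::euclidean_space set \<Rightarrow> ('a \<Rightarrow> real) \<Rightarrow> ('a \<Rightarrow> 'a) \<Rightarrow> bool" where
  "weak_gradient U u G \<longleftrightarrow>
    (\<forall>b\<in>Basis. (\<lambda>x. G x \<bullet> b) \<in> L2 (lebesgue_on U)) \<and>
    (\<forall>\<phi> D. test_fun U \<phi> \<longrightarrow> (\<forall>x. GDERIV \<phi> x :> D x) \<longrightarrow>
      (\<forall>b\<in>Basis. (LINT x|lebesgue_on U. u x * (D x \<bullet> b)) =
                - (LINT x|lebesgue_on U. (G x \<bullet> b) * \<phi> x)))"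

definition H1 :: "'a::euclidean_space set \<Rightarrow> ('a \<Rightarrow> real) set" where
  "H1 U = {u \<in> L2 (lebesgue_on U). \<exists>G. weak_gradient U u G}"

text \<open>The weak gradient is determined up to a null set of \<open>U\<close>.\<close>

definition grad :: "'a::euclidean_space set \<Rightarrow> ('a \<Rightarrow> real) \<Rightarrow> 'a \<Rightarrow> 'a" where
  "grad U u = (SOME G. weak_gradient U u G)"

definition H1_norm :: "'a::euclidean_space set \<Rightarrow> ('a \<Rightarrow> real) \<Rightarrow> real" where
  "H1_norm U u = sqrt (LINT x|lebesgue_on U. (norm (grad U u x))\<^sup>2 + (u x)\<^sup>2)"


section \<open>Lipschitz domains and \<open>H\<^sup>1\<close> on parts of the boundary\<close>

text \<open>
  The space \<open>\<real>\<^sup>n\<close> is written as \<open>\<real>\<^sup>n\<^sup>-\<^sup>1 \<times> \<real>\<close>, the type \<^typ>\<open>'m \<times> real\<close> with \<^typ>\<open>'m\<close> Euclidean of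
  dimension \<open>n - 1\<close>; its library inner product is the standard one. In the coordinates given by the
  rigid motion \<open>p \<mapsto> a + R p\<close>, the set \<open>\<Omega>\<close> is, inside the cylinder \<open>ball 0 r \<times> (-h, h)\<close>, the strict
  epigraph of the Lipschitz function \<open>\<gamma>\<close>, so the boundary is there the graph of \<open>\<gamma>\<close>.
\<close>

definition lipschitz_chart ::
  "('m::euclidean_space \<times> real) set \<Rightarrow> 'm \<times> real \<Rightarrow> ('m \<times> real \<Rightarrow> 'm \<times> real) \<Rightarrow>
   real \<Rightarrow> real \<Rightarrow> ('m \<Rightarrow> real) \<Rightarrow> bool" where
  "lipschitz_chart \<Omega> a R r h \<gamma> \<longleftrightarrow>
    orthogonal_transformation R \<and> 0 < r \<and> 0 < h \<and>
    (\<exists>L. L-lipschitz_on (ball 0 r) \<gamma>) \<and>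
    (\<forall>y\<in>ball 0 r. \<bar>\<gamma> y\<bar> < h) \<and>
    (\<forall>y\<in>ball 0 r. \<forall>s\<in>{-h<..<h}. a + R (y, s) \<in> \<Omega> \<longleftrightarrow> \<gamma> y < s)"

definition lipschitz_domain :: "('m::euclidean_space \<times> real) set \<Rightarrow> bool" where
  "lipschitz_domain \<Omega> \<longleftrightarrow>
    open \<Omega> \<and> connected \<Omega> \<and> \<Omega> \<noteq> {} \<and> bounded \<Omega> \<and>
    (\<forall>x\<in>frontier \<Omega>. \<exists>a R r h \<gamma>. lipschitz_chart \<Omega> a R r h \<gamma> \<and>
      (\<exists>y\<in>ball 0 r. x = a + R (y, \<gamma> y)))"

text \<open>
  \<open>H1_surface \<Omega> S\<close> is \<open>H\<^sup>1(S)\<close> for a subset \<open>S\<close> of the Lipschitz boundary of \<open>\<Omega>\<close>: square integrable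
  functions on \<open>S\<close> whose pull-backs under all graph parametrisations are \<open>H\<^sup>1\<close> on the part of the
  parameter ball that is mapped into the relative interior of \<open>S\<close>. On a compact Lipschitz boundary,
  quantifying over all charts is equivalent to using one finite atlas.
\<close>

definition H1_surface ::
  "('m::euclidean_space \<times> real) set \<Rightarrow> ('m \<times> real) set \<Rightarrow> ('m \<times> real \<Rightarrow> real) set" where
  "H1_surface \<Omega> S =
    {g \<in> L2 (surface_on S). \<forall>a R r h \<gamma>. lipschitz_chart \<Omega> a R r h \<gamma> \<longrightarrow>
      (\<lambda>y. g (a + R (y, \<gamma> y))) \<in>
        H1 {y \<in> ball 0 r. a + R (y, \<gamma> y) \<in> top_of_set (frontier \<Omega>) interior_of S}}"


section \<open>Traces and the variational inequality\<close>

text \<open>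
  The Sobolev trace is the continuous extension of the restriction map \<open>\<phi> \<mapsto> \<phi>|\<^sub>\<Gamma>\<close> from functions
  smooth up to the boundary to \<open>H\<^sup>1(\<Omega>)\<close>: \<open>\<tau>\<close> is a trace of \<open>v\<close> if some smooth functions converge to
  \<open>v\<close> in \<open>H\<^sup>1(\<Omega>)\<close> while their boundary values converge to \<open>\<tau>\<close> in \<open>L\<^sup>2(\<Gamma>)\<close>. For a bounded Lipschitz
  domain every \<open>v\<close> in \<open>H\<^sup>1(\<Omega>)\<close> has a trace, and it is unique up to surface null sets.
\<close>

definition is_trace ::
  "'a::euclidean_space set \<Rightarrow> ('a \<Rightarrow> real) \<Rightarrow> ('a \<Rightarrow> real) \<Rightarrow> bool" where
  "is_trace \<Omega> v \<tau> \<longleftrightarrow>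
    \<tau> \<in> L2 (surface_on (frontier \<Omega>)) \<and>
    (\<exists>\<phi>. (\<forall>k::nat. smooth (\<phi> k)) \<and>
      (\<lambda>k. H1_norm \<Omega> (\<lambda>x. \<phi> k x - v x)) \<longlonglongrightarrow> 0 \<and>
      (\<lambda>k. \<integral>\<^sup>+x. ennreal ((\<phi> k x - \<tau> x)\<^sup>2) \<partial>surface_on (frontier \<Omega>)) \<longlonglongrightarrow> 0)"

definition sobolev_trace :: "'a::euclidean_space set \<Rightarrow> ('a \<Rightarrow> real) \<Rightarrow> 'a \<Rightarrow> real" where
  "sobolev_trace \<Omega> v = (SOME \<tau>. is_trace \<Omega> v \<tau>)"

definition V_space :: "'a::euclidean_space set \<Rightarrow> 'a set \<Rightarrow> ('a \<Rightarrow> real) set" where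
  "V_space \<Omega> \<Gamma>0 =
    {v \<in> H1 \<Omega>. \<exists>\<tau>. is_trace \<Omega> v \<tau> \<and> (AE x in surface_on \<Gamma>0. \<tau> x = 0)}"

definition a_form :: "'a::euclidean_space set \<Rightarrow> ('a \<Rightarrow> real) \<Rightarrow> ('a \<Rightarrow> real) \<Rightarrow> real" where
  "a_form \<Omega> u v = (LINT x|lebesgue_on \<Omega>. grad \<Omega> u x \<bullet> grad \<Omega> v x + u x * v x)"

definition j_fun ::
  "'a::euclidean_space set \<Rightarrow> 'a set \<Rightarrow> ('a \<Rightarrow> real) \<Rightarrow> ('a \<Rightarrow> real) \<Rightarrow> real" where
  "j_fun \<Omega> \<Gamma>f g v = (LINT x|surface_on \<Gamma>f. g x * \<bar>sobolev_trace \<Omega> v x\<bar>)"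

definition load :: "'a::euclidean_space set \<Rightarrow> ('a \<Rightarrow> real) \<Rightarrow> ('a \<Rightarrow> real) \<Rightarrow> real" where
  "load \<Omega> f v = (LINT x|lebesgue_on \<Omega>. f x * v x)"

definition VI_solution ::
  "'a::euclidean_space set \<Rightarrow> 'a set \<Rightarrow> ('a \<Rightarrow> real) \<Rightarrow> ('a \<Rightarrow> real) \<Rightarrow> ('a \<Rightarrow> real) \<Rightarrow> bool" where
  "VI_solution \<Omega> \<Gamma>0 f g u \<longleftrightarrow>
    u \<in> V_space \<Omega> \<Gamma>0 \<and>
    (\<forall>v\<in>V_space \<Omega> \<Gamma>0.
      a_form \<Omega> u (\<lambda>x. v x - u x)
        + j_fun \<Omega> (frontier \<Omega> - \<Gamma>0) g v - j_fun \<Omega> (frontier \<Omega> - \<Gamma>0) g u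
      \<ge> load \<Omega> f (\<lambda>x. v x - u x))"

definition admissible ::
  "('m::euclidean_space \<times> real) set \<Rightarrow> ('m \<times> real) set \<Rightarrow> real \<Rightarrow> ('m \<times> real \<Rightarrow> real) set" where
  "admissible \<Omega> \<Gamma>f g0 =
    {g \<in> H1_surface \<Omega> \<Gamma>f. (AE x in surface_on \<Gamma>f. 0 < g x) \<and> L2_norm (surface_on \<Gamma>f) g \<le> g0}"

end

theory Submission
  imports Defs
begin

text \<open>
  Testing the inequality of each solution with the other solution, whose trace on \<open>\<Gamma>\<^sub>f\<close> is the same,
  gives \<open>a(u\<^sub>1 - u\<^sub>2, u\<^sub>1 - u\<^sub>2) \<le> 0\<close>, so \<open>u\<^sub>1 = u\<^sub>2\<close>. Testing with \<open>(1 \<plusminus> \<psi>) u\<^sub>i\<close> for smooth \<open>0 \<le> \<psi> \<le> 1\<close>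
  gives \<open>a(u\<^sub>i, \<psi> u\<^sub>i) + \<integral> g\<^sub>i \<psi> \<bar>u\<^sub>i\<bar> ds = \<langle>f, \<psi> u\<^sub>i\<rangle>\<close>; the difference of the two equations is
  \<open>\<integral> (g\<^sub>1 - g\<^sub>2) \<bar>u\<^sub>1\<bar> \<psi> ds = 0\<close> for all such \<open>\<psi>\<close>, and \<open>u\<^sub>1 \<noteq> 0\<close> a.e. on \<open>\<Gamma>\<^sub>f\<close>.

  Identifying the trace of \<open>(1 \<plusminus> \<psi>) u\<^sub>i\<close> requires uniqueness of traces. If smooth \<open>w\<^sub>k\<close> tend to \<open>0\<close> fast in
  \<open>H\<^sup>1(\<Omega>)\<close>, then integrating along the vertical lines of a chart shows that \<open>w\<^sub>k\<close> tends to \<open>0\<close> at almost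
  every point of the graph, because Lipschitz graph maps send Lebesgue null sets to surface null sets.
\<close>

section \<open>Hausdorff measure\<close>

text \<open>The surface measure lives on the Caratheodory sets of an outer measure, while smooth
  multipliers \<open>\<psi>\<close> detect only Borel sets, and the coefficients are measurable
  merely for the former. Two facts about Hausdorff measure bridge this: Borel sets are Caratheodory
  sets, and sets of finite measure have Borel hulls up to a null set. The absolute value obstructs
  an equation, since \<open>j\<close> is not differentiable where the trace vanishes. Perturbing
  \<open>u\<close> by \<open>\<psi> * u\<close> avoids this: the factors \<open>1 + \<psi>\<close>
  and \<open>1 - \<psi>\<close> are nonnegative, so the perturbed trace keeps its sign. The price is
  that only the product of the coefficient with \<open>\<bar>u\<bar>\<close> is determined; that is
  where the hypothesis on the zero sets enters. \<open>grad\<close> and \<open>sobolev_trace\<close>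
  are arbitrary choices, so neither is literally linear. Computations replace them by explicit
  representatives, which costs a uniqueness theorem for each. For traces, the approximations are
  thinned out until their errors are summable, which makes the convergence pointwise.\<close>

abbreviation hausdorff_size :: "nat \<Rightarrow> 'a::euclidean_space set \<Rightarrow> ennreal" where
  "hausdorff_size d C \<equiv> ennreal (unit_ball_vol (real d) * (diameter C / 2) ^ d)"

abbreviation fine_covers :: "real \<Rightarrow> 'a::euclidean_space set \<Rightarrow> (nat \<Rightarrow> 'a set) set" where
  "fine_covers \<delta> A \<equiv> {C. A \<subseteq> (\<Union>i. C i) \<and> (\<forall>i. bounded (C i) \<and> diameter (C i) \<le> \<delta>)}"

text \<open>Estimates are made at a fixed scale \<open>\<delta>\<close> and the supremum is taken
  afterwards, because covers chosen at different scales are unrelated.\<close>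

definition hausdorff_pre :: "nat \<Rightarrow> real \<Rightarrow> 'a::euclidean_space set \<Rightarrow> ennreal" where
  "hausdorff_pre d \<delta> A = (INF C\<in>fine_covers \<delta> A. \<Sum>i. hausdorff_size d (C i))"

lemma hausdorff_outer_eq_SUP: "hausdorff_outer d A = (SUP \<delta>\<in>{0<..}. hausdorff_pre d \<delta> A)"
  unfolding hausdorff_outer_def hausdorff_pre_def ..

lemma hausdorff_pre_le_outer: "0 < \<delta> \<Longrightarrow> hausdorff_pre d \<delta> A \<le> hausdorff_outer d A"
  unfolding hausdorff_outer_eq_SUP by (rule SUP_upper) simp

lemma hausdorff_outer_leI: "(\<And>\<delta>. 0 < \<delta> \<Longrightarrow> hausdorff_pre d \<delta> A \<le> c) \<Longrightarrow> hausdorff_outer d A \<le> c"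
  unfolding hausdorff_outer_eq_SUP by (rule SUP_least) simp

lemma hausdorff_pre_leI: "C \<in> fine_covers \<delta> A \<Longrightarrow> hausdorff_pre d \<delta> A \<le> (\<Sum>i. hausdorff_size d (C i))"
  unfolding hausdorff_pre_def by (rule INF_lower)

lemma hausdorff_pre_mono: "A \<subseteq> B \<Longrightarrow> hausdorff_pre d \<delta> A \<le> hausdorff_pre d \<delta> B"
  unfolding hausdorff_pre_def by (rule INF_superset_mono) auto

lemma hausdorff_pre_antimono: "\<delta> \<le> \<epsilon> \<Longrightarrow> hausdorff_pre d \<epsilon> A \<le> hausdorff_pre d \<delta> A"
  unfolding hausdorff_pre_def by (rule INF_superset_mono) (auto intro: order_trans)

lemma hausdorff_outer_mono: "A \<subseteq> B \<Longrightarrow> hausdorff_outer d A \<le> hausdorff_outer d B"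
  unfolding hausdorff_outer_eq_SUP by (rule SUP_subset_mono) (auto intro: hausdorff_pre_mono)

text \<open>Positive dimension lets empty sets pad a cover at no cost, whereas
  \<open>0 ^ 0 = 1\<close> would charge for each of them.\<close>

lemma hausdorff_size_empty: "0 < d \<Longrightarrow> hausdorff_size d {} = 0"
  by (simp add: diameter_def)

lemma hausdorff_outer_empty:
  assumes "0 < d"
  shows "hausdorff_outer d {} = 0"
proof -
  have "hausdorff_pre d \<delta> ({}::'a set) \<le> (\<Sum>i::nat. hausdorff_size d ({}::'a set))" if "0 < \<delta>" for \<delta>
    using that by (intro hausdorff_pre_leI) (auto simp: diameter_def)
  then have "hausdorff_pre d \<delta> ({}::'a set) \<le> 0" if "0 < \<delta>" for \<delta>
    unfolding hausdorff_size_empty[OF assms] using that by simp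
  then have "hausdorff_outer d ({}::'a set) \<le> 0"
    by (rule hausdorff_outer_leI)
  then show ?thesis by simp
qed

lemma hausdorff_pre_approx:
  assumes "hausdorff_pre d \<delta> A < \<infinity>" "0 < e"
  shows "\<exists>C. C \<in> fine_covers \<delta> A \<and> (\<Sum>i. hausdorff_size d (C i)) \<le> hausdorff_pre d \<delta> A + ennreal e"
proof -
  have "hausdorff_pre d \<delta> A < hausdorff_pre d \<delta> A + ennreal e"
    using assms by (auto simp: ennreal_add_left_cancel_less[of _ 0, simplified] less_top)
  then obtain C where "C \<in> fine_covers \<delta> A"
    "(\<Sum>i. hausdorff_size d (C i)) < hausdorff_pre d \<delta> A + ennreal e"
    unfolding hausdorff_pre_def INF_less_iff by blast
  then show ?thesis
    by (intro exI[of _ C] conjI less_imp_le)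
qed

lemma hausdorff_pre_countable_subadditive:
  "hausdorff_pre d \<delta> (\<Union>n. A n) \<le> (\<Sum>n. hausdorff_pre d \<delta> (A n))"
proof (cases "\<exists>n. hausdorff_pre d \<delta> (A n) = \<infinity>")
  case True
  then obtain n where "hausdorff_pre d \<delta> (A n) = \<infinity>" by blast
  with ennreal_suminf_lessD[of "\<lambda>n. hausdorff_pre d \<delta> (A n)" \<infinity> n] show ?thesis
    by (metis top.not_eq_extremum infinity_ennreal_def top_greatest)
next
  case False
  show ?thesis
  proof (rule ennreal_le_epsilon)
    fix e :: real assume "0 < e"
    \<comment> \<open>Each set gets a cover with excess \<open>e / 2 ^ (n + 1)\<close>; these
      excesses sum to \<open>e\<close>.\<close>
    have "\<exists>C. C \<in> fine_covers \<delta> (A n) \<and>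
      (\<Sum>i. hausdorff_size d (C i)) \<le> hausdorff_pre d \<delta> (A n) + ennreal (e * (1 / 2) ^ Suc n)" for n
    proof -
      have "hausdorff_pre d \<delta> (A n) < \<infinity>" "0 < e * (1 / 2) ^ Suc n"
        using False \<open>0 < e\<close> by (auto simp: less_top)
      then show ?thesis by (rule hausdorff_pre_approx)
    qed
    then have "\<forall>n. \<exists>C. C \<in> fine_covers \<delta> (A n) \<and>
      (\<Sum>i. hausdorff_size d (C i)) \<le> hausdorff_pre d \<delta> (A n) + ennreal (e * (1 / 2) ^ Suc n)" ..
    from choice[OF this] obtain C where "\<forall>n. C n \<in> fine_covers \<delta> (A n) \<and>
      (\<Sum>i. hausdorff_size d (C n i)) \<le> hausdorff_pre d \<delta> (A n) + ennreal (e * (1 / 2) ^ Suc n)" ..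
    note C = this[rule_format, THEN conjunct1] this[rule_format, THEN conjunct2]
    \<comment> \<open>The double sequence of covers is merged into one by the pairing bijection,
      which does not affect sums of nonnegative terms.\<close>
    let ?D = "\<lambda>k. case prod_decode k of (n, i) \<Rightarrow> C n i"
    have "?D \<in> fine_covers \<delta> (\<Union>n. A n)"
    proof safe
      fix x n assume "x \<in> A n"
      then obtain i where "x \<in> C n i" using C(1)[of n] by blast
      then show "x \<in> (\<Union>k. ?D k)"
        by (intro UN_I[of "prod_encode (n, i)"]) auto
    next
      fix k show "bounded (?D k)" "diameter (?D k) \<le> \<delta>"
        using C(1) by (auto split: prod.split)
    qed
    then have "hausdorff_pre d \<delta> (\<Union>n. A n) \<le> (\<Sum>k. hausdorff_size d (?D k))"
      by (rule hausdorff_pre_leI)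
    also have "\<dots> = (\<Sum>n. \<Sum>i. hausdorff_size d (C n i))"
      using suminf_ennreal_2dimen[of "\<lambda>n. \<Sum>i. hausdorff_size d (C n i)" "\<lambda>(n, i). hausdorff_size d (C n i)"]
      by (simp add: comp_def case_prod_unfold)
    also have "\<dots> \<le> (\<Sum>n. hausdorff_pre d \<delta> (A n) + ennreal (e * (1 / 2) ^ Suc n))"
      using C(2) by (intro suminf_le) auto
    also have "\<dots> = (\<Sum>n. hausdorff_pre d \<delta> (A n)) + (\<Sum>n. ennreal (e * (1 / 2) ^ Suc n))"
      by (subst suminf_add[symmetric]) auto
    also have "(\<Sum>n. ennreal (e * (1 / 2) ^ Suc n)) = ennreal e"
      using \<open>0 < e\<close> sums_mult[OF power_half_series, of e]
      by (subst suminf_ennreal_eq[where x = e]) auto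
    finally show "hausdorff_pre d \<delta> (\<Union>n. A n) \<le> (\<Sum>n. hausdorff_pre d \<delta> (A n)) + ennreal e" .
  qed
qed

lemma hausdorff_outer_countable_subadditive:
  "hausdorff_outer d (\<Union>n. A n) \<le> (\<Sum>n. hausdorff_outer d (A n))"
proof (rule hausdorff_outer_leI)
  fix \<delta> :: real assume "0 < \<delta>"
  have "hausdorff_pre d \<delta> (\<Union>n. A n) \<le> (\<Sum>n. hausdorff_pre d \<delta> (A n))"
    by (rule hausdorff_pre_countable_subadditive)
  also have "\<dots> \<le> (\<Sum>n. hausdorff_outer d (A n))"
    using \<open>0 < \<delta>\<close> by (intro suminf_le hausdorff_pre_le_outer) auto
  finally show "hausdorff_pre d \<delta> (\<Union>n. A n) \<le> (\<Sum>n. hausdorff_outer d (A n))" .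
qed

lemma hausdorff_outer_measure_space:
  "0 < d \<Longrightarrow> outer_measure_space (Pow UNIV) (hausdorff_outer d)"
  unfolding outer_measure_space_def
  by (auto simp: positive_def increasing_def countably_subadditive_def hausdorff_outer_empty
        intro: hausdorff_outer_mono hausdorff_outer_countable_subadditive)

lemma hausdorff_outer_Un_le:
  assumes "0 < d"
  shows "hausdorff_outer d (A \<union> B :: 'a::euclidean_space set) \<le> hausdorff_outer d A + hausdorff_outer d B"
proof -
  interpret algebra UNIV "Pow UNIV :: 'a set set" by (rule algebra_Pow)
  have "subadditive (Pow UNIV) (hausdorff_outer d :: 'a set \<Rightarrow> ennreal)"
    using countably_subadditive_subadditive[of "hausdorff_outer d"] hausdorff_outer_measure_space[OF assms]
    by (auto simp: outer_measure_space_def)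
  \<comment> \<open>\<open>subadditive\<close> speaks of disjoint sets, hence \<open>B - A\<close>
    in place of \<open>B\<close>.\<close>
  then have "hausdorff_outer d (A \<union> (B - A)) \<le> hausdorff_outer d A + hausdorff_outer d (B - A)"
    by (rule subadditiveD) auto
  also have "\<dots> \<le> hausdorff_outer d A + hausdorff_outer d B"
    by (intro add_left_mono hausdorff_outer_mono) auto
  finally show ?thesis by simp
qed

section \<open>Caratheodory measurability and null sets\<close>

lemma measure_space_hausdorff:
  assumes "0 < d"
  shows "measure_space (UNIV :: 'a::euclidean_space set)
    (lambda_system UNIV (Pow UNIV) (hausdorff_outer d)) (hausdorff_outer d)"
proof -
  interpret sigma_algebra UNIV "Pow UNIV :: 'a set set" by (rule sigma_algebra_Pow)
  show ?thesis by (rule caratheodory_lemma[OF hausdorff_outer_measure_space[OF assms]])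
qed

lemma space_hausdorff_measure: "space (hausdorff_measure d) = UNIV"
  by (simp add: hausdorff_measure_def space_measure_of_conv)

lemma sets_hausdorff_measure:
  assumes "0 < d"
  shows "sets (hausdorff_measure d) = lambda_system UNIV (Pow UNIV) (hausdorff_outer d)"
  using measure_space_hausdorff[OF assms] sigma_algebra.sigma_sets_eq
  unfolding hausdorff_measure_def by (subst sets_measure_of) (auto simp: measure_space_def)

text \<open>Subadditivity supplies the opposite inequality, so one inequality is left of the
  Caratheodory condition.\<close>

lemma in_sets_hausdorff_iff:
  assumes "0 < d"
  shows "A \<in> sets (hausdorff_measure d) \<longleftrightarrow>
    (\<forall>E. hausdorff_outer d (E \<inter> A) + hausdorff_outer d (E - A) \<le> hausdorff_outer d E)"
proof -
  have *: "hausdorff_outer d E \<le> hausdorff_outer d (E \<inter> A) + hausdorff_outer d (E - A)" for E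
    using hausdorff_outer_Un_le[OF assms, of "E \<inter> A" "E - A"] by (simp add: Int_Diff_Un)
  show ?thesis
    unfolding sets_hausdorff_measure[OF assms] algebra.lambda_system_eq[OF algebra_Pow]
    using * by (auto simp: Int_commute Diff_Int_distrib intro: antisym)
qed

lemma emeasure_hausdorff_measure:
  assumes "0 < d" "A \<in> sets (hausdorff_measure d)"
  shows "emeasure (hausdorff_measure d) A = hausdorff_outer d A"
proof -
  have "A \<in> lambda_system UNIV (Pow UNIV) (hausdorff_outer d)"
    using assms by (simp only: sets_hausdorff_measure)
  then show ?thesis
    using measure_space_hausdorff[OF assms(1)]
    unfolding hausdorff_measure_def by (intro emeasure_measure_of_sigma) (auto simp: measure_space_def)
qed

text \<open>A set of outer measure zero splits every set by monotonicity alone. Exceptional sets on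
  the boundary can therefore be handled by outer estimates.\<close>

lemma hausdorff_null_setsI:
  assumes "0 < d" "hausdorff_outer d N = 0"
  shows "N \<in> null_sets (hausdorff_measure d)"
proof -
  have "N \<in> sets (hausdorff_measure d)"
    unfolding in_sets_hausdorff_iff[OF assms(1)]
  proof
    fix E
    have "hausdorff_outer d (E \<inter> N) = 0"
      using hausdorff_outer_mono[of "E \<inter> N" N d] assms(2) by auto
    then show "hausdorff_outer d (E \<inter> N) + hausdorff_outer d (E - N) \<le> hausdorff_outer d E"
      using hausdorff_outer_mono[of "E - N" E d] by auto
  qed
  with assms show ?thesis by (simp add: null_sets_def emeasure_hausdorff_measure)
qed

text \<open>A set of small diameter cannot meet two sets at positive distance, so Hausdorff measure is a
  metric outer measure and Caratheodory's criterion applies.\<close>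

lemma hausdorff_outer_separated:
  fixes A B :: "'a::euclidean_space set"
  assumes d: "0 < d" and e: "0 < e" and sep: "\<And>x y. x \<in> A \<Longrightarrow> y \<in> B \<Longrightarrow> e \<le> dist x y"
  shows "hausdorff_outer d A + hausdorff_outer d B \<le> hausdorff_outer d (A \<union> B)"
proof -
  have pre: "hausdorff_pre d \<delta> A + hausdorff_pre d \<delta> B \<le> hausdorff_pre d \<delta> (A \<union> B)" if \<delta>: "0 < \<delta>" "\<delta> < e" for \<delta>
    unfolding hausdorff_pre_def[of d \<delta> "A \<union> B"]
  proof (rule INF_greatest)
    fix C assume C: "C \<in> fine_covers \<delta> (A \<union> B)"
    \<comment> \<open>Members that miss \<open>A\<close> (or \<open>B\<close>) are replaced by the
      empty set, which has size 0, so the cover splits without being reindexed.\<close>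
    let ?CA = "\<lambda>i. if C i \<inter> A \<noteq> {} then C i else {}"
    let ?CB = "\<lambda>i. if C i \<inter> B \<noteq> {} then C i else {}"
    have one: "C i \<inter> A = {} \<or> C i \<inter> B = {}" for i
    proof (rule ccontr)
      assume "\<not> ?thesis"
      then obtain x y where "x \<in> C i" "x \<in> A" "y \<in> C i" "y \<in> B" by blast
      then have "dist x y \<le> diameter (C i)" "diameter (C i) \<le> \<delta>"
        using C diameter_bounded_bound[of "C i" x y] by auto
      with sep[OF \<open>x \<in> A\<close> \<open>y \<in> B\<close>] \<delta> show False by linarith
    qed
    have emp: "diameter ({}::'a set) = 0" by (simp add: diameter_def)
    have C': "A \<union> B \<subseteq> (\<Union>i. C i)" "bounded (C i)" "diameter (C i) \<le> \<delta>" for i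
      using C by auto
    have "A \<subseteq> (\<Union>i. ?CA i)" "B \<subseteq> (\<Union>i. ?CB i)"
      using C'(1) by (fastforce split: if_splits)+
    then have "?CA \<in> fine_covers \<delta> A" "?CB \<in> fine_covers \<delta> B"
      using C'(2,3) \<delta> by (auto simp: emp)
    from this[THEN hausdorff_pre_leI]
    have "hausdorff_pre d \<delta> A \<le> (\<Sum>i. hausdorff_size d (?CA i))"
      "hausdorff_pre d \<delta> B \<le> (\<Sum>i. hausdorff_size d (?CB i))" .
    then have "hausdorff_pre d \<delta> A + hausdorff_pre d \<delta> B \<le>
        (\<Sum>i. hausdorff_size d (?CA i)) + (\<Sum>i. hausdorff_size d (?CB i))"
      by (rule add_mono)
    also have "\<dots> = (\<Sum>i. hausdorff_size d (?CA i) + hausdorff_size d (?CB i))"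
      by (rule suminf_add) auto
    also have "\<dots> \<le> (\<Sum>i. hausdorff_size d (C i))"
      using one d by (intro suminf_le) (auto simp: emp zero_power)
    finally show "hausdorff_pre d \<delta> A + hausdorff_pre d \<delta> B \<le> (\<Sum>i. hausdorff_size d (C i))" .
  qed
  have "hausdorff_pre d \<delta> A + hausdorff_pre d \<epsilon> B \<le> hausdorff_outer d (A \<union> B)"
    if "0 < \<delta>" "0 < \<epsilon>" for \<delta> \<epsilon>
  proof -
    \<comment> \<open>The two suprema range over independent scales; \<open>hausdorff_pre\<close>
      grows as the scale shrinks, so both terms are compared at a common scale below
      \<open>e\<close>.\<close>
    define \<eta> where "\<eta> = min (min \<delta> \<epsilon>) (e / 2)"
    have \<eta>: "0 < \<eta>" "\<eta> < e" "\<eta> \<le> \<delta>" "\<eta> \<le> \<epsilon>" using that e by (auto simp: \<eta>_def)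
    have "hausdorff_pre d \<delta> A + hausdorff_pre d \<epsilon> B \<le> hausdorff_pre d \<eta> A + hausdorff_pre d \<eta> B"
      using \<eta> by (intro add_mono hausdorff_pre_antimono)
    also have "\<dots> \<le> hausdorff_pre d \<eta> (A \<union> B)" using \<eta> by (intro pre)
    also have "\<dots> \<le> hausdorff_outer d (A \<union> B)" using \<eta> by (intro hausdorff_pre_le_outer)
    finally show ?thesis .
  qed
  then show ?thesis
    unfolding hausdorff_outer_eq_SUP[of d A] hausdorff_outer_eq_SUP[of d B]
    by (simp add: ennreal_SUP_add_left[symmetric] ennreal_SUP_add_right SUP_le_iff)
qed

text \<open>The separation \<open>e\<close> may depend on \<open>n\<close>: induction splits off one
  set at a time from finitely many earlier ones, and only then does their number tend to
  infinity.\<close>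

lemma hausdorff_outer_separated_UN:
  fixes A :: "nat \<Rightarrow> 'a::euclidean_space set"
  assumes d: "0 < d"
    and sep: "\<And>n. \<exists>e>0. \<forall>m<n. \<forall>x\<in>A m. \<forall>y\<in>A n. e \<le> dist x y"
  shows "(\<Sum>n. hausdorff_outer d (A n)) \<le> hausdorff_outer d (\<Union>n. A n)"
proof (rule suminf_le_const)
  fix N
  have "(\<Sum>n<N. hausdorff_outer d (A n)) \<le> hausdorff_outer d (\<Union>n<N. A n)"
  proof (induction N)
    case (Suc N)
    obtain e where e: "e > 0" "\<forall>m<N. \<forall>x\<in>A m. \<forall>y\<in>A N. e \<le> dist x y"
      using sep by blast
    have "(\<Sum>n<Suc N. hausdorff_outer d (A n)) \<le> hausdorff_outer d (\<Union>n<N. A n) + hausdorff_outer d (A N)"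
      using Suc.IH by (simp add: add_right_mono)
    also have "\<dots> \<le> hausdorff_outer d ((\<Union>n<N. A n) \<union> A N)"
      using e by (intro hausdorff_outer_separated[OF d, of e]) auto
    also have "(\<Union>n<N. A n) \<union> A N = (\<Union>n<Suc N. A n)"
      by (auto simp: less_Suc_eq)
    finally show ?case .
  qed simp
  also have "\<dots> \<le> hausdorff_outer d (\<Union>n. A n)"
    by (rule hausdorff_outer_mono) auto
  finally show "(\<Sum>n<N. hausdorff_outer d (A n)) \<le> hausdorff_outer d (\<Union>n. A n)" .
qed auto

lemma ennreal_suminf_tail:
  fixes f :: "nat \<Rightarrow> ennreal"
  assumes "(\<Sum>n. f n) < \<infinity>"
  shows "(\<lambda>n. \<Sum>k. f (k + n)) \<longlonglongrightarrow> 0"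
proof -
  have fin: "f n < \<infinity>" for n
    using ennreal_suminf_lessD[OF assms] .
  define g where "g n = enn2real (f n)" for n
  have f: "f = (\<lambda>n. ennreal (g n))" and g0: "0 \<le> g n" for n
    using fin by (auto simp: g_def less_top)
  have "summable g"
    using assms unfolding f by (intro summable_suminf_not_top g0) auto
  then have "(\<lambda>n. \<Sum>k. g (k + n)) \<longlonglongrightarrow> 0"
    by (rule suminf_exist_split2)
  then have "(\<lambda>n. ennreal (\<Sum>k. g (k + n))) \<longlonglongrightarrow> ennreal 0"
    by (rule tendsto_ennrealI)
  moreover have "ennreal (\<Sum>k. g (k + n)) = (\<Sum>k. f (k + n))" for n
    unfolding f using \<open>summable g\<close> g0 by (intro suminf_ennreal2[symmetric]) (simp_all add: summable_iff_shift)
  ultimately show ?thesis by simp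
qed

lemma closed_in_sets_hausdorff:
  fixes F :: "'a::euclidean_space set"
  assumes d: "0 < d" and F: "closed F"
  shows "F \<in> sets (hausdorff_measure d)"
proof (cases "F = {}")
  case True
  then show ?thesis by simp
next
  case False
  show ?thesis
    unfolding in_sets_hausdorff_iff[OF d]
  proof
    fix E :: "'a set"
    let ?H = "hausdorff_outer d"
    show "?H (E \<inter> F) + ?H (E - F) \<le> ?H E"
    proof (cases "?H E = \<infinity>")
      case fin: False
      \<comment> \<open>\<open>G n\<close> is positively separated from \<open>E \<inter> F\<close>,
        and the shells \<open>R k\<close> with \<open>k \<ge> n\<close> fill the rest of
        \<open>E - F\<close>. What has to be shown is that the shells have summable outer
        measure.\<close>
      define G where "G n = {x \<in> E. 1 / real (Suc n) \<le> infdist x F}" for n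
      define R where "R n = {x \<in> E. 1 / real (Suc (Suc n)) \<le> infdist x F \<and> infdist x F < 1 / real (Suc n)}" for n
      have gap: "1 / real (Suc m) - 1 / real n \<le> dist x y"
        if "1 / real (Suc m) \<le> infdist x F" "infdist y F < 1 / real n" for x y m n
        using that infdist_triangle[of x F y] by linarith
      \<comment> \<open>Neighbouring shells touch, but shells whose indices have equal parity are
        kept apart by a full shell between them.\<close>
      have Rsum: "(\<Sum>k. ?H (R (2 * k + j))) \<le> ?H E" for j
      proof -
        have "(\<Sum>k. ?H (R (2 * k + j))) \<le> ?H (\<Union>k. R (2 * k + j))"
        proof (rule hausdorff_outer_separated_UN[OF d])
          fix n
          \<comment> \<open>The width of shell \<open>2 * n + j - 1\<close>, which lies between. The
            case \<open>n = 0\<close> has no earlier shells and is treated apart, since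
            \<open>1 / 0 = 0\<close> can make \<open>e\<close> negative.\<close>
          define e where "e = 1 / real (2 * n + j) - 1 / real (Suc (2 * n + j))"
          show "\<exists>e>0. \<forall>m<n. \<forall>x\<in>R (2 * m + j). \<forall>y\<in>R (2 * n + j). e \<le> dist x y"
          proof (cases "n = 0")
            case False
            show ?thesis
            proof (intro exI[of _ e] conjI allI impI ballI)
              have "0 < real (2 * n + j)" using False by simp
              then show "0 < e" unfolding e_def by (simp add: frac_less2 del: of_nat_add of_nat_mult)
              fix m x y assume "m < n" and x: "x \<in> R (2 * m + j)" and y: "y \<in> R (2 * n + j)"
              then have "real (Suc (Suc (2 * m + j))) \<le> real (2 * n + j)" by linarith
              then have "1 / real (2 * n + j) \<le> 1 / real (Suc (Suc (2 * m + j)))"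
                by (intro divide_left_mono) auto
              with gap[of "Suc (2 * m + j)" x y "Suc (2 * n + j)"] x y
              show "e \<le> dist x y" by (simp add: R_def e_def)
            qed
          qed (auto intro: exI[of _ 1])
        qed
        also have "\<dots> \<le> ?H E" by (rule hausdorff_outer_mono) (auto simp: R_def)
        finally show ?thesis .
      qed
      \<comment> \<open>Even and odd shells each contribute at most \<open>?H E\<close>, which is
        finite here.\<close>
      have "(\<Sum>n. ?H (R n)) < \<infinity>"
      proof -
        have "(\<Sum>n<N. ?H (R n)) \<le> ?H E + ?H E" for N
        proof -
          have "(\<Sum>n<N. ?H (R n)) \<le> (\<Sum>n<2 * N. ?H (R n))"
            by (rule sum_mono2) auto
          also have "\<dots> = (\<Sum>k<N. ?H (R (2 * k + 0))) + (\<Sum>k<N. ?H (R (2 * k + 1)))"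
            by (induction N) (auto simp: algebra_simps)
          also have "\<dots> \<le> ?H E + ?H E"
            by (intro add_mono order_trans[OF sum_le_suminf Rsum]) auto
          finally show ?thesis .
        qed
        then have "(\<Sum>n. ?H (R n)) \<le> ?H E + ?H E" by (intro suminf_le_const) auto
        also have "\<dots> < \<infinity>" using fin by (simp add: less_top)
        finally show ?thesis .
      qed
      then have tail: "(\<lambda>n. \<Sum>k. ?H (R (k + n))) \<longlonglongrightarrow> 0"
        by (rule ennreal_suminf_tail)
      have "?H (E \<inter> F) + ?H (E - F) \<le> ?H E + (\<Sum>k. ?H (R (k + n)))" for n
      proof -
        have "E - F \<subseteq> G n \<union> (\<Union>k. R (k + n))"
        proof
          fix x assume x: "x \<in> E - F"
          then have pos: "0 < infdist x F"
            using F False in_closed_iff_infdist_zero[of F x] infdist_nonneg[of x F] by auto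
          show "x \<in> G n \<union> (\<Union>k. R (k + n))"
          proof (cases "x \<in> G n")
            case nG: False
            define P where "P m \<longleftrightarrow> 1 / real (Suc m) \<le> infdist x F" for m
            obtain m0 where "inverse (real (Suc m0)) < infdist x F"
              using reals_Archimedean[OF pos] by blast
            then have "P m0" by (simp add: P_def inverse_eq_divide)
            \<comment> \<open>Not being in \<open>G n\<close> forces \<open>n < m\<close>, and
              minimality of \<open>m\<close> puts \<open>x\<close> into shell
              \<open>m - 1\<close>.\<close>
            define m where "m = (LEAST m. P m)"
            have m: "P m" "\<And>k. k < m \<Longrightarrow> \<not> P k"
              unfolding m_def using \<open>P m0\<close> by (rule LeastI, blast dest: not_less_Least)
            have "\<not> P n" using nG x by (auto simp: G_def P_def)
            have "n < m"
            proof (rule ccontr)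
              assume "\<not> n < m"
              then have "1 / real (Suc n) \<le> 1 / real (Suc m)" by (simp add: field_simps)
              with m(1) \<open>\<not> P n\<close> show False by (simp add: P_def)
            qed
            then obtain k where k: "m = Suc (k + n)"
              by (metis add.commute less_imp_Suc_add)
            have "x \<in> R (k + n)"
              using m(1) m(2)[of "k + n"] x k by (simp add: R_def P_def)
            then show ?thesis by blast
          qed simp
        qed
        then have "?H (E - F) \<le> ?H (G n) + ?H (\<Union>k. R (k + n))"
          by (rule order_trans[OF hausdorff_outer_mono hausdorff_outer_Un_le[OF d]])
        also have "\<dots> \<le> ?H (G n) + (\<Sum>k. ?H (R (k + n)))"
          by (intro add_left_mono hausdorff_outer_countable_subadditive)
        finally have "?H (E \<inter> F) + ?H (E - F) \<le> (?H (E \<inter> F) + ?H (G n)) + (\<Sum>k. ?H (R (k + n)))"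
          by (simp add: add.assoc add_left_mono)
        also have "?H (E \<inter> F) + ?H (G n) \<le> ?H ((E \<inter> F) \<union> G n)"
        proof (rule hausdorff_outer_separated[OF d, of "1 / real (Suc n)"])
          fix x y assume "x \<in> E \<inter> F" "y \<in> G n"
          then show "1 / real (Suc n) \<le> dist x y"
            using infdist_le[of x F y] by (auto simp: G_def dist_commute)
        qed simp
        also have "\<dots> \<le> ?H E" by (rule hausdorff_outer_mono) (auto simp: G_def)
        finally show ?thesis by (simp add: add_right_mono)
      qed
      then have "?H (E \<inter> F) + ?H (E - F) \<le> ?H E + 0"
        by (intro LIMSEQ_le_const[OF tendsto_add[OF tendsto_const tail]]) auto
      then show ?thesis by simp
    qed simp
  qed
qed

section \<open>Borel sets and Borel hulls\<close>

lemma borel_subset_sets_hausdorff: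
  assumes "0 < d"
  shows "sets borel \<subseteq> sets (hausdorff_measure d :: 'a::euclidean_space measure)"
proof -
  have "sigma_sets UNIV (Collect closed) \<subseteq> sets (hausdorff_measure d :: 'a measure)"
    using closed_in_sets_hausdorff[OF assms] sets.sigma_sets_subset[of "Collect closed" "hausdorff_measure d"]
    by (auto simp: space_hausdorff_measure)
  then show ?thesis by (simp add: borel_eq_closed sets_measure_of)
qed

text \<open>Closing a covering set preserves its diameter, so nearly optimal covers may be taken
  closed. Intersecting their unions over the scales \<open>1 / (n + 1)\<close> gives a Borel set
  with the outer measure of \<open>E\<close>, and finiteness turns equality of measures into a null
  difference.\<close>

lemma hausdorff_borel_hull:
  fixes E :: "'a::euclidean_space set"
  assumes d: "0 < d" and E: "E \<in> sets (hausdorff_measure d)" and fin: "emeasure (hausdorff_measure d) E < \<infinity>"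
  shows "\<exists>B\<in>sets borel. E \<subseteq> B \<and> emeasure (hausdorff_measure d) (B - E) = 0"
proof -
  let ?H = "hausdorff_outer d"
  have finH: "?H E < \<infinity>" using fin E d by (simp add: emeasure_hausdorff_measure)
  have "\<exists>C. C \<in> fine_covers (1 / Suc n) E \<and>
    (\<Sum>i. hausdorff_size d (C i)) \<le> hausdorff_pre d (1 / Suc n) E + ennreal (1 / Suc n)" for n
  proof -
    have "hausdorff_pre d (1 / Suc n) E < \<infinity>"
      using hausdorff_pre_le_outer[of "1 / Suc n" d E] finH by (simp add: le_less_trans)
    then show ?thesis by (rule hausdorff_pre_approx) simp
  qed
  then have "\<forall>n. \<exists>C. C \<in> fine_covers (1 / Suc n) E \<and>
    (\<Sum>i. hausdorff_size d (C i)) \<le> hausdorff_pre d (1 / Suc n) E + ennreal (1 / Suc n)" ..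
  from choice[OF this] obtain C where "\<forall>n. C n \<in> fine_covers (1 / Suc n) E \<and>
    (\<Sum>i. hausdorff_size d (C n i)) \<le> hausdorff_pre d (1 / Suc n) E + ennreal (1 / Suc n)" ..
  note C = this[rule_format, THEN conjunct1] this[rule_format, THEN conjunct2]
  define B where "B = (\<Inter>n. \<Union>i. closure (C n i))"
  have B: "B \<in> sets borel" unfolding B_def by (intro sets.countable_INT' sets.countable_UN) (auto simp: borel_closed)
  have EB: "E \<subseteq> B"
  proof
    fix x assume "x \<in> E"
    then have "x \<in> (\<Union>i. closure (C n i))" for n
      using C(1)[of n] closure_subset by blast
    then show "x \<in> B" by (simp add: B_def)
  qed
  have "?H B \<le> ?H E"
  proof (rule hausdorff_outer_leI)
    fix \<delta> :: real assume "0 < \<delta>"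
    have le: "hausdorff_pre d \<delta> B \<le> ?H E + ennreal (1 / Suc n)" if n: "1 / Suc n \<le> \<delta>" for n
    proof -
      have "(\<lambda>i. closure (C n i)) \<in> fine_covers \<delta> B"
        using C(1)[of n] n unfolding B_def
        by (auto simp: bounded_closure diameter_closure intro: order_trans)
      then have "hausdorff_pre d \<delta> B \<le> (\<Sum>i. hausdorff_size d (closure (C n i)))"
        by (rule hausdorff_pre_leI)
      also have "\<dots> = (\<Sum>i. hausdorff_size d (C n i))"
        using C(1)[of n] by (simp add: diameter_closure)
      also have "\<dots> \<le> hausdorff_pre d (1 / Suc n) E + ennreal (1 / Suc n)" by (rule C(2))
      also have "\<dots> \<le> ?H E + ennreal (1 / Suc n)"
        by (intro add_right_mono hausdorff_pre_le_outer) auto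
      finally show ?thesis .
    qed
    show "hausdorff_pre d \<delta> B \<le> ?H E"
    proof (rule ennreal_le_epsilon)
      fix e :: real assume "0 < e"
      obtain n where "inverse (real (Suc n)) < min \<delta> e"
        using reals_Archimedean[of "min \<delta> e"] \<open>0 < \<delta>\<close> \<open>0 < e\<close> by auto
      then have n: "1 / Suc n \<le> \<delta>" "1 / Suc n \<le> e" by (auto simp: inverse_eq_divide)
      have "hausdorff_pre d \<delta> B \<le> ?H E + ennreal (1 / Suc n)" by (rule le[OF n(1)])
      also have "\<dots> \<le> ?H E + ennreal e" using n(2) by (intro add_left_mono ennreal_leI)
      finally show "hausdorff_pre d \<delta> B \<le> ?H E + ennreal e" .
    qed
  qed
  then have "?H B = ?H E" by (rule antisym[OF _ hausdorff_outer_mono[OF EB]])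
  moreover have BM: "B \<in> sets (hausdorff_measure d)"
    using B borel_subset_sets_hausdorff[OF d] by blast
  ultimately have "emeasure (hausdorff_measure d) B = emeasure (hausdorff_measure d) E"
    using E d by (simp add: emeasure_hausdorff_measure)
  then have "emeasure (hausdorff_measure d) (B - E) = 0"
    using emeasure_Diff[OF _ BM E EB] fin by auto
  with B EB show ?thesis by blast
qed

section \<open>Smooth functions\<close>

lemma GDERIV_unique: "GDERIV f x :> D \<Longrightarrow> GDERIV f x :> D' \<Longrightarrow> D = D'"
  unfolding gderiv_def
  by (metis has_derivative_unique inner_commute vector_eq_ldot)

lemma Ck_add: "Ck k f \<Longrightarrow> Ck k g \<Longrightarrow> Ck k (\<lambda>x. f x + g x)"
proof (induction k arbitrary: f g)
  case (Suc k)
  then obtain D E where "\<forall>x. GDERIV f x :> D x" "\<forall>b\<in>Basis. Ck k (\<lambda>x. D x \<bullet> b)"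
    "\<forall>x. GDERIV g x :> E x" "\<forall>b\<in>Basis. Ck k (\<lambda>x. E x \<bullet> b)"
    by auto
  then show ?case
    unfolding Ck.simps
    by (intro exI[of _ "\<lambda>x. D x + E x"]) (auto simp: inner_add_left intro: GDERIV_add Suc.IH)
qed (simp add: continuous_on_add)

lemma Ck_const: "Ck k (\<lambda>x. c)"
proof (induction k arbitrary: c)
  case (Suc k)
  then show ?case
    unfolding Ck.simps by (intro exI[of _ "\<lambda>x. 0"]) (auto simp: GDERIV_const)
qed auto

lemma GDERIV_imp_continuous_on:
  assumes "\<And>x. GDERIV f x :> D x"
  shows "continuous_on S f"
  by (rule has_derivative_continuous_on, rule has_derivative_at_withinI)
     (rule assms[unfolded gderiv_def])

lemma Ck_imp_continuous: "Ck k f \<Longrightarrow> continuous_on UNIV f"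
proof (cases k)
  case (Suc k')
  assume "Ck k f"
  with Suc obtain D where "\<forall>x. GDERIV f x :> D x" by auto
  then show ?thesis using GDERIV_imp_continuous_on by blast
qed simp

lemma Ck_SucD: "Ck (Suc k) f \<Longrightarrow> Ck k f"
proof (induction k arbitrary: f)
  case 0
  from Ck_imp_continuous[OF this] show ?case by simp
next
  case (Suc k)
  then obtain D where D: "\<forall>x. GDERIV f x :> D x" "\<forall>b\<in>Basis. Ck (Suc k) (\<lambda>x. D x \<bullet> b)"
    unfolding Ck.simps(2)[of "Suc k" f] by (elim exE conjE)
  then have "\<forall>b\<in>Basis. Ck k (\<lambda>x. D x \<bullet> b)"
    using Suc.IH by simp
  with D(1) show ?case
    unfolding Ck.simps(2)[of k f] by (intro exI[of _ D] conjI)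
qed

lemma Ck_mult: "Ck k f \<Longrightarrow> Ck k g \<Longrightarrow> Ck k (\<lambda>x. f x * g x)"
proof (induction k arbitrary: f g)
  case (Suc k)
  then obtain D E where D: "\<forall>x. GDERIV f x :> D x" "\<forall>b\<in>Basis. Ck k (\<lambda>x. D x \<bullet> b)"
    and E: "\<forall>x. GDERIV g x :> E x" "\<forall>b\<in>Basis. Ck k (\<lambda>x. E x \<bullet> b)"
    by auto
  \<comment> \<open>The product rule leaves \<open>f\<close> and \<open>g\<close> undifferentiated,
    so the induction hypothesis is applied to them at order \<open>k\<close> as well.\<close>
  have fg: "Ck k f" "Ck k g" using Suc.prems Ck_SucD by blast+
  show ?case
    unfolding Ck.simps
  proof (intro exI[of _ "\<lambda>x. f x *\<^sub>R E x + g x *\<^sub>R D x"] conjI allI ballI)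
    show "GDERIV (\<lambda>x. f x * g x) x :> f x *\<^sub>R E x + g x *\<^sub>R D x" for x
      using D(1) E(1) by (intro GDERIV_mult) auto
    show "Ck k (\<lambda>x. (f x *\<^sub>R E x + g x *\<^sub>R D x) \<bullet> b)" if "b \<in> Basis" for b
      unfolding inner_add_left inner_scaleR_left
      using D(2) E(2) fg that by (intro Ck_add Suc.IH) auto
  qed
qed (simp add: continuous_on_mult)

lemma smooth_const: "smooth (\<lambda>x. c)"
  by (simp add: smooth_def Ck_const)

lemma smooth_add: "smooth f \<Longrightarrow> smooth g \<Longrightarrow> smooth (\<lambda>x. f x + g x)"
  by (simp add: smooth_def Ck_add)

lemma smooth_mult: "smooth f \<Longrightarrow> smooth g \<Longrightarrow> smooth (\<lambda>x. f x * g x)"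
  by (simp add: smooth_def Ck_mult)

lemma smooth_diff: "smooth f \<Longrightarrow> smooth g \<Longrightarrow> smooth (\<lambda>x. f x - g x)"
  using smooth_add[of f "\<lambda>x. (- 1) * g x"] smooth_mult[OF smooth_const, of g "- 1"] by simp

lemma smooth_power: "smooth f \<Longrightarrow> smooth (\<lambda>x. f x ^ n)"
  by (induction n) (auto intro: smooth_const smooth_mult)

lemma smooth_prod: "(\<And>i. i \<in> I \<Longrightarrow> smooth (f i)) \<Longrightarrow> smooth (\<lambda>x. \<Prod>i\<in>I. f i x)"
  by (induction I rule: infinite_finite_induct) (auto intro: smooth_const smooth_mult)

lemma smooth_continuous_on: "smooth f \<Longrightarrow> continuous_on S f"
  by (meson Ck_imp_continuous continuous_on_subset smooth_def subset_UNIV)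

lemma smooth_gderivE:
  assumes "smooth f"
  obtains D where "\<And>x. GDERIV f x :> D x" "continuous_on UNIV D"
proof -
  obtain D where D: "\<forall>x. GDERIV f x :> D x" "\<forall>b\<in>Basis. continuous_on UNIV (\<lambda>x. D x \<bullet> b)"
    using assms Ck.simps(2)[of 0 f] by (auto simp: smooth_def)
  have "continuous_on UNIV D"
    using D(2) continuous_on_componentwise by blast
  with D that show ?thesis by blast
qed

lemma smooth_gderiv_continuous_on:
  assumes "smooth f" "\<And>x. GDERIV f x :> D x"
  shows "continuous_on UNIV D"
proof -
  obtain D' where D': "\<And>x. GDERIV f x :> D' x" "continuous_on UNIV D'"
    using smooth_gderivE[OF assms(1)] by blast
  have "D' = D" using GDERIV_unique[OF D'(1) assms(2)] by blast
  with D'(2) show ?thesis by simp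
qed

text \<open>The functions \<open>t\<^sup>-\<^sup>n exp (- 1 / t)\<close> form a family closed under differentiation up to linear
  combinations.\<close>

definition flat :: "nat \<Rightarrow> real \<Rightarrow> real" where
  "flat n t = (if 0 < t then exp (- 1 / t) / t ^ n else 0)"

lemma flat_tendsto_0: "(flat n \<longlongrightarrow> 0) (at 0)"
proof -
  \<comment> \<open>Substituting \<open>x = 1 / t\<close> turns the right-hand limit into the decay
    of \<open>x ^ n / exp x\<close> at infinity.\<close>
  have "((\<lambda>x. x ^ n / exp x) \<longlongrightarrow> (0::real)) at_top"
    by (rule tendsto_power_div_exp_0)
  then have "((\<lambda>t. inverse t ^ n / exp (inverse t)) \<longlongrightarrow> (0::real)) (at_right 0)"
    by (rule filterlim_compose[OF _ filterlim_inverse_at_top_right])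
  then have "(flat n \<longlongrightarrow> 0) (at_right 0)"
    by (rule Lim_transform_eventually)
       (auto simp: eventually_at_right_less flat_def exp_minus field_simps power_inverse
             intro!: eventually_at_rightI[of 0 1])
  moreover have "(flat n \<longlongrightarrow> 0) (at_left 0)"
    by (rule tendsto_eventually) (auto simp: flat_def intro!: eventually_at_leftI[of "-1"])
  ultimately show ?thesis
    by (rule filterlim_split_at[rotated])
qed

lemma DERIV_flat: "DERIV (flat n) t :> flat (n + 2) t - real n * flat (n + 1) t"
proof -
  consider "t > 0" | "t < 0" | "t = 0" by linarith
  then show ?thesis
  proof cases
    case 1
    have "((\<lambda>t. exp (- 1 / t) / t ^ n) has_real_derivative
        (exp (- 1 / t) * (1 / t ^ 2) * t ^ n - exp (- 1 / t) * (real n * t ^ (n - 1))) / (t ^ n * t ^ n)) (at t)"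
      using 1 by (auto intro!: derivative_eq_intros simp: power2_eq_square)
    moreover have "(exp (- 1 / t) * (1 / t ^ 2) * t ^ n - exp (- 1 / t) * (real n * t ^ (n - 1))) / (t ^ n * t ^ n)
        = flat (n + 2) t - real n * flat (n + 1) t"
      using 1 by (cases n) (auto simp: flat_def field_simps power2_eq_square)
    ultimately have "((\<lambda>t. exp (- 1 / t) / t ^ n) has_real_derivative
        (flat (n + 2) t - real n * flat (n + 1) t)) (at t)"
      by simp
    then show ?thesis
      by (rule has_field_derivative_transform_within_open[where S = "{0<..}"])
         (use 1 in \<open>auto simp: flat_def\<close>)
  next
    case 2
    have "((\<lambda>t. 0) has_real_derivative 0) (at t)" by simp
    then have "(flat n has_real_derivative 0) (at t)"
      by (rule has_field_derivative_transform_within_open[where S = "{..<0}"])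
         (use 2 in \<open>auto simp: flat_def\<close>)
    then show ?thesis
      using 2 by (simp add: flat_def)
  next
    case 3
    \<comment> \<open>At 0 the difference quotient of \<open>flat n\<close> is
      \<open>flat (Suc n)\<close>, so its limit is already known.\<close>
    have "((\<lambda>h. (flat n (0 + h) - flat n 0) / h) \<longlongrightarrow> 0) (at 0)"
      by (rule Lim_transform_eventually[OF flat_tendsto_0[of "Suc n"]])
         (auto simp: eventually_at_filter flat_def)
    then show ?thesis using 3 by (simp add: DERIV_def flat_def)
  qed
qed

lemma GDERIV_flat:
  "GDERIV (\<lambda>x. flat n (x \<bullet> i - c)) x :>
    (flat (n + 2) (x \<bullet> i - c) + (- real n) * flat (n + 1) (x \<bullet> i - c)) *\<^sub>R i"
proof -
  have "GDERIV (\<lambda>x. x \<bullet> i - c) x :> i"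
    unfolding gderiv_def by (auto intro!: derivative_eq_intros simp: inner_commute)
  from GDERIV_DERIV_compose[OF this DERIV_flat] show ?thesis by simp
qed

lemma Ck_flat: "Ck k (\<lambda>x::'a::euclidean_space. flat n (x \<bullet> i - c))"
proof (induction k arbitrary: n)
  case 0
  show ?case
    unfolding Ck.simps by (rule GDERIV_imp_continuous_on[OF GDERIV_flat])
next
  case (Suc k)
  have "Ck k (\<lambda>x. (flat (n + 2) (x \<bullet> i - c) + (- real n) * flat (n + 1) (x \<bullet> i - c)) * (i \<bullet> b))" for b
    by (intro Ck_mult Ck_add Suc.IH Ck_const)
  then show ?case
    unfolding Ck.simps using GDERIV_flat[of n i c] by (intro exI conjI allI) auto
qed

text \<open>The direction \<open>- i\<close> turns the upper face into a lower one, so the one-sided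
  functions of \<open>Ck_flat\<close> serve both.\<close>

definition box_bump :: "'a::euclidean_space \<Rightarrow> 'a \<Rightarrow> 'a \<Rightarrow> real" where
  "box_bump a b x = (\<Prod>i\<in>Basis. flat 0 (x \<bullet> i - a \<bullet> i) * flat 0 (x \<bullet> (- i) - b \<bullet> (- i)))"

lemma smooth_box_bump: "smooth (box_bump a b)"
proof -
  have *: "smooth (\<lambda>x. flat 0 (x \<bullet> i - c))" for i :: 'a and c
    unfolding smooth_def by (rule allI, rule Ck_flat)
  show ?thesis
    unfolding box_bump_def by (rule smooth_prod, rule smooth_mult) (rule *)+
qed

lemma box_bump_range: "0 \<le> box_bump a b x" "box_bump a b x \<le> 1"
proof -
  have *: "0 \<le> flat 0 s * flat 0 t \<and> flat 0 s * flat 0 t \<le> 1" for s t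
    by (auto simp: flat_def intro!: mult_le_one)
  show "0 \<le> box_bump a b x"
    unfolding box_bump_def by (rule prod_nonneg) (use * in blast)
  show "box_bump a b x \<le> 1"
    unfolding box_bump_def by (rule prod_le_1) (use * in blast)
qed

lemma box_bump_eq_0_iff: "box_bump a b x = 0 \<longleftrightarrow> x \<notin> box a b"
proof -
  have "flat 0 s * flat 0 t = 0 \<longleftrightarrow> \<not> (0 < s \<and> 0 < t)" for s t
    by (auto simp: flat_def)
  then show ?thesis
    unfolding box_bump_def by (simp add: mem_box)
qed

lemma test_fun_box_bump:
  assumes "cbox a b \<subseteq> U"
  shows "test_fun U (box_bump a b)"
proof -
  have *: "{x. box_bump a b x \<noteq> 0} = box a b"
    by (simp add: box_bump_eq_0_iff)
  have "closure (box a b) \<subseteq> cbox a b"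
    by (rule closure_minimal[OF box_subset_cbox closed_cbox])
  then show ?thesis
    unfolding test_fun_def * using assms smooth_box_bump compact_closure bounded_box by blast
qed

text \<open>Powers of \<open>1 - box_bump a b x\<close> give smooth approximations of the indicator
  with values between 0 and 1, the range of multipliers for which the variational inequality becomes
  an equation.\<close>

lemma box_bump_indicator:
  "(\<lambda>k. 1 - (1 - box_bump a b x) ^ k) \<longlonglongrightarrow> indicator (box a b) x"
proof (cases "x \<in> box a b")
  case True
  then have "0 < box_bump a b x"
    using box_bump_eq_0_iff[of a b x] box_bump_range(1)[of a b x] by linarith
  then have "(\<lambda>k. (1 - box_bump a b x) ^ k) \<longlonglongrightarrow> 0"
    using box_bump_range[of a b x] by (intro LIMSEQ_realpow_zero) auto
  from tendsto_diff[OF tendsto_const this] show ?thesis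
    using True by simp
next
  case False
  then show ?thesis using box_bump_eq_0_iff[of a b x] by simp
qed

text \<open>A measure whose sets may form a larger \<open>\<sigma>\<close>-algebra than the Borel sets, as Lebesgue and Hausdorff
  measure do, is tested by Borel sets as soon as its sets of finite measure have Borel hulls.\<close>

lemma AE_zero_of_box_bumps:
  fixes q :: "'a::euclidean_space \<Rightarrow> real"
  assumes sets: "sets borel \<subseteq> sets M" and space: "space M = UNIV"
    and hull: "\<And>E. E \<in> sets M \<Longrightarrow> emeasure M E < \<infinity> \<Longrightarrow>
      \<exists>B\<in>sets borel. E \<subseteq> B \<and> emeasure M (B - E) = 0"
    and q: "integrable M q"
    and zero: "\<And>\<psi>. smooth \<psi> \<Longrightarrow> (\<And>x. 0 \<le> \<psi> x \<and> \<psi> x \<le> 1) \<Longrightarrow> (LINT x|M. q x * \<psi> x) = 0"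
  shows "AE x in M. q x = 0"
proof -
  have int: "integrable M (\<lambda>x. indicator B x * q x)" if "B \<in> sets M" for B
    using integrable_mult_indicator[OF that q] by simp
  have box0: "(LINT x|M. indicator (box a b) x * q x) = 0" for a b
  proof -
    let ?\<psi> = "\<lambda>k x. 1 - (1 - box_bump a b x) ^ k"
    have sm: "smooth (?\<psi> k)" for k
      by (intro smooth_diff smooth_const smooth_power smooth_box_bump)
    have rng: "0 \<le> ?\<psi> k x \<and> ?\<psi> k x \<le> 1" for k x
      using box_bump_range[of a b x] by (auto intro!: power_le_one)
    have meas: "?\<psi> k \<in> borel_measurable M" for k
    proof -
      have "?\<psi> k \<in> borel_measurable borel"
        using smooth_continuous_on[OF sm] by (rule borel_measurable_continuous_onI)
      then show ?thesis
        using sets space by (auto simp: measurable_def)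
    qed
    have "(\<lambda>k. LINT x|M. q x * ?\<psi> k x) \<longlonglongrightarrow> (LINT x|M. indicator (box a b) x * q x)"
    proof (rule integral_dominated_convergence[where w = "\<lambda>x. \<bar>q x\<bar>"])
      show "AE x in M. (\<lambda>k. q x * ?\<psi> k x) \<longlonglongrightarrow> indicator (box a b) x * q x"
        using tendsto_mult[OF box_bump_indicator tendsto_const, of a b] by (simp add: mult.commute)
      show "AE x in M. norm (q x * ?\<psi> k x) \<le> \<bar>q x\<bar>" for k
        using rng by (auto simp: abs_mult intro!: mult_left_le)
      show "(\<lambda>x. q x * ?\<psi> k x) \<in> borel_measurable M" for k
        using q meas[of k] by auto
      show "(\<lambda>x. indicator (box a b) x * q x) \<in> borel_measurable M"
        using int[of "box a b"] subsetD[OF sets, of "box a b"] by auto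
    qed (use q in auto)
    moreover have "(LINT x|M. q x * ?\<psi> k x) = 0" for k
      using zero[OF sm rng] .
    ultimately show ?thesis by (simp add: LIMSEQ_const_iff)
  qed
  \<comment> \<open>The multiplier 1 handles the whole space, as the complement step of the
    induction below requires.\<close>
  have all0: "(LINT x|M. q x) = 0"
    using zero[OF smooth_const[of 1]] by simp
  \<comment> \<open>Boxes generate the Borel sets and are stable under intersection, so a Dynkin
    argument extends \<open>box0\<close>.\<close>
  have borel0: "(LINT x|M. indicator B x * q x) = 0" if "B \<in> sets borel" for B
  proof -
    have B: "B \<in> sigma_sets UNIV (range (\<lambda>(a, b). box a b))"
      using that by (simp add: borel_eq_box sets_measure_of)
    have int_stable: "Int_stable (range (\<lambda>(a, b). box a b :: 'a set))"
      by (auto simp: Int_stable_def box_Int_box)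
    have "range (\<lambda>(a, b). box a b :: 'a set) \<subseteq> Pow UNIV" by simp
    from int_stable this B show ?thesis
    proof (induction B rule: sigma_sets_induct_disjoint)
      case (basic A)
      then show ?case using box0 by auto
    next
      case (compl A)
      then have "A \<in> sets borel" by (simp add: borel_eq_box sets_measure_of)
      then have "integrable M (\<lambda>x. indicator A x * q x)" using int sets by auto
      moreover have "indicator (UNIV - A) x * q x = q x - indicator A x * q x" for x
        by (auto simp: indicator_def)
      ultimately show ?case using q all0 compl.IH by simp
    next
      case (union A)
      then have A: "A i \<in> sets M" for i
        using sets by (auto simp: borel_eq_box sets_measure_of)
      have "(LINT x:(\<Union>i. A i)|M. q x) = (\<Sum>i. LINT x:A i|M. q x)"
        using A union.hyps(1) int[of "\<Union>i. A i"]
        by (intro lebesgue_integral_countable_add)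
           (auto simp: disjoint_family_on_def set_integrable_def)
      then show ?case using union.IH by (simp add: set_lebesgue_integral_def)
    qed auto
  qed
  \<comment> \<open>\<open>s\<close> treats both signs of \<open>q\<close>. Because \<open>e\<close>
    is positive, Markov's inequality gives the level sets finite measure, as the hull hypothesis
    demands.\<close>
  have small: "emeasure M {x. e < s * q x} = 0" if "0 < e" "s \<in> {1, - 1}" for s e
  proof -
    let ?E = "{x. e < s * q x}"
    have qm: "q \<in> borel_measurable M" using q by auto
    have E: "?E \<in> sets M"
      using qm space borel_measurable_const[of e M]
        borel_measurable_less[of "\<lambda>_. e" M "\<lambda>x. s * q x"] by auto
    have "{x\<in>space M. e \<le> \<bar>q x\<bar>} \<in> sets M" using qm by measurable
    then have "emeasure M ?E \<le> emeasure M {x\<in>space M. e \<le> \<bar>q x\<bar>}"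
      using that by (intro emeasure_mono) (auto simp: space)
    also have "\<dots> \<le> ennreal (1 / e * (\<integral>x. \<bar>q x\<bar> \<partial>M))"
      using integral_Markov_inequality[of M "\<lambda>x. \<bar>q x\<bar>" e] integrable_abs[OF q] that(1) by simp
    also have "\<dots> < \<infinity>"
      by (simp add: ennreal_mult_less_top)
    finally have fin: "emeasure M ?E < \<infinity>" .
    obtain B where B: "B \<in> sets borel" "?E \<subseteq> B" "emeasure M (B - ?E) = 0"
      using hull[OF E fin] by blast
    have "AE x in M. x \<notin> B - ?E"
      using B E sets by (intro AE_not_in) auto
    then have ae: "AE x in M. indicator B x * q x = indicator ?E x * q x"
      by eventually_elim (use B(2) in \<open>auto simp: indicator_def\<close>)
    \<comment> \<open>Passing between the level set and its Borel hull does not change the integral,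
      so it vanishes, although the integrand \<open>s * q x\<close> exceeds \<open>e\<close> on the
      level set.\<close>
    have "0 = (LINT x|M. indicator ?E x * q x)"
      using borel0[OF B(1)] integral_cong_AE[OF _ _ ae] int[OF E] int[of B] B(1) sets by auto
    moreover have "(LINT x|M. e * indicator ?E x) \<le> (LINT x|M. s * (indicator ?E x * q x))"
    proof (rule integral_mono)
      show "integrable M (\<lambda>x. e * indicator ?E x)"
        using E fin by (intro integrable_mult_right integrable_real_indicator)
      show "integrable M (\<lambda>x. s * (indicator ?E x * q x))"
        using int[OF E] by (rule integrable_mult_right)
    qed (auto simp: indicator_def less_imp_le)
    ultimately have "e * measure M ?E \<le> 0"
      using E space by simp
    then have "measure M ?E = 0"
      using that(1) by (simp add: mult_le_0_iff antisym)
    then show ?thesis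
      using fin by (auto simp: measure_def enn2real_eq_0_iff)
  qed
  have "AE x in M. \<forall>n. \<not> 1 / real (Suc n) < s * q x" if "s \<in> {1, - 1}" for s
  proof (subst AE_all_countable, rule allI)
    fix n
    have "{x. 1 / real (Suc n) < s * q x} \<in> sets M"
      using q space borel_measurable_less[of "\<lambda>_. 1 / real (Suc n)" M "\<lambda>x. s * q x"] by auto
    then have "{x. 1 / real (Suc n) < s * q x} \<in> null_sets M"
      using small[OF _ that, of "1 / real (Suc n)"] by auto
    from AE_not_in[OF this] show "AE x in M. \<not> 1 / real (Suc n) < s * q x" by simp
  qed
  from this[of 1] this[of "- 1"] have
    "AE x in M. \<forall>n. \<not> 1 / real (Suc n) < q x \<and> \<not> 1 / real (Suc n) < - q x"
    by auto
  then show ?thesis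
  proof eventually_elim
    case (elim x)
    show ?case
    proof (rule ccontr)
      assume "q x \<noteq> 0"
      then obtain n where "inverse (real (Suc n)) < \<bar>q x\<bar>"
        using reals_Archimedean[of "\<bar>q x\<bar>"] by auto
      with elim show False by (auto simp: inverse_eq_divide abs_if split: if_splits)
    qed
  qed
qed

section \<open>Square integrable functions\<close>

lemma L2_mult_integrable:
  assumes "u \<in> L2 M" "v \<in> L2 M"
  shows "integrable M (\<lambda>x. u x * v x)"
proof (rule Bochner_Integration.integrable_bound)
  show "integrable M (\<lambda>x. (u x)\<^sup>2 + (v x)\<^sup>2)"
    using assms by (auto simp: L2_def)
  show "(\<lambda>x. u x * v x) \<in> borel_measurable M"
    using assms by (auto simp: L2_def)
  have "\<bar>s * t\<bar> \<le> s\<^sup>2 + t\<^sup>2" for s t :: real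
    using sum_squares_bound[of "\<bar>s\<bar>" "\<bar>t\<bar>"] abs_ge_zero[of "s * t"]
    unfolding abs_mult power2_abs by linarith
  then show "AE x in M. norm (u x * v x) \<le> norm ((u x)\<^sup>2 + (v x)\<^sup>2)"
    by simp
qed

lemma L2_bounded_mult:
  assumes u: "u \<in> L2 M" and "v \<in> borel_measurable M" and b: "\<And>x. x \<in> space M \<Longrightarrow> \<bar>v x\<bar> \<le> c"
  shows "(\<lambda>x. v x * u x) \<in> L2 M"
proof -
  have m: "u \<in> borel_measurable M" "integrable M (\<lambda>x. (u x)\<^sup>2)" using u by (auto simp: L2_def)
  have "integrable M (\<lambda>x. (v x * u x)\<^sup>2)"
  proof (rule Bochner_Integration.integrable_bound)
    show "integrable M (\<lambda>x. c\<^sup>2 * (u x)\<^sup>2)" using m by auto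
    show "(\<lambda>x. (v x * u x)\<^sup>2) \<in> borel_measurable M" using m assms(2) by auto
    have "norm ((v x * u x)\<^sup>2) \<le> norm (c\<^sup>2 * (u x)\<^sup>2)" if "x \<in> space M" for x
      using power_mono[OF b[OF that] abs_ge_zero, of 2]
      by (simp add: power_mult_distrib mult_right_mono)
    then show "AE x in M. norm ((v x * u x)\<^sup>2) \<le> norm (c\<^sup>2 * (u x)\<^sup>2)" by (intro AE_I2)
  qed
  then show ?thesis using m assms(2) by (simp add: L2_def)
qed

lemma L2_add:
  assumes "u \<in> L2 M" "v \<in> L2 M"
  shows "(\<lambda>x. u x + v x) \<in> L2 M"
proof -
  have "integrable M (\<lambda>x. (u x)\<^sup>2 + (v x)\<^sup>2 + 2 * (u x * v x))"
    using assms L2_mult_integrable[OF assms]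
    by (intro Bochner_Integration.integrable_add integrable_mult_right) (auto simp: L2_def)
  then show ?thesis
    using assms by (auto simp: L2_def power2_sum mult.assoc)
qed

lemma L2_cmult: "u \<in> L2 M \<Longrightarrow> (\<lambda>x. c * u x) \<in> L2 M" for c :: real
  by (auto simp: L2_def power_mult_distrib)

lemma L2_diff: "u \<in> L2 M \<Longrightarrow> v \<in> L2 M \<Longrightarrow> (\<lambda>x. u x - v x) \<in> L2 M"
  using L2_add[of u M "\<lambda>x. (- 1) * v x"] L2_cmult[of v M "- 1"] by simp

lemma L2_abs: "u \<in> L2 M \<Longrightarrow> (\<lambda>x. \<bar>u x\<bar>) \<in> L2 M"
  by (auto simp: L2_def)

lemma continuous_imp_borel_lebesgue_on:
  assumes "continuous_on UNIV (f :: 'a::euclidean_space \<Rightarrow> 'b::topological_space)"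
  shows "f \<in> borel_measurable (lebesgue_on U)"
  using borel_measurable_continuous_onI[OF assms]
  by (intro measurable_restrict_space1 measurable_completion) simp

lemma bounded_continuous_on_bounded:
  fixes f :: "'a::euclidean_space \<Rightarrow> 'b::real_normed_vector"
  assumes "continuous_on UNIV f" "bounded U"
  obtains c where "0 \<le> c" "\<And>x. x \<in> U \<Longrightarrow> norm (f x) \<le> c"
proof -
  have "compact (f ` closure U)"
    using assms by (intro compact_continuous_image) (auto intro: continuous_on_subset)
  then obtain c where "\<forall>y\<in>f ` closure U. norm y \<le> c"
    using compact_imp_bounded bounded_iff by blast
  then have "norm (f x) \<le> max c 0" if "x \<in> U" for x
    using that closure_subset by fastforce
  with that[of "max c 0"] show thesis by simp
qed

lemma L2_const:
  assumes "open U" "bounded U"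
  shows "(\<lambda>x. c) \<in> L2 (lebesgue_on U)"
proof -
  have "U \<in> lmeasurable" using assms by (intro lmeasurable_open)
  then have "integrable (lebesgue_on U) (\<lambda>x. c\<^sup>2)"
    by (intro integrable_const finite_measure.integrable_const finite_measure_lebesgue_on)
  then show ?thesis by (simp add: L2_def)
qed

lemma L2_continuous_mult:
  assumes "continuous_on UNIV f" "bounded U" "u \<in> L2 (lebesgue_on U)"
  shows "(\<lambda>x. f x * u x) \<in> L2 (lebesgue_on U)"
proof -
  obtain c where c: "\<And>x. x \<in> U \<Longrightarrow> norm (f x) \<le> c"
    using bounded_continuous_on_bounded[OF assms(1,2)] by metis
  show ?thesis
    using c by (intro L2_bounded_mult[OF assms(3) continuous_imp_borel_lebesgue_on[OF assms(1)], of c])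
               (simp add: space_restrict_space)
qed

lemma L2_continuous:
  assumes "continuous_on UNIV f" "open U" "bounded U"
  shows "f \<in> L2 (lebesgue_on U)"
  using L2_continuous_mult[OF assms(1,3) L2_const[OF assms(2,3), of 1]] by simp

section \<open>Weak gradients\<close>

lemma test_funD:
  assumes "test_fun U \<phi>"
  shows "smooth \<phi>" "x \<notin> U \<Longrightarrow> \<phi> x = 0"
  using assms closure_subset[of "{x. \<phi> x \<noteq> 0}"] by (auto simp: test_fun_def)

lemma test_fun_gderiv_outside:
  assumes "test_fun U \<phi>" "GDERIV \<phi> x :> D" "x \<notin> closure {x. \<phi> x \<noteq> 0}"
  shows "D = 0"
proof -
  have "GDERIV \<phi> x :> 0"
    unfolding gderiv_def
  proof (rule has_derivative_transform_within_open[where f = "\<lambda>_. 0"])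
    show "open (- closure {x. \<phi> x \<noteq> 0})" by auto
    show "x \<in> - closure {x. \<phi> x \<noteq> 0}" using assms by auto
    show "0 = \<phi> y" if "y \<in> - closure {x. \<phi> x \<noteq> 0}" for y
      using that closure_subset[of "{x. \<phi> x \<noteq> 0}"] by auto
  qed simp
  with assms(2) show ?thesis by (metis GDERIV_unique)
qed

lemma test_fun_smooth_mult:
  assumes "smooth \<psi>" "test_fun U \<phi>"
  shows "test_fun U (\<lambda>x. \<psi> x * \<phi> x)"
proof -
  have \<phi>: "smooth \<phi>" "compact (closure {x. \<phi> x \<noteq> 0})" "closure {x. \<phi> x \<noteq> 0} \<subseteq> U"
    using assms(2) by (auto simp: test_fun_def)
  have sub: "closure {x. \<psi> x * \<phi> x \<noteq> 0} \<subseteq> closure {x. \<phi> x \<noteq> 0}"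
    by (rule closure_mono) auto
  then have "bounded (closure {x. \<psi> x * \<phi> x \<noteq> 0})"
    by (rule bounded_subset[OF compact_imp_bounded[OF \<phi>(2)]])
  then have "compact (closure {x. \<psi> x * \<phi> x \<noteq> 0})"
    by (simp only: compact_eq_bounded_closed closed_closure simp_thms)
  then show ?thesis
    unfolding test_fun_def using smooth_mult[OF assms(1) \<phi>(1)] sub \<phi>(3)
    by (intro conjI order_trans[OF sub \<phi>(3)])
qed

section \<open>Fundamental lemma of the calculus of variations\<close>

lemma lebesgue_borel_hull:
  assumes "E \<in> sets lebesgue"
  shows "\<exists>B\<in>sets borel. E \<subseteq> B \<and> emeasure lebesgue (B - E) = 0"
proof -
  obtain B where B: "E \<subseteq> B" "B \<in> sets borel" and "B - E \<in> null_sets lebesgue"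
      and "emeasure lebesgue E = emeasure lborel B"
    using completion_upper[of E lborel] assms by auto
  then have "emeasure lebesgue (B - E) = 0" by (simp only: null_setsD1)
  with B show ?thesis by (intro bexI[of _ B] conjI)
qed

text \<open>On a box with closure in \<open>U\<close>, every smooth multiple of the bump is a test
  function, so \<open>AE_zero_of_box_bumps\<close> applies to \<open>h\<close> times the bump, and
  the bump has no zero in the box. Countably many such boxes exhaust \<open>U\<close>.\<close>

lemma AE_zero_of_test_funs:
  fixes h :: "'a::euclidean_space \<Rightarrow> real"
  assumes U: "open U" and h: "integrable (lebesgue_on U) h"
    and zero: "\<And>\<phi>. test_fun U \<phi> \<Longrightarrow> (LINT x|lebesgue_on U. h x * \<phi> x) = 0"
  shows "AE x in lebesgue_on U. h x = 0"
proof -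
  have UM: "U \<inter> space lebesgue \<in> sets lebesgue" using U by simp
  have h': "integrable lebesgue (\<lambda>x. indicator U x * h x)"
    using h integrable_restrict_space[OF UM, of h] by simp
  have on_box: "AE x in lebesgue. x \<in> box a b \<inter> U \<longrightarrow> h x = 0" if "cbox a b \<subseteq> U" for a b
  proof -
    let ?q = "\<lambda>x. box_bump a b x * (indicator U x * h x)"
    have m: "box_bump a b \<in> borel_measurable lebesgue"
      using borel_measurable_continuous_onI[OF smooth_continuous_on[OF smooth_box_bump], of a b]
      by (intro measurable_completion) simp
    have q: "integrable lebesgue ?q"
    proof (rule Bochner_Integration.integrable_bound[OF h'])
      show "?q \<in> borel_measurable lebesgue" using m h' by auto
      show "AE x in lebesgue. norm (?q x) \<le> norm (indicator U x * h x)"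
        using box_bump_range[of a b] by (auto simp: abs_mult intro!: mult_left_le_one_le)
    qed
    have "AE x in lebesgue. ?q x = 0"
    proof (rule AE_zero_of_box_bumps[OF _ _ _ q])
      fix \<psi> :: "'a \<Rightarrow> real" assume "smooth \<psi>"
      then have "test_fun U (\<lambda>x. \<psi> x * box_bump a b x)"
        using test_fun_box_bump[OF that] by (rule test_fun_smooth_mult)
      from zero[OF this] show "(LINT x|lebesgue. ?q x * \<psi> x) = 0"
        unfolding integral_restrict_space[OF UM] by (simp add: mult_ac)
    qed (use lebesgue_borel_hull in auto)
    then show ?thesis
      by eventually_elim (auto simp: box_bump_eq_0_iff)
  qed
  let ?F = "{box a b | a b. cbox a b \<subseteq> U}"
  obtain F where F: "F \<subseteq> ?F" "countable F" "\<Union>F = \<Union>?F"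
  proof (rule Lindelof[of ?F])
    show "open S" if "S \<in> ?F" for S using that by auto
  qed
  have "U \<subseteq> \<Union>?F"
  proof
    fix x assume "x \<in> U"
    then obtain a b where "x \<in> box a b" "cbox a b \<subseteq> U"
      using open_contains_cbox[of U] U box_subset_cbox by metis
    then show "x \<in> \<Union>?F" by blast
  qed
  moreover have "AE x in lebesgue. \<forall>S\<in>F. x \<in> S \<inter> U \<longrightarrow> h x = 0"
    using F(1,2) on_box by (subst AE_ball_countable) auto
  ultimately have "AE x in lebesgue. x \<in> U \<longrightarrow> h x = 0"
    using F(3) by (auto elim!: eventually_mono)
  then show ?thesis
    using AE_restrict_space_iff[OF UM] by simp
qed

lemma L2_inner_integrable:
  fixes G :: "'a::euclidean_space \<Rightarrow> 'a"
  assumes "\<forall>b\<in>Basis. (\<lambda>x. G x \<bullet> b) \<in> L2 M" "\<forall>b\<in>Basis. (\<lambda>x. H x \<bullet> b) \<in> L2 M"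
  shows "integrable M (\<lambda>x. G x \<bullet> H x)"
  unfolding euclidean_inner[of "G _" "H _"]
  using assms by (intro Bochner_Integration.integrable_sum L2_mult_integrable) auto

text \<open>The fundamental lemma in each coordinate; boundedness of \<open>U\<close> makes square
  integrable coordinates integrable. It renders the choice in \<open>grad\<close> harmless under
  integrals.\<close>

lemma weak_gradient_unique:
  assumes U: "open U" "bounded U" and G: "weak_gradient U u G" and G': "weak_gradient U u G'"
  shows "AE x in lebesgue_on U. G x = G' x"
proof -
  have "AE x in lebesgue_on U. G x \<bullet> b - G' x \<bullet> b = 0" if b: "b \<in> Basis" for b
  proof (rule AE_zero_of_test_funs[OF U(1)])
    have L: "(\<lambda>x. G x \<bullet> b) \<in> L2 (lebesgue_on U)" "(\<lambda>x. G' x \<bullet> b) \<in> L2 (lebesgue_on U)"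
      using G G' b by (auto simp: weak_gradient_def)
    show "integrable (lebesgue_on U) (\<lambda>x. G x \<bullet> b - G' x \<bullet> b)"
      using L2_mult_integrable[OF L2_diff[OF L] L2_const[OF U, of 1]] by simp
    fix \<phi> assume \<phi>: "test_fun U \<phi>"
    obtain D where D: "\<forall>x. GDERIV \<phi> x :> D x"
      using smooth_gderivE[OF test_funD(1)[OF \<phi>]] by blast
    have \<phi>2: "\<phi> \<in> L2 (lebesgue_on U)"
      using L2_continuous[OF smooth_continuous_on[OF test_funD(1)[OF \<phi>]] U] .
    have "(LINT x|lebesgue_on U. u x * (D x \<bullet> b)) = - (LINT x|lebesgue_on U. (G x \<bullet> b) * \<phi> x)"
      "(LINT x|lebesgue_on U. u x * (D x \<bullet> b)) = - (LINT x|lebesgue_on U. (G' x \<bullet> b) * \<phi> x)"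
      using G G' \<phi> D b unfolding weak_gradient_def by blast+
    then have "(LINT x|lebesgue_on U. (G x \<bullet> b) * \<phi> x) = (LINT x|lebesgue_on U. (G' x \<bullet> b) * \<phi> x)"
      by simp
    then show "(LINT x|lebesgue_on U. (G x \<bullet> b - G' x \<bullet> b) * \<phi> x) = 0"
      using L2_mult_integrable[OF L(1) \<phi>2] L2_mult_integrable[OF L(2) \<phi>2]
      by (simp add: left_diff_distrib)
  qed
  then have "AE x in lebesgue_on U. \<forall>b\<in>Basis. G x \<bullet> b - G' x \<bullet> b = 0"
    by (subst AE_ball_countable) (auto simp: countable_finite)
  then show ?thesis
    by eventually_elim (auto intro: euclidean_eqI)
qed

lemma weak_gradient_grad:
  assumes "u \<in> H1 U"
  shows "weak_gradient U u (grad U u)"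
proof -
  have "\<exists>G. weak_gradient U u G" using assms by (simp add: H1_def)
  then show ?thesis unfolding grad_def by (rule someI_ex)
qed

lemma H1_L2: "u \<in> H1 U \<Longrightarrow> u \<in> L2 (lebesgue_on U)"
  by (simp add: H1_def)

lemma L2_continuous_inner:
  assumes "continuous_on UNIV D" "open U" "bounded U"
  shows "(\<lambda>x. D x \<bullet> b) \<in> L2 (lebesgue_on U)"
  by (intro L2_continuous assms continuous_intros)

lemma weak_gradient_add:
  assumes U: "open U" "bounded U" and u: "u \<in> L2 (lebesgue_on U)" and v: "v \<in> L2 (lebesgue_on U)"
    and G: "weak_gradient U u G" and H: "weak_gradient U v H"
  shows "weak_gradient U (\<lambda>x. u x + v x) (\<lambda>x. G x + H x)"
  unfolding weak_gradient_def
proof (intro conjI ballI allI impI)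
  fix b :: 'a assume b: "b \<in> Basis"
  have L: "(\<lambda>x. G x \<bullet> b) \<in> L2 (lebesgue_on U)" "(\<lambda>x. H x \<bullet> b) \<in> L2 (lebesgue_on U)"
    using G H b by (auto simp: weak_gradient_def)
  show "(\<lambda>x. (G x + H x) \<bullet> b) \<in> L2 (lebesgue_on U)"
    using L2_add[OF L] by (simp add: inner_add_left)
  fix \<phi> D assume \<phi>: "test_fun U \<phi>" and D: "\<forall>x. GDERIV \<phi> x :> D x"
  have cD: "continuous_on UNIV D"
    by (rule smooth_gderiv_continuous_on[OF test_funD(1)[OF \<phi>]]) (use D in blast)
  have D2: "(\<lambda>x. D x \<bullet> b) \<in> L2 (lebesgue_on U)" by (rule L2_continuous_inner[OF cD U])
  have \<phi>2: "\<phi> \<in> L2 (lebesgue_on U)"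
    using L2_continuous[OF smooth_continuous_on[OF test_funD(1)[OF \<phi>]] U] .
  have "(LINT x|lebesgue_on U. u x * (D x \<bullet> b)) = - (LINT x|lebesgue_on U. (G x \<bullet> b) * \<phi> x)"
    "(LINT x|lebesgue_on U. v x * (D x \<bullet> b)) = - (LINT x|lebesgue_on U. (H x \<bullet> b) * \<phi> x)"
    using G H \<phi> D b by (auto simp: weak_gradient_def)
  then show "(LINT x|lebesgue_on U. (u x + v x) * (D x \<bullet> b)) =
      - (LINT x|lebesgue_on U. ((G x + H x) \<bullet> b) * \<phi> x)"
    using L2_mult_integrable[OF u D2] L2_mult_integrable[OF v D2]
      L2_mult_integrable[OF L(1) \<phi>2] L2_mult_integrable[OF L(2) \<phi>2]
    by (simp add: distrib_right inner_add_left)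
qed

text \<open>If \<open>\<phi>\<close> is a test function, so is \<open>\<psi> * \<phi>\<close>.
  Testing \<open>u\<close> with it and moving the term with the gradient of \<open>\<psi>\<close> to
  the other side gives the product rule.\<close>

lemma weak_gradient_smooth_mult:
  assumes U: "open U" "bounded U" and u: "u \<in> L2 (lebesgue_on U)" and G: "weak_gradient U u G"
    and \<psi>: "smooth \<psi>" "\<And>x. GDERIV \<psi> x :> E x" "continuous_on UNIV E"
  shows "weak_gradient U (\<lambda>x. \<psi> x * u x) (\<lambda>x. \<psi> x *\<^sub>R G x + u x *\<^sub>R E x)"
  unfolding weak_gradient_def
proof (intro conjI ballI allI impI)
  fix b :: 'a assume b: "b \<in> Basis"
  have L: "(\<lambda>x. G x \<bullet> b) \<in> L2 (lebesgue_on U)"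
    using G b by (auto simp: weak_gradient_def)
  have c\<psi>: "continuous_on UNIV \<psi>" using smooth_continuous_on[OF \<psi>(1)] .
  have cE: "continuous_on UNIV (\<lambda>x. E x \<bullet> b)" by (intro continuous_intros \<psi>)
  have L1: "(\<lambda>x. \<psi> x * (G x \<bullet> b)) \<in> L2 (lebesgue_on U)" by (rule L2_continuous_mult[OF c\<psi> U(2) L])
  have L2: "(\<lambda>x. (E x \<bullet> b) * u x) \<in> L2 (lebesgue_on U)" by (rule L2_continuous_mult[OF cE U(2) u])
  show "(\<lambda>x. (\<psi> x *\<^sub>R G x + u x *\<^sub>R E x) \<bullet> b) \<in> L2 (lebesgue_on U)"
    using L2_add[OF L1 L2] by (simp add: inner_add_left mult.commute)
  fix \<phi> D assume \<phi>: "test_fun U \<phi>" and D: "\<forall>x. GDERIV \<phi> x :> D x"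
  have "continuous_on UNIV D"
    by (rule smooth_gderiv_continuous_on[OF test_funD(1)[OF \<phi>]]) (use D in blast)
  then have cD: "continuous_on UNIV (\<lambda>x. D x \<bullet> b)"
    by (intro continuous_on_inner continuous_on_const)
  have c\<phi>: "continuous_on UNIV \<phi>" using smooth_continuous_on[OF test_funD(1)[OF \<phi>]] .
  have \<phi>2: "\<phi> \<in> L2 (lebesgue_on U)" by (rule L2_continuous[OF c\<phi> U])
  have D2: "(\<lambda>x. D x \<bullet> b) \<in> L2 (lebesgue_on U)" by (rule L2_continuous[OF cD U])
  have "\<forall>x. GDERIV (\<lambda>x. \<psi> x * \<phi> x) x :> \<psi> x *\<^sub>R D x + \<phi> x *\<^sub>R E x"
    using \<psi>(2) D by (auto intro: GDERIV_mult)
  from G[unfolded weak_gradient_def, THEN conjunct2, rule_format,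
      OF test_fun_smooth_mult[OF \<psi>(1) \<phi>] this[rule_format] b]
  have "(LINT x|lebesgue_on U. u x * ((\<psi> x *\<^sub>R D x + \<phi> x *\<^sub>R E x) \<bullet> b)) =
      - (LINT x|lebesgue_on U. (G x \<bullet> b) * (\<psi> x * \<phi> x))" .
  moreover have i1: "integrable (lebesgue_on U) (\<lambda>x. (\<psi> x * u x) * (D x \<bullet> b))"
    by (rule L2_mult_integrable[OF L2_continuous_mult[OF c\<psi> U(2) u] D2])
  moreover have i2: "integrable (lebesgue_on U) (\<lambda>x. ((E x \<bullet> b) * u x) * \<phi> x)"
    by (rule L2_mult_integrable[OF L2 \<phi>2])
  moreover have i3: "integrable (lebesgue_on U) (\<lambda>x. (\<psi> x * (G x \<bullet> b)) * \<phi> x)"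
    by (rule L2_mult_integrable[OF L1 \<phi>2])
  moreover have "(\<lambda>x. u x * ((\<psi> x *\<^sub>R D x + \<phi> x *\<^sub>R E x) \<bullet> b)) =
      (\<lambda>x. (\<psi> x * u x) * (D x \<bullet> b) + ((E x \<bullet> b) * u x) * \<phi> x)"
    by (auto simp: inner_add_left algebra_simps)
  moreover have "(\<lambda>x. ((\<psi> x *\<^sub>R G x + u x *\<^sub>R E x) \<bullet> b) * \<phi> x) =
      (\<lambda>x. (\<psi> x * (G x \<bullet> b)) * \<phi> x + ((E x \<bullet> b) * u x) * \<phi> x)"
    by (auto simp: inner_add_left algebra_simps)
  moreover have "(\<lambda>x. (G x \<bullet> b) * (\<psi> x * \<phi> x)) = (\<lambda>x. (\<psi> x * (G x \<bullet> b)) * \<phi> x)"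
    by (auto simp: algebra_simps)
  ultimately show "(LINT x|lebesgue_on U. \<psi> x * u x * (D x \<bullet> b)) =
      - (LINT x|lebesgue_on U. ((\<psi> x *\<^sub>R G x + u x *\<^sub>R E x) \<bullet> b) * \<phi> x)"
    by simp
qed

text \<open>Translation invariance of Lebesgue measure makes the integrals of the difference quotients
  vanish.\<close>

lemma integral_deriv_test_fun:
  fixes \<phi> :: "'a::euclidean_space \<Rightarrow> real"
  assumes \<phi>: "test_fun UNIV \<phi>" and D: "\<And>x. GDERIV \<phi> x :> D x"
  shows "(LINT x|lborel. D x \<bullet> b) = 0"
proof -
  have c\<phi>: "continuous_on UNIV \<phi>" using smooth_continuous_on[OF test_funD(1)[OF \<phi>]] .
  have cD: "continuous_on UNIV D" by (rule smooth_gderiv_continuous_on[OF test_funD(1)[OF \<phi>] D])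
  obtain R where R: "0 \<le> R" "\<And>x. x \<in> closure {x. \<phi> x \<noteq> 0} \<Longrightarrow> norm x \<le> R"
  proof -
    have "bounded (closure {x. \<phi> x \<noteq> 0})"
      using \<phi> by (auto simp: test_fun_def intro: compact_imp_bounded)
    then obtain R where "\<forall>x\<in>closure {x. \<phi> x \<noteq> 0}. norm x \<le> R" by (auto simp: bounded_iff)
    then show thesis by (intro that[of "max R 0"]) auto
  qed
  have \<phi>0: "\<phi> x = 0" if "R < norm x" for x
    using R(2)[of x] closure_subset[of "{x. \<phi> x \<noteq> 0}"] that by force
  have D0: "D x = 0" if "R < norm x" for x
    using test_fun_gderiv_outside[OF \<phi> D] R(2)[of x] that by force
  obtain C where C: "0 \<le> C" "\<And>x. norm (D x) \<le> C"
  proof -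
    obtain C where C: "0 \<le> C" "\<And>x. x \<in> cball 0 R \<Longrightarrow> norm (D x) \<le> C"
      using bounded_continuous_on_bounded[OF cD bounded_cball] by metis
    have "norm (D x) \<le> C" for x using C D0[of x] by (cases "norm x \<le> R") auto
    with C(1) that show thesis by blast
  qed
  let ?t = "\<lambda>n. 1 / real (Suc n)"
  let ?q = "\<lambda>n x. (\<phi> (?t n *\<^sub>R b + x) - \<phi> x) / ?t n"
  have int\<phi>: "integrable lborel \<phi>"
  proof -
    have "integrable lborel (\<lambda>x. indicator (cball 0 R) x *\<^sub>R \<phi> x)"
      by (rule borel_integrable_compact[OF compact_cball continuous_on_subset[OF c\<phi>]]) simp
    moreover have "(\<lambda>x. indicator (cball 0 R) x *\<^sub>R \<phi> x) = \<phi>"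
      using \<phi>0 by (intro ext) (auto simp: indicator_def)
    ultimately show ?thesis by simp
  qed
  have m\<phi>: "\<phi> \<in> borel_measurable borel" by (rule borel_measurable_continuous_onI[OF c\<phi>])
  have q0: "(LINT x|lborel. ?q n x) = 0" for n
  proof -
    have "integrable (distr lborel borel ((+) (?t n *\<^sub>R b))) \<phi>"
      using int\<phi> by (simp add: lborel_distr_plus)
    then have i: "integrable lborel (\<lambda>x. \<phi> (?t n *\<^sub>R b + x))"
      using m\<phi> by (subst (asm) integrable_distr_eq) auto
    have "(LINT x|lborel. \<phi> (?t n *\<^sub>R b + x)) = (LINT x|distr lborel borel ((+) (?t n *\<^sub>R b)). \<phi> x)"
      using m\<phi> by (subst integral_distr) auto
    also have "\<dots> = (LINT x|lborel. \<phi> x)" by (simp add: lborel_distr_plus)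
    finally show ?thesis
      using i int\<phi> by (simp add: Bochner_Integration.integral_diff del: of_nat_Suc)
  qed
  \<comment> \<open>Shifts by at most \<open>norm b\<close> keep all difference quotients supported
    in one ball, and the mean value inequality bounds them by \<open>C * norm b\<close>.\<close>
  have "(\<lambda>n. LINT x|lborel. ?q n x) \<longlonglongrightarrow> (LINT x|lborel. D x \<bullet> b)"
  proof (rule integral_dominated_convergence[where w = "\<lambda>x. C * norm b * indicator (cball 0 (R + norm b)) x"])
    show "(\<lambda>x. D x \<bullet> b) \<in> borel_measurable lborel"
      using cD by (simp add: borel_measurable_continuous_onI continuous_on_inner)
    show "?q n \<in> borel_measurable lborel" for n
      using m\<phi> by measurable
    show "integrable lborel (\<lambda>x. C * norm b * indicator (cball 0 (R + norm b)) x)"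
      by (intro integrable_mult_right integrable_real_indicator emeasure_bounded_finite) auto
    show "AE x in lborel. (\<lambda>n. ?q n x) \<longlonglongrightarrow> D x \<bullet> b"
    proof (rule AE_I2)
      fix x
      have "((\<lambda>t. \<phi> (t *\<^sub>R b + x)) has_real_derivative D x \<bullet> b) (at 0)"
      proof -
        have "(\<phi> has_derivative (\<lambda>h. h \<bullet> D x)) (at (0 *\<^sub>R b + x))" using D[of x] by (simp add: gderiv_def)
        moreover have "((\<lambda>t. t *\<^sub>R b + x) has_derivative (\<lambda>t. t *\<^sub>R b)) (at 0)"
          by (auto intro!: derivative_eq_intros)
        ultimately have "((\<lambda>t. \<phi> (t *\<^sub>R b + x)) has_derivative (\<lambda>t. (t *\<^sub>R b) \<bullet> D x)) (at 0)"
          by (rule has_derivative_compose[rotated])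
        then show ?thesis
          unfolding has_field_derivative_def inner_scaleR_left inner_commute[of b] mult.commute[of _ "D x \<bullet> b"] .
      qed
      then have "((\<lambda>t. (\<phi> (t *\<^sub>R b + x) - \<phi> x) / t) \<longlongrightarrow> D x \<bullet> b) (at 0)"
        by (simp add: DERIV_def)
      moreover have "filterlim ?t (at 0) sequentially"
        using LIMSEQ_inverse_real_of_nat[unfolded inverse_eq_divide] by (simp add: filterlim_at del: of_nat_Suc)
      ultimately show "(\<lambda>n. ?q n x) \<longlonglongrightarrow> D x \<bullet> b"
        by (rule filterlim_compose)
    qed
    show "AE x in lborel. norm (?q n x) \<le> C * norm b * indicator (cball 0 (R + norm b)) x" for n
    proof (rule AE_I2)
      fix x
      have tb: "norm (?t n *\<^sub>R b) \<le> norm b"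
        using mult_left_mono[of 1 "real (Suc n)" "norm b"] by (simp add: divide_le_eq)
      show "norm (?q n x) \<le> C * norm b * indicator (cball 0 (R + norm b)) x"
      proof (cases "norm x \<le> R + norm b")
        case True
        have "norm (\<phi> (?t n *\<^sub>R b + x) - \<phi> x) \<le> C * norm (?t n *\<^sub>R b + x - x)"
        proof (rule differentiable_bound[of UNIV \<phi> "\<lambda>x h. h \<bullet> D x"])
          show "onorm (\<lambda>h. h \<bullet> D y) \<le> C" for y
          proof (rule onorm_le)
            show "norm (h \<bullet> D y) \<le> C * norm h" for h
              using Cauchy_Schwarz_ineq2[of h "D y"] mult_right_mono[OF C(2)[of y] norm_ge_zero[of h]]
              by (simp add: mult.commute)
          qed
        qed (use D in \<open>auto simp: gderiv_def\<close>)
        also have "\<dots> = C * norm b * ?t n" by simp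
        finally have "norm (\<phi> (?t n *\<^sub>R b + x) - \<phi> x) / ?t n \<le> C * norm b"
          by (simp add: field_simps)
        then have "norm (?q n x) \<le> C * norm b"
          by (simp add: abs_mult)
        then show ?thesis using True by simp
      next
        case False
        then have "R < norm x" "R < norm (?t n *\<^sub>R b + x)"
          using tb norm_triangle_ineq2[of x "- (?t n *\<^sub>R b)"] norm_ge_zero[of b]
          unfolding norm_minus_cancel diff_minus_eq_add add.commute[of _ x] by linarith+
        then show ?thesis using \<phi>0 C by simp
      qed
    qed
  qed
  with q0 show ?thesis by (simp add: LIMSEQ_const_iff)
qed

text \<open>Integration by parts reduces to the vanishing integral of a derivative with compact
  support. Every smooth function is a smooth multiple of 1, so its weak gradient then follows from
  the product rule.\<close>

lemma weak_gradient_one: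
  assumes "open U"
  shows "weak_gradient U (\<lambda>x. 1) (\<lambda>x. 0)"
  unfolding weak_gradient_def
proof (intro conjI ballI allI impI)
  fix b :: 'a assume b: "b \<in> Basis"
  show "(\<lambda>x. 0 \<bullet> b) \<in> L2 (lebesgue_on U)" by (simp add: L2_def)
  fix \<phi> D assume \<phi>: "test_fun U \<phi>" and D: "\<forall>x. GDERIV \<phi> x :> D x"
  have UM: "U \<inter> space lebesgue \<in> sets lebesgue" using assms by simp
  have \<phi>': "test_fun UNIV \<phi>" using \<phi> by (simp add: test_fun_def)
  have D0: "D x = 0" if "x \<notin> U" for x
  proof -
    have "x \<notin> closure {x. \<phi> x \<noteq> 0}" using \<phi> that by (auto simp: test_fun_def)
    with test_fun_gderiv_outside[OF \<phi>] D show ?thesis by blast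
  qed
  have "continuous_on UNIV D"
    by (rule smooth_gderiv_continuous_on[OF test_funD(1)[OF \<phi>]]) (use D in blast)
  then have "(\<lambda>x. D x \<bullet> b) \<in> borel_measurable lborel"
    by (simp add: borel_measurable_continuous_onI continuous_on_inner)
  then have "(LINT x|lebesgue. D x \<bullet> b) = (LINT x|lborel. D x \<bullet> b)"
    by (rule integral_completion)
  also have "\<dots> = 0" using integral_deriv_test_fun[OF \<phi>'] D by blast
  finally have "(LINT x|lebesgue. D x \<bullet> b) = 0" .
  moreover have "(\<lambda>x. indicator U x *\<^sub>R (1 * (D x \<bullet> b))) = (\<lambda>x. D x \<bullet> b)"
    by (intro ext) (metis D0 indicator_simps inner_zero_left mult_1 mult_zero_right real_scaleR_def scaleR_one)
  ultimately show "(LINT x|lebesgue_on U. 1 * (D x \<bullet> b)) = - (LINT x|lebesgue_on U. (0 \<bullet> b) * \<phi> x)"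
    unfolding integral_restrict_space[OF UM] by simp
qed

lemma weak_gradient_smooth:
  assumes "open U" "bounded U" "smooth \<psi>" "\<And>x. GDERIV \<psi> x :> E x" "continuous_on UNIV E"
  shows "weak_gradient U \<psi> E"
  using weak_gradient_smooth_mult[OF assms(1,2) L2_const[OF assms(1,2)] weak_gradient_one[OF assms(1)] assms(3-5)]
  by simp

section \<open>Coverings by cubes\<close>

text \<open>For cubes, unlike general boxes, the volume controls the power of the diameter that
  Hausdorff sums use. The constant comes from bounding the diameter by the dimension times the side
  length.\<close>

lemma cube_cover:
  fixes S :: "'a::euclidean_space set"
  assumes S: "S \<in> lmeasurable" "bounded S" and e: "0 < e"
  obtains C :: "nat \<Rightarrow> 'a set" where "S \<subseteq> (\<Union>i. C i)" "\<And>i. compact (C i)"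
    "\<And>i. ennreal (diameter (C i) ^ DIM('a)) \<le> ennreal (real DIM('a) ^ DIM('a)) * emeasure lebesgue (C i)"
    "(\<Sum>i. emeasure lebesgue (C i)) \<le> emeasure lebesgue S + ennreal e"
proof -
  obtain r where r: "0 < r" "S \<subseteq> cbox (- r *\<^sub>R One) (r *\<^sub>R One)"
  proof -
    obtain r where r: "0 < r" "\<And>x. x \<in> S \<Longrightarrow> norm x \<le> r"
      using S(2) bounded_pos by blast
    have "S \<subseteq> cbox (- r *\<^sub>R One) (r *\<^sub>R One)"
    proof
      fix x assume "x \<in> S"
      then have "\<bar>x \<bullet> i\<bar> \<le> r" if "i \<in> Basis" for i
        using Basis_le_norm[OF that, of x] r(2) by (meson order_trans)
      then show "x \<in> cbox (- r *\<^sub>R One) (r *\<^sub>R One)"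
        by (auto simp: mem_box abs_le_iff minus_le_iff)
    qed
    with r(1) show thesis by (rule that)
  qed
  obtain \<D> where D: "countable \<D>" "\<And>K. K \<in> \<D> \<Longrightarrow> K \<subseteq> cbox (- r *\<^sub>R One) (r *\<^sub>R One) \<and> K \<noteq> {} \<and> (\<exists>c d. K = cbox c d)"
    "pairwise (\<lambda>A B. interior A \<inter> interior B = {}) \<D>"
    "\<And>u v. cbox u v \<in> \<D> \<Longrightarrow> \<exists>n. \<forall>i\<in>Basis. v \<bullet> i - u \<bullet> i = ((r *\<^sub>R One) \<bullet> i - (- r *\<^sub>R One) \<bullet> i) / 2 ^ n"
    "S \<subseteq> \<Union>\<D>" "\<Union>\<D> \<in> lmeasurable" "measure lebesgue (\<Union>\<D>) \<le> measure lebesgue S + e"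
    using measurable_outer_intervals_bounded[OF S(1) r(2) e] by metis
  have cube: "ennreal (diameter K ^ DIM('a)) \<le> ennreal (real DIM('a) ^ DIM('a)) * emeasure lebesgue K"
    if "K \<in> \<D>" for K
  proof -
    obtain c d where K: "K = cbox c d" "K \<noteq> {}" using D(2)[OF \<open>K \<in> \<D>\<close>] by blast
    then obtain n where n: "\<forall>i\<in>Basis. d \<bullet> i - c \<bullet> i = ((r *\<^sub>R One) \<bullet> i - (- r *\<^sub>R One) \<bullet> i) / 2 ^ n"
      using D(4) \<open>K \<in> \<D>\<close> by blast
    \<comment> \<open>All sides of \<open>K\<close> have this length because the dyadic subdivision
      starts from a cube.\<close>
    define s where "s = 2 * r / 2 ^ n"
    have s: "0 \<le> s" "\<And>i. i \<in> Basis \<Longrightarrow> d \<bullet> i - c \<bullet> i = s"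
      using n r(1) by (auto simp: s_def)
    have le: "c \<bullet> i \<le> d \<bullet> i" if "i \<in> Basis" for i using s(1) s(2)[OF that] by linarith
    have "diameter K = dist c d" unfolding K(1) using le by (intro diameter_cbox) auto
    also have "\<dots> \<le> (\<Sum>i\<in>Basis. \<bar>(d - c) \<bullet> i\<bar>)" by (subst dist_commute) (simp only: dist_norm norm_le_l1)
    also have "\<dots> = real DIM('a) * s" using s by (simp add: inner_diff_left)
    finally have "diameter K \<le> real DIM('a) * s" .
    then have "diameter K ^ DIM('a) \<le> (real DIM('a) * s) ^ DIM('a)"
      using bounded_cbox K(1) by (intro power_mono diameter_ge_0) auto
    moreover have "emeasure lebesgue K = ennreal (s ^ DIM('a))"
      using le s(2) unfolding K(1) by (simp add: emeasure_lborel_cbox_eq inner_diff_left)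
    ultimately show ?thesis
      using s(1) by (simp add: power_mult_distrib ennreal_mult[symmetric] ennreal_leI)
  qed
  \<comment> \<open>\<open>\<D>\<close> may be finite, so its enumeration is padded with empty
    sets.\<close>
  define C where "C i = (if i \<in> to_nat_on \<D> ` \<D> then from_nat_into \<D> i else {})" for i
  have C: "C i \<in> \<D> \<or> C i = {}" for i
    using D(1) by (auto simp: C_def)
  have inter: "interior (C i) \<inter> interior (C j) = {}" if "i \<noteq> j" for i j
  proof (cases "i \<in> to_nat_on \<D> ` \<D> \<and> j \<in> to_nat_on \<D> ` \<D>")
    case True
    then obtain K L where "K \<in> \<D>" "i = to_nat_on \<D> K" "L \<in> \<D>" "j = to_nat_on \<D> L" by blast
    moreover from this that have "K \<noteq> L" by blast
    ultimately show ?thesis using D(1,3) by (auto simp: C_def pairwise_def)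
  qed (auto simp: C_def)
  have CU: "(\<Union>i. C i) = \<Union>\<D>"
  proof
    show "(\<Union>i. C i) \<subseteq> \<Union>\<D>" using C by fastforce
    show "\<Union>\<D> \<subseteq> (\<Union>i. C i)"
    proof
      fix x assume "x \<in> \<Union>\<D>"
      then obtain K where "K \<in> \<D>" "x \<in> K" by blast
      then have "x \<in> C (to_nat_on \<D> K)" using D(1) by (simp add: C_def)
      then show "x \<in> (\<Union>i. C i)" by blast
    qed
  qed
  \<comment> \<open>The cubes overlap only along null faces, so the measures add up over the
    disjoint interiors.\<close>
  have int: "emeasure lebesgue (C i) = emeasure lebesgue (interior (C i))" for i
  proof (cases "C i = {}")
    case False
    then obtain c d where "C i = cbox c d" using C[of i] D(2) by blast
    then show ?thesis by (simp add: interior_cbox emeasure_lborel_cbox_eq emeasure_lborel_box_eq)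
  qed simp
  have "(\<Sum>i. emeasure lebesgue (C i)) = emeasure lebesgue (\<Union>i. interior (C i))"
    unfolding int by (rule suminf_emeasure) (auto simp: disjoint_family_on_def inter)
  also have "\<dots> \<le> emeasure lebesgue (\<Union>\<D>)"
    using D(6) interior_subset unfolding CU[symmetric] by (intro emeasure_mono) auto
  also have "\<dots> \<le> emeasure lebesgue S + ennreal e"
    using D(6,7) S(1) e by (simp add: emeasure_eq_measure2 ennreal_plus[symmetric] del: ennreal_plus)
  finally have "(\<Sum>i. emeasure lebesgue (C i)) \<le> emeasure lebesgue S + ennreal e" .
  moreover have "compact (C i)" for i using C[of i] D(2) by (metis compact_cbox compact_empty)
  moreover have "ennreal (diameter (C i) ^ DIM('a)) \<le> ennreal (real DIM('a) ^ DIM('a)) * emeasure lebesgue (C i)" for i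
    using C[of i] cube[of "C i"] by (cases "C i = {}") (auto simp: zero_power)
  moreover have "S \<subseteq> (\<Union>i. C i)" using CU D(5) by simp
  ultimately show thesis using that by blast
qed

text \<open>A null set has cube covers of arbitrarily small total volume, and the map stretches
  diameters by at most \<open>L\<close>. The image cover is automatically fine, since a cube of
  small volume has small diameter.\<close>

lemma hausdorff_outer_Lipschitz_image_null:
  fixes N :: "'a::euclidean_space set" and g :: "'a \<Rightarrow> 'b::euclidean_space"
  assumes N: "N \<in> null_sets lebesgue" "bounded N" and g: "L-lipschitz_on N g"
  shows "hausdorff_outer DIM('a) (g ` N) = 0"
proof -
  let ?d = "DIM('a)"
  let ?K = "real ?d ^ ?d"
  have L: "0 \<le> L" using g by (rule lipschitz_on_nonneg)
  have "hausdorff_pre ?d \<delta> (g ` N) \<le> 0" if \<delta>: "0 < \<delta>" for \<delta>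
  proof (rule ennreal_le_epsilon)
    fix e :: real assume e: "0 < e"
    \<comment> \<open>\<open>M\<close> converts the volume of a cube into the Hausdorff size of its
      image: \<open>L / 2\<close> comes from half the image diameter, \<open>?K\<close> from
      comparing diameter with volume.\<close>
    define M where "M = unit_ball_vol (real ?d) * (L / 2) ^ ?d * ?K"
    have M: "0 \<le> M" using L by (simp add: M_def)
    \<comment> \<open>The first bound makes the total size at most \<open>e\<close>, the second
      makes every image of diameter at most \<open>\<delta>\<close>. Adding 1 to \<open>M\<close>
      and \<open>L\<close> avoids division by zero.\<close>
    define \<eta> where "\<eta> = min (e / (M + 1)) ((\<delta> / (L + 1)) ^ ?d / ?K)"
    have \<eta>: "0 < \<eta>" "M * \<eta> \<le> e" "?K * \<eta> \<le> (\<delta> / (L + 1)) ^ ?d"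
    proof -
      show "0 < \<eta>" using e M \<delta> L by (simp add: \<eta>_def)
      have "M * \<eta> \<le> M * (e / (M + 1))" using M by (intro mult_left_mono) (auto simp: \<eta>_def)
      also have "\<dots> \<le> e" using M e by (simp add: field_simps)
      finally show "M * \<eta> \<le> e" .
      have "?K * \<eta> \<le> ?K * ((\<delta> / (L + 1)) ^ ?d / ?K)" by (intro mult_left_mono) (auto simp: \<eta>_def)
      then show "?K * \<eta> \<le> (\<delta> / (L + 1)) ^ ?d" by simp
    qed
    have "N \<in> lmeasurable" using N(1) by (rule fmeasurableI_null_sets)
    then obtain C where C: "N \<subseteq> (\<Union>i. C i)" "\<And>i. compact (C i)"
      "\<And>i. ennreal (diameter (C i) ^ ?d) \<le> ennreal ?K * emeasure lebesgue (C i)"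
      "(\<Sum>i. emeasure lebesgue (C i)) \<le> emeasure lebesgue N + ennreal \<eta>"
      using cube_cover[OF _ N(2) \<eta>(1)] by metis
    have sum: "(\<Sum>i. emeasure lebesgue (C i)) \<le> ennreal \<eta>"
      using C(4) null_setsD1[OF N(1)] by simp
    have dC: "0 \<le> diameter (C i)" for i
      using C(2) by (simp add: diameter_ge_0 compact_imp_bounded)
    have small: "diameter (C i) \<le> \<delta> / (L + 1)" for i
    proof -
      have "emeasure lebesgue (C i) \<le> ennreal \<eta>"
        using sum_le_suminf[of "\<lambda>i. emeasure lebesgue (C i)" "{i}"] sum by (auto intro: order_trans)
      then have "ennreal (diameter (C i) ^ ?d) \<le> ennreal ?K * ennreal \<eta>"
        using C(3)[of i] by (meson mult_left_mono order_trans zero_le)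
      also have "\<dots> \<le> ennreal ((\<delta> / (L + 1)) ^ ?d)"
        using \<eta> by (simp add: ennreal_mult[symmetric] ennreal_leI)
      finally have "diameter (C i) ^ ?d \<le> (\<delta> / (L + 1)) ^ ?d"
        using \<delta> L by (simp add: ennreal_le_iff)
      then show ?thesis
        using \<delta> L dC by (subst (asm) power_mono_iff) auto
    qed
    \<comment> \<open>The map is Lipschitz on \<open>N\<close> only, so the cubes are cut down to
      \<open>N\<close> before being mapped.\<close>
    let ?G = "\<lambda>i. g ` (C i \<inter> N)"
    have diam: "diameter (?G i) \<le> L * diameter (C i)" "bounded (?G i)" for i
    proof -
      have le: "dist (g x) (g y) \<le> L * diameter (C i)" if "x \<in> C i \<inter> N" "y \<in> C i \<inter> N" for x y
      proof -
        have "dist (g x) (g y) \<le> L * dist x y" using g that by (auto dest: lipschitz_onD)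
        also have "\<dots> \<le> L * diameter (C i)"
          using that C(2)[of i] L by (intro mult_left_mono diameter_bounded_bound) (auto intro: compact_imp_bounded)
        finally show ?thesis .
      qed
      show "diameter (?G i) \<le> L * diameter (C i)"
        using le L dC by (intro diameter_le) (auto simp: dist_norm)
      show "bounded (?G i)"
        using le unfolding bounded_two_points by auto
    qed
    have "?G \<in> fine_covers \<delta> (g ` N)"
    proof safe
      fix x assume "x \<in> N"
      then show "g x \<in> (\<Union>i. ?G i)" using C(1) by blast
    next
      fix i
      show "bounded (?G i)" by (rule diam)
      have "diameter (?G i) \<le> L * (\<delta> / (L + 1))"
        using diam(1)[of i] small[of i] L by (meson mult_left_mono order_trans)
      also have "\<dots> \<le> \<delta>" using L \<delta> by (simp add: field_simps)
      finally show "diameter (?G i) \<le> \<delta>" .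
    qed
    then have "hausdorff_pre ?d \<delta> (g ` N) \<le> (\<Sum>i. hausdorff_size ?d (?G i))"
      by (rule hausdorff_pre_leI)
    also have "\<dots> \<le> (\<Sum>i. ennreal M * emeasure lebesgue (C i))"
    proof (intro suminf_le allI summableI)
      fix i
      have "unit_ball_vol (real ?d) * (diameter (?G i) / 2) ^ ?d \<le>
          unit_ball_vol (real ?d) * (L * diameter (C i) / 2) ^ ?d"
        using diam[of i] by (intro mult_left_mono power_mono divide_right_mono) (auto intro: diameter_ge_0)
      then have "hausdorff_size ?d (?G i) \<le>
          ennreal (unit_ball_vol (real ?d) * (L / 2) ^ ?d) * ennreal (diameter (C i) ^ ?d)"
        using L dC by (simp add: ennreal_mult[symmetric] ennreal_leI power_mult_distrib power_divide mult_ac)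
      also have "\<dots> \<le> ennreal (unit_ball_vol (real ?d) * (L / 2) ^ ?d) * (ennreal ?K * emeasure lebesgue (C i))"
        by (intro mult_left_mono C) auto
      also have "\<dots> = ennreal M * emeasure lebesgue (C i)"
        using L by (simp add: M_def ennreal_mult mult.assoc)
      finally show "hausdorff_size ?d (?G i) \<le> ennreal M * emeasure lebesgue (C i)" .
    qed
    also have "\<dots> = ennreal M * (\<Sum>i. emeasure lebesgue (C i))" by simp
    also have "\<dots> \<le> ennreal M * ennreal \<eta>" using sum by (intro mult_left_mono) auto
    also have "\<dots> \<le> ennreal e" using M \<eta> by (simp add: ennreal_mult[symmetric] ennreal_leI)
    finally show "hausdorff_pre ?d \<delta> (g ` N) \<le> 0 + ennreal e" by simp
  qed
  then have "hausdorff_outer ?d (g ` N) \<le> 0" by (rule hausdorff_outer_leI)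
  then show ?thesis by simp
qed

text \<open>The preimage of a set of diameter \<open>D\<close> lies in a ball of radius
  \<open>D\<close>; over a cover by cubes this costs a dimensional constant. The bound serves only
  to carry finiteness of an energy into the coordinates of a chart, where a constant does no
  harm.\<close>

lemma emeasure_isometry_vimage_le:
  fixes T :: "'a::euclidean_space \<Rightarrow> 'a"
  assumes T: "\<And>x y. dist (T x) (T y) = dist x y" and A: "A \<in> sets borel" "bounded A"
  shows "emeasure lborel (T -` A) \<le>
    ennreal (unit_ball_vol (real DIM('a)) * real DIM('a) ^ DIM('a)) * emeasure lborel A"
proof (rule ennreal_le_epsilon)
  let ?d = "DIM('a)"
  let ?K = "unit_ball_vol (real ?d) * real ?d ^ ?d"
  fix e :: real assume e: "0 < e"
  define K where "K = ?K"
  have K: "0 < K" by (simp add: K_def)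
  have contT: "continuous_on UNIV T"
    unfolding continuous_on_iff by (metis T)
  have Al: "A \<in> lmeasurable"
    using A by (intro bounded_set_imp_lmeasurable) auto
  obtain C where C: "A \<subseteq> (\<Union>i. C i)" "\<And>i. compact (C i)"
    "\<And>i. ennreal (diameter (C i) ^ ?d) \<le> ennreal (real ?d ^ ?d) * emeasure lebesgue (C i)"
    "(\<Sum>i. emeasure lebesgue (C i)) \<le> emeasure lebesgue A + ennreal (e / K)"
    using cube_cover[OF Al A(2), of "e / K"] e K by (metis divide_pos_pos)
  have closed: "closed (T -` C i)" for i
    using compact_imp_closed[OF C(2)] contT by (rule closed_vimage)
  have one: "emeasure lborel (T -` C i) \<le> ennreal K * emeasure lebesgue (C i)" for i
  proof (cases "T -` C i = {}")
    case False
    then obtain x where x: "T x \<in> C i" by blast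
    have d0: "0 \<le> diameter (C i)" using C(2) by (simp add: diameter_ge_0 compact_imp_bounded)
    have "T -` C i \<subseteq> cball x (diameter (C i))"
    proof
      fix z assume "z \<in> T -` C i"
      then have "dist (T x) (T z) \<le> diameter (C i)"
        by (intro diameter_bounded_bound[OF compact_imp_bounded[OF C(2)] x]) simp
      then show "z \<in> cball x (diameter (C i))" by (simp add: T)
    qed
    then have "emeasure lborel (T -` C i) \<le> emeasure lborel (cball x (diameter (C i)))"
      by (intro emeasure_mono) auto
    also have "\<dots> = ennreal (unit_ball_vol (real ?d)) * ennreal (diameter (C i) ^ ?d)"
      using d0 by (simp add: emeasure_cball ennreal_mult)
    also have "\<dots> \<le> ennreal (unit_ball_vol (real ?d)) * (ennreal (real ?d ^ ?d) * emeasure lebesgue (C i))"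
      by (intro mult_left_mono C) auto
    also have "\<dots> = ennreal K * emeasure lebesgue (C i)"
      by (simp add: K_def ennreal_mult mult.assoc)
    finally show ?thesis .
  qed simp
  have "T -` A \<subseteq> (\<Union>i. T -` C i)"
    unfolding vimage_UN[symmetric] using C(1) by (rule vimage_mono)
  then have "emeasure lborel (T -` A) \<le> emeasure lborel (\<Union>i. T -` C i)"
    using closed by (intro emeasure_mono) auto
  also have "\<dots> \<le> (\<Sum>i. emeasure lborel (T -` C i))"
    using closed by (intro emeasure_subadditive_countably) auto
  also have "\<dots> \<le> (\<Sum>i. ennreal K * emeasure lebesgue (C i))"
    by (intro suminf_le one) auto
  also have "\<dots> = ennreal K * (\<Sum>i. emeasure lebesgue (C i))" by simp
  also have "\<dots> \<le> ennreal K * (emeasure lebesgue A + ennreal (e / K))"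
    using C(4) by (intro mult_left_mono) auto
  also have "\<dots> = ennreal K * emeasure lborel A + ennreal e"
    using A K e by (simp add: distrib_left ennreal_mult[symmetric])
  finally show "emeasure lborel (T -` A) \<le> ennreal ?K * emeasure lborel A + ennreal e"
    unfolding K_def .
qed

lemma nn_integral_isometry_finite:
  fixes T :: "'a::euclidean_space \<Rightarrow> 'a"
  assumes T: "\<And>x y. dist (T x) (T y) = dist x y" and f: "f \<in> borel_measurable borel"
    and fin: "(\<integral>\<^sup>+x. f x \<partial>lborel) < \<infinity>"
  shows "(\<integral>\<^sup>+x. f (T x) \<partial>lborel) < \<infinity>"
proof -
  let ?K = "ennreal (unit_ball_vol (real DIM('a)) * real DIM('a) ^ DIM('a))"
  have "continuous_on UNIV T"
    unfolding continuous_on_iff by (metis T)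
  then have [measurable]: "T \<in> borel_measurable borel"
    by (rule borel_measurable_continuous_onI)
  let ?N = "distr lborel borel T"
  have le: "emeasure ?N A \<le> emeasure (scale_measure ?K lborel) A" if A: "A \<in> sets borel" for A
  proof -
    \<comment> \<open>The estimate is for bounded sets, so \<open>A\<close> is exhausted by its
      intersections with balls.\<close>
    let ?A = "\<lambda>n::nat. A \<inter> cball 0 (real n)"
    have "(\<Union>n. ?A n) = A"
      using real_arch_simple by (auto simp: mem_cball)
    moreover have "incseq ?A" by (auto simp: incseq_def)
    ultimately have "emeasure ?N A = (SUP n. emeasure ?N (?A n))"
      using SUP_emeasure_incseq[of ?A ?N] A by (simp add: image_subset_iff)
    also have "\<dots> \<le> emeasure (scale_measure ?K lborel) A"
    proof (rule SUP_least)
      fix n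
      have "emeasure ?N (?A n) = emeasure lborel (T -` ?A n)"
        using A by (subst emeasure_distr) auto
      also have "\<dots> \<le> ?K * emeasure lborel (?A n)"
        using A by (intro emeasure_isometry_vimage_le[OF T]) auto
      also have "\<dots> \<le> ?K * emeasure lborel A"
        using A by (intro mult_left_mono emeasure_mono) auto
      finally show "emeasure ?N (?A n) \<le> emeasure (scale_measure ?K lborel) A" by simp
    qed
    finally show ?thesis .
  qed
  have "(\<integral>\<^sup>+x. f (T x) \<partial>lborel) = (\<integral>\<^sup>+x. f x \<partial>?N)"
    using f by (subst nn_integral_distr) auto
  also have "\<dots> \<le> (\<integral>\<^sup>+x. f x \<partial>scale_measure ?K lborel)"
    using le by (intro nn_integral_mono_measure) (auto simp: le_measure)
  also have "\<dots> = ?K * (\<integral>\<^sup>+x. f x \<partial>lborel)"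
    using f by (intro nn_integral_scale_measure) auto
  also have "\<dots> < \<infinity>" using fin by (simp add: ennreal_mult_less_top)
  finally show ?thesis .
qed

section \<open>Uniqueness of traces\<close>

text \<open>Integrates the derivative of \<open>(b - s) W(s)\<^sup>2\<close>.\<close>

lemma boundary_value_le:
  fixes W :: "real \<Rightarrow> real"
  assumes ab: "a < b" and W: "\<And>s. (W has_real_derivative W' s) (at s)" and W': "continuous_on UNIV W'"
  shows "ennreal ((b - a) * (W a)\<^sup>2) \<le>
    (\<integral>\<^sup>+s. ennreal ((1 + (b - a)) * ((W s)\<^sup>2 + (W' s)\<^sup>2)) * indicator {a<..<b} s \<partial>lborel)"
proof -
  let ?f = "\<lambda>s. (W s)\<^sup>2 - 2 * (b - s) * W s * W' s"
  let ?g = "\<lambda>s. (1 + (b - a)) * ((W s)\<^sup>2 + (W' s)\<^sup>2)"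
  have cW: "continuous_on UNIV W"
    using W by (intro DERIV_continuous_on) (auto intro: has_field_derivative_at_within)
  have cf: "continuous_on UNIV ?f" by (intro continuous_intros cW W')
  have d: "((\<lambda>s. - ((b - s) * (W s)\<^sup>2)) has_real_derivative ?f s) (at s)" for s
    by (auto intro!: derivative_eq_intros W simp: algebra_simps power2_eq_square)
  \<comment> \<open>The weight \<open>b - s\<close> vanishes at \<open>b\<close>, so only the value
    at \<open>a\<close> survives.\<close>
  have ftc: "(\<integral>s. ?f s * indicator {a..b} s \<partial>lborel) = (b - a) * (W a)\<^sup>2"
    using integral_FTC_Icc_real[of a b "\<lambda>s. - ((b - s) * (W s)\<^sup>2)" ?f] ab d cf
    by (simp add: continuous_on_eq_continuous_at)
  have int: "integrable lborel (\<lambda>s. ?f s * indicator {a..b} s)"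
    using borel_integrable_compact[of "{a..b}" ?f] continuous_on_subset[OF cf]
    by (simp add: mult.commute)
  have le: "?f s \<le> ?g s" if "a \<le> s" "s \<le> b" for s
  proof -
    have "- (2 * (W s * W' s)) \<le> (W s)\<^sup>2 + (W' s)\<^sup>2"
      using zero_le_power2[of "W s + W' s"] by (simp add: power2_sum)
    then have "(b - s) * (- (2 * (W s * W' s))) \<le> (b - s) * ((W s)\<^sup>2 + (W' s)\<^sup>2)"
      using that by (intro mult_left_mono) auto
    also have "\<dots> \<le> (b - a) * ((W s)\<^sup>2 + (W' s)\<^sup>2)"
      using that by (intro mult_right_mono) auto
    finally have "(b - s) * (- (2 * (W s * W' s))) \<le> (b - a) * ((W s)\<^sup>2 + (W' s)\<^sup>2)" .
    moreover have "?f s = (W s)\<^sup>2 + (b - s) * (- (2 * (W s * W' s)))"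
      by (simp add: algebra_simps)
    moreover have "?g s = ((W s)\<^sup>2 + (W' s)\<^sup>2) + (b - a) * ((W s)\<^sup>2 + (W' s)\<^sup>2)"
      by (simp add: distrib_right)
    ultimately show ?thesis using zero_le_power2[of "W' s"] by linarith
  qed
  have cg: "continuous_on UNIV ?g" by (intro continuous_intros cW W')
  have intg: "integrable lborel (\<lambda>s. ?g s * indicator {a..b} s)"
    using borel_integrable_compact[of "{a..b}" ?g] continuous_on_subset[OF cg]
    by (simp add: mult.commute)
  have "(b - a) * (W a)\<^sup>2 \<le> (\<integral>s. ?g s * indicator {a..b} s \<partial>lborel)"
    unfolding ftc[symmetric]
  proof (rule integral_mono[OF int intg])
    show "?f s * indicator {a..b} s \<le> ?g s * indicator {a..b} s" for s
    proof (cases "s \<in> {a..b}")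
      case True
      then have "?f s \<le> ?g s" by (intro le) auto
      then show ?thesis by (rule mult_right_mono) simp
    qed simp
  qed
  then have "ennreal ((b - a) * (W a)\<^sup>2) \<le> ennreal (\<integral>s. ?g s * indicator {a..b} s \<partial>lborel)"
    by (rule ennreal_leI)
  also have "\<dots> = (\<integral>\<^sup>+s. ennreal (?g s * indicator {a..b} s) \<partial>lborel)"
    using ab by (intro nn_integral_eq_integral[symmetric] intg) simp
  \<comment> \<open>The endpoint \<open>a\<close> will be a boundary point; a chart places only the
    open segment above it inside the domain.\<close>
  also have "\<dots> = (\<integral>\<^sup>+s. ennreal (?g s) * indicator {a<..<b} s \<partial>lborel)"
  proof (rule nn_integral_cong_AE)
    have "AE s in lborel. s \<noteq> a" "AE s in lborel. s \<noteq> b" by (rule AE_lborel_singleton)+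
    then show "AE s in lborel. ennreal (?g s * indicator {a..b} s) = ennreal (?g s) * indicator {a<..<b} s"
    proof eventually_elim
      case (elim s)
      then show ?case by (cases "a < s \<and> s < b") auto
    qed
  qed
  finally show ?thesis .
qed

text \<open>Summability replaces the extraction of an almost everywhere convergent
  subsequence.\<close>

lemma suminf_power2_finite_imp_tendsto_0:
  fixes c :: "nat \<Rightarrow> real"
  assumes "(\<Sum>k. ennreal ((c k)\<^sup>2)) < \<infinity>"
  shows "c \<longlonglongrightarrow> 0"
proof -
  have "summable (\<lambda>k. (c k)\<^sup>2)"
    using assms by (intro summable_suminf_not_top) auto
  then have "(\<lambda>k. (c k)\<^sup>2) \<longlonglongrightarrow> 0" by (rule summable_LIMSEQ_zero)
  then have "(\<lambda>k. sqrt ((c k)\<^sup>2)) \<longlonglongrightarrow> sqrt 0" by (rule tendsto_real_sqrt)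
  then show ?thesis by (simp add: tendsto_rabs_zero_iff)
qed

text \<open>By Tonelli the summed energy is finite along almost every vertical line, and
  \<open>boundary_value_le\<close> bounds the squares of the boundary values by it.\<close>

lemma chart_boundary_values_tendsto_0:
  fixes \<Omega> :: "('m::euclidean_space \<times> real) set"
  assumes chart: "lipschitz_chart \<Omega> a R r h \<gamma>" and \<Omega>: "open \<Omega>"
    and w: "\<And>k x. GDERIV (w k) x :> D k x" "\<And>k. continuous_on UNIV (D k)"
    and fin: "(\<Sum>k. \<integral>\<^sup>+x. ennreal ((w k x)\<^sup>2 + (norm (D k x))\<^sup>2) * indicator \<Omega> x \<partial>lborel) < \<infinity>"
  shows "AE y in lborel. y \<in> ball 0 r \<longrightarrow> (\<lambda>k. w k (a + R (y, \<gamma> y))) \<longlonglongrightarrow> 0"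
proof -
  let ?T = "\<lambda>p. a + R p"
  have R: "orthogonal_transformation R" "linear R"
    using chart by (auto simp: lipschitz_chart_def orthogonal_transformation_linear)
  have dist: "dist (?T x) (?T y) = dist x y" for x y
    using R by (simp add: dist_norm linear_diff[symmetric] orthogonal_transformation_norm)
  have "continuous_on UNIV ?T" unfolding continuous_on_iff by (metis dist)
  then have mT[measurable]: "?T \<in> borel_measurable borel" by (rule borel_measurable_continuous_onI)
  have cw: "continuous_on UNIV (w k)" for k by (rule GDERIV_imp_continuous_on[OF w(1)])
  have mw[measurable]: "w k \<in> borel_measurable borel" "D k \<in> borel_measurable borel" for k
    using cw w(2) by (auto intro: borel_measurable_continuous_onI)
  have m\<Omega>[measurable]: "\<Omega> \<in> sets borel" using \<Omega> by simp
  let ?e = "\<lambda>k x. ennreal ((w k x)\<^sup>2 + (norm (D k x))\<^sup>2)"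
  \<comment> \<open>Summing over \<open>k\<close> before slicing gives one exceptional set of lines
    for the whole sequence.\<close>
  let ?F = "\<lambda>x. (\<Sum>k. ?e k x * indicator \<Omega> x)"
  have "(\<integral>\<^sup>+x. ?F x \<partial>lborel) = (\<Sum>k. \<integral>\<^sup>+x. ?e k x * indicator \<Omega> x \<partial>lborel)"
    by (rule nn_integral_suminf) measurable
  then have "(\<integral>\<^sup>+p. ?F (?T p) \<partial>lborel) < \<infinity>"
    using fin by (intro nn_integral_isometry_finite[OF dist]) auto
  then have "(\<integral>\<^sup>+y. (\<integral>\<^sup>+s. ?F (?T (y, s)) \<partial>lborel) \<partial>lborel) < \<infinity>"
    by (subst lborel.nn_integral_fst) (auto simp: lborel_prod)
  moreover have "(\<lambda>y. \<integral>\<^sup>+s. ?F (?T (y, s)) \<partial>lborel) \<in> borel_measurable lborel"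
    by (rule lborel.borel_measurable_nn_integral_fst) (simp add: lborel_prod)
  ultimately have "AE y in lborel. (\<integral>\<^sup>+s. ?F (?T (y, s)) \<partial>lborel) \<noteq> \<infinity>"
    by (intro nn_integral_PInf_AE) auto
  then show ?thesis
  proof eventually_elim
    case (elim y)
    show ?case
    proof
      assume y: "y \<in> ball 0 r"
      \<comment> \<open>The direction of the vertical lines; since it is a unit vector, derivatives
        along it are bounded by the gradient.\<close>
      define u where "u = R (0, 1)"
      have u: "norm u = 1" using R(1) by (simp add: u_def orthogonal_transformation_norm norm_Pair)
      have Tys: "?T (y, s) = ?T (y, 0) + s *\<^sub>R u" for s
        using linear_add[OF R(2), of "(y, 0)" "s *\<^sub>R (0, 1)"] linear_scale[OF R(2), of s "(0, 1)"]
        by (simp add: u_def)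
      have gam: "\<bar>\<gamma> y\<bar> < h" using chart y by (auto simp: lipschitz_chart_def)
      have in\<Omega>: "?T (y, s) \<in> \<Omega>" if "\<gamma> y < s" "s < h" for s
      proof -
        have "s \<in> {- h<..<h}" using that gam by auto
        with chart y that(1) show ?thesis unfolding lipschitz_chart_def by blast
      qed
      let ?c = "1 + (h - \<gamma> y)"
      have bv: "ennreal ((h - \<gamma> y) * (w k (?T (y, \<gamma> y)))\<^sup>2) \<le>
          ennreal ?c * (\<integral>\<^sup>+s. ?e k (?T (y, s)) * indicator \<Omega> (?T (y, s)) \<partial>lborel)" for k
      proof -
        let ?W = "\<lambda>s. w k (?T (y, s))"
        let ?W' = "\<lambda>s. D k (?T (y, s)) \<bullet> u"
        have dW: "(?W has_real_derivative ?W' s) (at s)" for s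
        proof -
          have "(w k has_derivative (\<lambda>z. z \<bullet> D k (?T (y, s)))) (at (?T (y, 0) + s *\<^sub>R u))"
            using w(1)[of k "?T (y, s)"] unfolding gderiv_def Tys[of s, symmetric] .
          moreover have "((\<lambda>s. ?T (y, 0) + s *\<^sub>R u) has_derivative (\<lambda>t. t *\<^sub>R u)) (at s)"
            by (auto intro!: derivative_eq_intros)
          ultimately have "((\<lambda>s. w k (?T (y, 0) + s *\<^sub>R u)) has_derivative
              (\<lambda>t. (t *\<^sub>R u) \<bullet> D k (?T (y, s)))) (at s)"
            by (rule has_derivative_compose[rotated])
          then show ?thesis
            unfolding has_field_derivative_def inner_scaleR_left Tys[symmetric] inner_commute[of u]
              mult.commute[of _ "D k (?T (y, s)) \<bullet> u"] .
        qed
        have "continuous_on UNIV (\<lambda>s. D k (?T (y, 0) + s *\<^sub>R u) \<bullet> u)"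
          by (intro continuous_intros continuous_on_compose2[OF w(2)]) auto
        then have cW': "continuous_on UNIV ?W'" by (simp only: Tys[symmetric])
        have "ennreal ((h - \<gamma> y) * (?W (\<gamma> y))\<^sup>2) \<le>
            (\<integral>\<^sup>+s. ennreal (?c * ((?W s)\<^sup>2 + (?W' s)\<^sup>2)) * indicator {\<gamma> y<..<h} s \<partial>lborel)"
          using gam by (intro boundary_value_le[OF _ dW cW']) auto
        also have "\<dots> \<le> (\<integral>\<^sup>+s. ennreal ?c * (?e k (?T (y, s)) * indicator \<Omega> (?T (y, s))) \<partial>lborel)"
        proof (rule nn_integral_mono)
          fix s
          have "\<bar>?W' s\<bar> \<le> norm (D k (?T (y, s)))"
            using Cauchy_Schwarz_ineq2[of "D k (?T (y, s))" u] u by simp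
          then have "(?W' s)\<^sup>2 \<le> (norm (D k (?T (y, s))))\<^sup>2"
            using power_mono[of "\<bar>?W' s\<bar>" _ 2] by simp
          then have "ennreal (?c * ((?W s)\<^sup>2 + (?W' s)\<^sup>2)) \<le> ennreal ?c * ?e k (?T (y, s))"
            using gam by (subst ennreal_mult[symmetric]) (auto intro!: ennreal_leI mult_left_mono)
          then show "ennreal (?c * ((?W s)\<^sup>2 + (?W' s)\<^sup>2)) * indicator {\<gamma> y<..<h} s \<le>
              ennreal ?c * (?e k (?T (y, s)) * indicator \<Omega> (?T (y, s)))"
            using in\<Omega>[of s] by (auto simp: indicator_def)
        qed
        also have "\<dots> = ennreal ?c * (\<integral>\<^sup>+s. ?e k (?T (y, s)) * indicator \<Omega> (?T (y, s)) \<partial>lborel)"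
          by (rule nn_integral_cmult) measurable
        finally show ?thesis .
      qed
      have "(\<Sum>k. ennreal ((h - \<gamma> y) * (w k (?T (y, \<gamma> y)))\<^sup>2)) \<le>
          (\<Sum>k. ennreal ?c * (\<integral>\<^sup>+s. ?e k (?T (y, s)) * indicator \<Omega> (?T (y, s)) \<partial>lborel))"
        by (intro suminf_le bv) auto
      also have "\<dots> = ennreal ?c * (\<integral>\<^sup>+s. ?F (?T (y, s)) \<partial>lborel)"
        by (subst nn_integral_suminf) auto
      also have "\<dots> < \<infinity>" using elim by (simp add: ennreal_mult_less_top less_top)
      \<comment> \<open>The factor \<open>h - \<gamma> y\<close> is positive on this line and is
        moved into the square.\<close>
      finally have "(\<Sum>k. ennreal ((sqrt (h - \<gamma> y) * w k (?T (y, \<gamma> y)))\<^sup>2)) < \<infinity>"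
        using gam by (simp add: power_mult_distrib)
      then have "(\<lambda>k. sqrt (h - \<gamma> y) * w k (?T (y, \<gamma> y))) \<longlonglongrightarrow> 0"
        by (rule suminf_power2_finite_imp_tendsto_0)
      then show "(\<lambda>k. w k (?T (y, \<gamma> y))) \<longlonglongrightarrow> 0"
        using gam tendsto_mult_left_iff[of "sqrt (h - \<gamma> y)" "\<lambda>k. w k (?T (y, \<gamma> y))" 0 sequentially] by simp
    qed
  qed
qed

text \<open>Charts control the boundary only locally; subadditivity over a finite subcover makes the
  conclusion global.\<close>

lemma hausdorff_outer_null_local:
  assumes d: "0 < d" and S: "compact S" "A \<subseteq> S"
    and local: "\<And>x. x \<in> S \<Longrightarrow> \<exists>V. open V \<and> x \<in> V \<and> hausdorff_outer d (A \<inter> V) = 0"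
  shows "hausdorff_outer d A = 0"
proof -
  obtain V where V: "\<And>x. x \<in> S \<Longrightarrow> open (V x) \<and> x \<in> V x \<and> hausdorff_outer d (A \<inter> V x) = 0"
    using local by metis
  have "S \<subseteq> (\<Union>x\<in>S. V x)" using V by blast
  then obtain F where F: "F \<subseteq> S" "finite F" "S \<subseteq> (\<Union>x\<in>F. V x)"
    using compactE_image[OF S(1), of S V] V by metis
  have "hausdorff_outer d (A \<inter> (\<Union>x\<in>F. V x)) = 0" using F(2,1)
  proof (induction F)
    case (insert x F)
    have "hausdorff_outer d (A \<inter> (\<Union>x\<in>insert x F. V x)) =
        hausdorff_outer d ((A \<inter> V x) \<union> (A \<inter> (\<Union>x\<in>F. V x)))"
      by (simp add: Int_Un_distrib)
    also have "\<dots> \<le> hausdorff_outer d (A \<inter> V x) + hausdorff_outer d (A \<inter> (\<Union>x\<in>F. V x))"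
      by (rule hausdorff_outer_Un_le[OF d])
    also have "\<dots> = 0" using insert V by auto
    finally show ?case by simp
  qed (simp add: hausdorff_outer_empty[OF d])
  moreover have "A \<inter> (\<Union>x\<in>F. V x) = A" using F(3) S(2) by blast
  ultimately show ?thesis by simp
qed

text \<open>A chart describes membership in \<open>\<Omega>\<close>, not the boundary. Points of the
  cylinder above the graph are in the open set \<open>\<Omega>\<close>, those below have a
  neighbourhood outside it, so boundary points can only lie on the graph.\<close>

lemma chart_cylinder:
  fixes \<Omega> :: "('m::euclidean_space \<times> real) set"
  assumes chart: "lipschitz_chart \<Omega> a R r h \<gamma>" and \<Omega>: "open \<Omega>" and y: "y \<in> ball 0 r"
  obtains V where "open V" "a + R (y, \<gamma> y) \<in> V"
    "frontier \<Omega> \<inter> V \<subseteq> (\<lambda>y. a + R (y, \<gamma> y)) ` ball 0 r"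
proof -
  let ?T = "\<lambda>p. a + R p"
  let ?Q = "ball (0::'m) r \<times> {- h<..<h}"
  have R: "orthogonal_transformation R" and gam: "\<And>y. y \<in> ball 0 r \<Longrightarrow> \<bar>\<gamma> y\<bar> < h"
    and epi: "\<And>y s. y \<in> ball 0 r \<Longrightarrow> s \<in> {- h<..<h} \<Longrightarrow> a + R (y, s) \<in> \<Omega> \<longleftrightarrow> \<gamma> y < s"
    using chart unfolding lipschitz_chart_def by blast+
  obtain L where L: "L-lipschitz_on (ball 0 r) \<gamma>" using chart unfolding lipschitz_chart_def by blast
  have openT: "open (?T ` X)" if "open X" for X
  proof -
    have "open (R ` X)"
      using that R by (intro open_surjective_linear_image orthogonal_transformation_surj
          orthogonal_transformation_linear)
    then have "open ((+) a ` (R ` X))" by (rule open_translation)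
    then show ?thesis by (simp add: image_image)
  qed
  have openQ: "open ?Q" by (intro open_Times) auto
  \<comment> \<open>Open because \<open>\<gamma>\<close> is continuous; once its image is disjoint
    from \<open>\<Omega>\<close>, it is disjoint from the closure too.\<close>
  let ?B = "{p \<in> ?Q. snd p - \<gamma> (fst p) < 0}"
  have "continuous_on ?Q (\<lambda>p. snd p - \<gamma> (fst p))"
    by (intro continuous_intros continuous_on_compose2[OF lipschitz_on_continuous_on[OF L]]) auto
  then have "open ((\<lambda>p. snd p - \<gamma> (fst p)) -` {..<0} \<inter> ?Q)"
    using openQ by (intro continuous_on_open_vimage[THEN iffD1, rule_format]) auto
  also have "(\<lambda>p. snd p - \<gamma> (fst p)) -` {..<0} \<inter> ?Q = ?B" by auto
  finally have "open (?T ` ?B)" by (rule openT)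
  moreover have "?T ` ?B \<inter> \<Omega> = {}" using epi by force
  ultimately have B: "?T ` ?B \<inter> closure \<Omega> = {}" by (simp add: open_Int_closure_eq_empty)
  show thesis
  proof (rule that[of "?T ` ?Q"])
    show "open (?T ` ?Q)" by (rule openT[OF openQ])
    have "(y, \<gamma> y) \<in> ?Q" using gam[OF y] y by (auto simp: abs_less_iff)
    then show "a + R (y, \<gamma> y) \<in> ?T ` ?Q" by blast
    show "frontier \<Omega> \<inter> ?T ` ?Q \<subseteq> (\<lambda>y. a + R (y, \<gamma> y)) ` ball 0 r"
    proof
      fix x assume x: "x \<in> frontier \<Omega> \<inter> ?T ` ?Q"
      then obtain z s where zs: "x = a + R (z, s)" "z \<in> ball 0 r" "s \<in> {- h<..<h}" by blast
      have "x \<in> closure \<Omega>" "x \<notin> \<Omega>" using x \<Omega> by (auto simp: frontier_def interior_open)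
      then have "\<not> \<gamma> z < s" using epi[OF zs(2,3)] zs(1) by simp
      moreover have "\<not> s < \<gamma> z"
      proof
        assume "s < \<gamma> z"
        then have "(z, s) \<in> ?B" using zs by simp
        then have "x \<in> ?T ` ?B" unfolding zs(1) by (rule imageI)
        with B \<open>x \<in> closure \<Omega>\<close> show False by blast
      qed
      ultimately have "s = \<gamma> z" by simp
      then show "x \<in> (\<lambda>y. a + R (y, \<gamma> y)) ` ball 0 r" using zs by blast
    qed
  qed
qed

lemma chart_graph_lipschitz:
  fixes \<Omega> :: "('m::euclidean_space \<times> real) set"
  assumes chart: "lipschitz_chart \<Omega> a R r h \<gamma>"
  obtains L where "L-lipschitz_on (ball 0 r) (\<lambda>y. a + R (y, \<gamma> y))"
proof -
  obtain L where L: "L-lipschitz_on (ball 0 r) \<gamma>" using chart unfolding lipschitz_chart_def by blast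
  have R: "orthogonal_transformation R" using chart unfolding lipschitz_chart_def by blast
  have "(1 + L)-lipschitz_on (ball 0 r) (\<lambda>y. a + R (y, \<gamma> y))"
  proof (rule lipschitz_onI)
    show "0 \<le> 1 + L" using lipschitz_on_nonneg[OF L] by simp
    fix x y :: 'm assume xy: "x \<in> ball 0 r" "y \<in> ball 0 r"
    have "dist (a + R (x, \<gamma> x)) (a + R (y, \<gamma> y)) = dist (x, \<gamma> x) (y, \<gamma> y)"
      using R by (simp add: dist_norm linear_diff[OF orthogonal_transformation_linear[OF R], symmetric]
          orthogonal_transformation_norm)
    also have "\<dots> \<le> dist x y + dist (\<gamma> x) (\<gamma> y)"
      unfolding dist_Pair_Pair by (rule sqrt_sum_squares_le_sum) auto
    also have "\<dots> \<le> (1 + L) * dist x y"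
      using lipschitz_onD[OF L xy] by (simp add: algebra_simps)
    finally show "dist (a + R (x, \<gamma> x)) (a + R (y, \<gamma> y)) \<le> (1 + L) * dist x y" .
  qed
  then show thesis by (rule that)
qed

section \<open>Surface measure on the boundary\<close>

lemma sets_surface_borel:
  "sets borel \<subseteq> sets (surface :: ('m::euclidean_space \<times> real) measure)"
  unfolding surface_def by (rule borel_subset_sets_hausdorff) simp

lemma space_surface: "space surface = UNIV"
  unfolding surface_def by (rule space_hausdorff_measure)

lemma borel_measurable_surface:
  fixes f :: "'m::euclidean_space \<times> real \<Rightarrow> real"
  assumes "continuous_on UNIV f"
  shows "f \<in> borel_measurable surface"
  using borel_measurable_continuous_onI[OF assms] sets_surface_borel
  by (auto simp: measurable_def space_surface)

text \<open>Near each boundary point \<open>A\<close> lies on one graph, where it is the Lipschitz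
  image of a null set of parameters; compactness of the frontier does the rest.\<close>

lemma frontier_null_setsI:
  fixes \<Omega> :: "('m::euclidean_space \<times> real) set"
  assumes \<Omega>: "lipschitz_domain \<Omega>" and A: "A \<subseteq> frontier \<Omega>"
    and chart: "\<And>a R r h \<gamma>. lipschitz_chart \<Omega> a R r h \<gamma> \<Longrightarrow>
      AE y in lborel. y \<in> ball 0 r \<longrightarrow> a + R (y, \<gamma> y) \<notin> A"
  shows "A \<in> null_sets surface"
proof -
  have "hausdorff_outer DIM('m) A = 0"
  proof (rule hausdorff_outer_null_local)
    show "compact (frontier \<Omega>)"
      using \<Omega> by (intro compact_frontier_bounded) (simp add: lipschitz_domain_def)
    fix x assume "x \<in> frontier \<Omega>"
    then obtain a R r h \<gamma> y where c: "lipschitz_chart \<Omega> a R r h \<gamma>" "y \<in> ball 0 r" "x = a + R (y, \<gamma> y)"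
      using \<Omega> unfolding lipschitz_domain_def by blast
    have "open \<Omega>" using \<Omega> by (simp add: lipschitz_domain_def)
    then obtain V where V: "open V" "x \<in> V" "frontier \<Omega> \<inter> V \<subseteq> (\<lambda>y. a + R (y, \<gamma> y)) ` ball 0 r"
      using chart_cylinder[OF c(1) _ c(2)] c(3) by metis
    obtain N where N: "N \<in> null_sets lborel" "{y. \<not> (y \<in> ball 0 r \<longrightarrow> a + R (y, \<gamma> y) \<notin> A)} \<subseteq> N"
      using chart[OF c(1)] by (auto simp: eventually_ae_filter)
    obtain L where L: "L-lipschitz_on (ball 0 r) (\<lambda>y. a + R (y, \<gamma> y))"
      using chart_graph_lipschitz[OF c(1)] by blast
    have "hausdorff_outer DIM('m) ((\<lambda>y. a + R (y, \<gamma> y)) ` (N \<inter> ball 0 r)) = 0"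
    proof (rule hausdorff_outer_Lipschitz_image_null)
      have "N \<in> null_sets lebesgue" using N(1) by (rule null_sets_completionI)
      then show "N \<inter> ball 0 r \<in> null_sets lebesgue" by (rule null_set_Int2) simp
      show "bounded (N \<inter> ball 0 r)" by (simp add: bounded_Int)
      show "L-lipschitz_on (N \<inter> ball 0 r) (\<lambda>y. a + R (y, \<gamma> y))"
        using L by (rule lipschitz_on_subset) simp
    qed
    moreover have "hausdorff_outer DIM('m) (A \<inter> V) \<le>
        hausdorff_outer DIM('m) ((\<lambda>y. a + R (y, \<gamma> y)) ` (N \<inter> ball 0 r))"
    proof (intro hausdorff_outer_mono subsetI)
      fix z assume z: "z \<in> A \<inter> V"
      then obtain y where "z = a + R (y, \<gamma> y)" "y \<in> ball 0 r" using V(3) A by blast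
      with z N(2) show "z \<in> (\<lambda>y. a + R (y, \<gamma> y)) ` (N \<inter> ball 0 r)" by blast
    qed
    ultimately have "hausdorff_outer DIM('m) (A \<inter> V) \<le> 0"
      by simp
    then have "hausdorff_outer DIM('m) (A \<inter> V) = 0" by simp
    with V(1,2) show "\<exists>V. open V \<and> x \<in> V \<and> hausdorff_outer DIM('m) (A \<inter> V) = 0"
      by (intro exI conjI)
  qed (simp_all add: A)
  then show ?thesis
    unfolding surface_def by (intro hausdorff_null_setsI) simp_all
qed

section \<open>The space \<open>H\<^sup>1\<close>\<close>

lemma weak_gradient_diff:
  assumes U: "open U" "bounded U" and u: "u \<in> L2 (lebesgue_on U)" and v: "v \<in> L2 (lebesgue_on U)"
    and G: "weak_gradient U u G" and H: "weak_gradient U v H"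
  shows "weak_gradient U (\<lambda>x. u x - v x) (\<lambda>x. G x - H x)"
proof -
  have "weak_gradient U (\<lambda>x. - 1 * v x) (\<lambda>x. - 1 *\<^sub>R H x + v x *\<^sub>R 0)"
    by (rule weak_gradient_smooth_mult[OF U v H smooth_const GDERIV_const]) simp
  from weak_gradient_add[OF U u L2_cmult[OF v, of "- 1"] G this] show ?thesis by simp
qed

lemma H1_diff:
  assumes U: "open U" "bounded U" and "u \<in> H1 U" "v \<in> H1 U"
  shows "(\<lambda>x. u x - v x) \<in> H1 U"
  using assms L2_diff weak_gradient_diff[OF U] unfolding H1_def by blast

lemma smooth_H1:
  assumes U: "open U" "bounded U" and "smooth \<psi>"
  shows "\<psi> \<in> H1 U"
proof -
  obtain E where "\<And>x. GDERIV \<psi> x :> E x" "continuous_on UNIV E"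
    using smooth_gderivE[OF assms(3)] by blast
  from weak_gradient_smooth[OF U assms(3) this] L2_continuous[OF smooth_continuous_on[OF assms(3)] U]
  show ?thesis unfolding H1_def by blast
qed

lemma smooth_mult_H1:
  assumes U: "open U" "bounded U" and \<psi>: "smooth \<psi>" and u: "u \<in> H1 U"
  shows "(\<lambda>x. \<psi> x * u x) \<in> H1 U"
proof -
  obtain E where "\<And>x. GDERIV \<psi> x :> E x" "continuous_on UNIV E"
    using smooth_gderivE[OF \<psi>] by blast
  from weak_gradient_smooth_mult[OF U H1_L2[OF u] weak_gradient_grad[OF u] \<psi> this]
    L2_continuous_mult[OF smooth_continuous_on[OF \<psi>] U(2) H1_L2[OF u]]
  show ?thesis unfolding H1_def by blast
qed

lemma inner_weak_gradient_integrable: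
  assumes "weak_gradient U u G" "weak_gradient U v H"
  shows "integrable (lebesgue_on U) (\<lambda>x. G x \<bullet> H x)"
  using assms by (intro L2_inner_integrable) (auto simp: weak_gradient_def)

text \<open>Allows \<open>a_form\<close> to be computed from any weak gradients, such as those given
  by the difference and product rules.\<close>

lemma a_form_eq:
  assumes U: "open U" "bounded U" and u: "u \<in> H1 U" and v: "v \<in> H1 U"
    and G: "weak_gradient U u G" and H: "weak_gradient U v H"
  shows "integrable (lebesgue_on U) (\<lambda>x. G x \<bullet> H x + u x * v x)"
    and "a_form U u v = (LINT x|lebesgue_on U. G x \<bullet> H x + u x * v x)"
proof -
  have int: "integrable (lebesgue_on U) (\<lambda>x. G x \<bullet> H x + u x * v x)"
    if "weak_gradient U u G" "weak_gradient U v H" for G H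
    using that u v by (intro Bochner_Integration.integrable_add inner_weak_gradient_integrable
        L2_mult_integrable H1_L2)
  show "integrable (lebesgue_on U) (\<lambda>x. G x \<bullet> H x + u x * v x)" by (rule int[OF G H])
  have "AE x in lebesgue_on U. grad U u x = G x" "AE x in lebesgue_on U. grad U v x = H x"
    using weak_gradient_unique[OF U] weak_gradient_grad u v G H by blast+
  then have "AE x in lebesgue_on U. grad U u x \<bullet> grad U v x + u x * v x = G x \<bullet> H x + u x * v x"
    by eventually_elim simp
  then show "a_form U u v = (LINT x|lebesgue_on U. G x \<bullet> H x + u x * v x)"
    unfolding a_form_def using int[OF weak_gradient_grad[OF u] weak_gradient_grad[OF v]] int[OF G H]
    by (intro integral_cong_AE) auto
qed

lemma H1_norm_power2:
  assumes U: "open U" "bounded U" and u: "u \<in> H1 U" and G: "weak_gradient U u G"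
  shows "(H1_norm U u)\<^sup>2 = (LINT x|lebesgue_on U. (norm (G x))\<^sup>2 + (u x)\<^sup>2)"
    and "integrable (lebesgue_on U) (\<lambda>x. (norm (G x))\<^sup>2 + (u x)\<^sup>2)"
proof -
  have eq: "(norm (H x))\<^sup>2 + (u x)\<^sup>2 = H x \<bullet> H x + u x * u x" for H :: "'a \<Rightarrow> 'a" and x
    unfolding power2_norm_eq_inner power2_eq_square[of "u x"] ..
  show "integrable (lebesgue_on U) (\<lambda>x. (norm (G x))\<^sup>2 + (u x)\<^sup>2)"
    unfolding eq by (rule a_form_eq(1)[OF U u u G G])
  have "(H1_norm U u)\<^sup>2 = (LINT x|lebesgue_on U. (norm (grad U u x))\<^sup>2 + (u x)\<^sup>2)"
    unfolding H1_norm_def by (intro real_sqrt_pow2 integral_nonneg_AE) auto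
  also have "\<dots> = a_form U u u" unfolding eq a_form_def ..
  also have "\<dots> = (LINT x|lebesgue_on U. (norm (G x))\<^sup>2 + (u x)\<^sup>2)"
    unfolding eq by (rule a_form_eq(2)[OF U u u G G])
  finally show "(H1_norm U u)\<^sup>2 = (LINT x|lebesgue_on U. (norm (G x))\<^sup>2 + (u x)\<^sup>2)" .
qed

lemma H1_norm_nonneg: "0 \<le> H1_norm U u"
  unfolding H1_norm_def by (intro real_sqrt_ge_zero integral_nonneg_AE) auto

lemma norm_add_power2_le: "(norm (x + y))\<^sup>2 \<le> 2 * (norm x)\<^sup>2 + 2 * (norm y)\<^sup>2"
  for x y :: "'a::real_normed_vector"
proof -
  have "(norm (x + y))\<^sup>2 \<le> (norm x + norm y)\<^sup>2"
    by (intro power_mono norm_triangle_ineq) auto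
  also have "\<dots> \<le> 2 * (norm x)\<^sup>2 + 2 * (norm y)\<^sup>2"
    using zero_le_power2[of "norm x - norm y"] by (simp add: power2_sum power2_diff)
  finally show ?thesis .
qed

lemma norm_diff_power2_le: "(norm (x - y))\<^sup>2 \<le> 2 * (norm x)\<^sup>2 + 2 * (norm y)\<^sup>2"
  for x y :: "'a::real_normed_vector"
  using norm_add_power2_le[of x "- y"] by simp

lemma H1_norm_diff_power2_le:
  assumes U: "open U" "bounded U" and u: "u \<in> H1 U" and v: "v \<in> H1 U"
  shows "(H1_norm U (\<lambda>x. u x - v x))\<^sup>2 \<le> 2 * (H1_norm U u)\<^sup>2 + 2 * (H1_norm U v)\<^sup>2"
proof -
  let ?G = "grad U u" and ?H = "grad U v"
  note G = weak_gradient_grad[OF u] and H = weak_gradient_grad[OF v]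
  note w = weak_gradient_diff[OF U H1_L2[OF u] H1_L2[OF v] G H]
  note nu = H1_norm_power2[OF U u G] and nv = H1_norm_power2[OF U v H]
    and nw = H1_norm_power2[OF U H1_diff[OF U u v] w]
  have "(H1_norm U (\<lambda>x. u x - v x))\<^sup>2 \<le>
      (LINT x|lebesgue_on U. 2 * ((norm (?G x))\<^sup>2 + (u x)\<^sup>2) + 2 * ((norm (?H x))\<^sup>2 + (v x)\<^sup>2))"
    unfolding nw(1)
  proof (rule integral_mono[OF nw(2)])
    show "integrable (lebesgue_on U) (\<lambda>x. 2 * ((norm (?G x))\<^sup>2 + (u x)\<^sup>2) + 2 * ((norm (?H x))\<^sup>2 + (v x)\<^sup>2))"
      by (intro Bochner_Integration.integrable_add integrable_mult_right nu nv)
    show "(norm (?G x - ?H x))\<^sup>2 + (u x - v x)\<^sup>2 \<le>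
        2 * ((norm (?G x))\<^sup>2 + (u x)\<^sup>2) + 2 * ((norm (?H x))\<^sup>2 + (v x)\<^sup>2)" for x
      using norm_diff_power2_le[of "?G x" "?H x"] norm_diff_power2_le[of "u x" "v x"] by simp
  qed
  also have "\<dots> = 2 * (H1_norm U u)\<^sup>2 + 2 * (H1_norm U v)\<^sup>2"
    unfolding nu(1) nv(1)
    by (subst Bochner_Integration.integral_add)
       (rule integrable_mult_right[OF nu(2)] integrable_mult_right[OF nv(2)] | simp only: integral_mult_right_zero)+
  finally show ?thesis .
qed

lemma H1_norm_smooth_mult_le:
  assumes U: "open U" "bounded U" and \<psi>: "smooth \<psi>"
  obtains c where "0 \<le> c" "\<And>u. u \<in> H1 U \<Longrightarrow> H1_norm U (\<lambda>x. \<psi> x * u x) \<le> c * H1_norm U u"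
proof -
  obtain E where E: "\<And>x. GDERIV \<psi> x :> E x" "continuous_on UNIV E"
    using smooth_gderivE[OF \<psi>] by blast
  obtain c1 where c1: "0 \<le> c1" "\<And>x. x \<in> U \<Longrightarrow> norm (\<psi> x) \<le> c1"
    using bounded_continuous_on_bounded[OF smooth_continuous_on[OF \<psi>] U(2)] by blast
  obtain c2 where c2: "0 \<le> c2" "\<And>x. x \<in> U \<Longrightarrow> norm (E x) \<le> c2"
    using bounded_continuous_on_bounded[OF E(2) U(2)] by blast
  \<comment> \<open>The gradient term contributes \<open>2 * c1\<^sup>2\<close> and
    \<open>2 * c2\<^sup>2\<close>, the zero-order term another \<open>c1\<^sup>2\<close>; the sum
    dominates the coefficients of both squares.\<close>
  define c where "c = 3 * c1\<^sup>2 + 2 * c2\<^sup>2"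
  have "H1_norm U (\<lambda>x. \<psi> x * u x) \<le> sqrt c * H1_norm U u" if u: "u \<in> H1 U" for u
  proof -
    let ?G = "grad U u"
    note G = weak_gradient_grad[OF u]
    note w = weak_gradient_smooth_mult[OF U H1_L2[OF u] G \<psi> E]
    note nu = H1_norm_power2[OF U u G] and nw = H1_norm_power2[OF U smooth_mult_H1[OF U \<psi> u] w]
    have "(H1_norm U (\<lambda>x. \<psi> x * u x))\<^sup>2 \<le> (LINT x|lebesgue_on U. c * ((norm (?G x))\<^sup>2 + (u x)\<^sup>2))"
      unfolding nw(1)
    proof (rule integral_mono[OF nw(2) integrable_mult_right[OF nu(2)]])
      fix x assume "x \<in> space (lebesgue_on U)"
      then have x: "x \<in> U" by (simp add: space_restrict_space)
      have a: "(\<psi> x)\<^sup>2 \<le> c1\<^sup>2" "(norm (E x))\<^sup>2 \<le> c2\<^sup>2"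
        using power_mono[OF c1(2)[OF x] norm_ge_zero, of 2] power_mono[OF c2(2)[OF x] norm_ge_zero, of 2]
        by simp_all
      have "(norm (\<psi> x *\<^sub>R ?G x + u x *\<^sub>R E x))\<^sup>2 + (\<psi> x * u x)\<^sup>2 \<le>
          2 * ((\<psi> x)\<^sup>2 * (norm (?G x))\<^sup>2) + 2 * ((norm (E x))\<^sup>2 * (u x)\<^sup>2) + (\<psi> x)\<^sup>2 * (u x)\<^sup>2"
        using norm_add_power2_le[of "\<psi> x *\<^sub>R ?G x" "u x *\<^sub>R E x"]
        by (simp add: power_mult_distrib mult.commute)
      also have "\<dots> \<le> 2 * (c1\<^sup>2 * (norm (?G x))\<^sup>2) + 2 * (c2\<^sup>2 * (u x)\<^sup>2) + c1\<^sup>2 * (u x)\<^sup>2"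
        using a by (intro add_mono mult_left_mono mult_right_mono) auto
      also have "\<dots> \<le> c * ((norm (?G x))\<^sup>2 + (u x)\<^sup>2)"
        by (simp add: c_def algebra_simps)
      finally show "(norm (\<psi> x *\<^sub>R ?G x + u x *\<^sub>R E x))\<^sup>2 + (\<psi> x * u x)\<^sup>2 \<le> c * ((norm (?G x))\<^sup>2 + (u x)\<^sup>2)" .
    qed
    also have "\<dots> = (sqrt c * H1_norm U u)\<^sup>2"
      using nu(1) by (simp add: power_mult_distrib c_def)
    finally show ?thesis
      by (rule power2_le_imp_le) (simp add: c_def H1_norm_nonneg)
  qed
  then show thesis by (intro that[of "sqrt c"]) (simp_all add: c_def)
qed

section \<open>Traces of smooth multiples and uniqueness of traces\<close>

lemma tendsto_0_le_nonneg:
  fixes f g :: "nat \<Rightarrow> real"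
  assumes "\<And>k. f k \<le> g k" "g \<longlonglongrightarrow> 0" "\<And>k. 0 \<le> f k"
  shows "f \<longlonglongrightarrow> 0"
  by (rule tendsto_sandwich[of "\<lambda>_. 0" f sequentially g 0])
     (simp_all add: assms)

text \<open>Multiplying the approximating functions by \<open>\<psi>\<close> respects both limits:
  \<open>\<psi>\<close> and its gradient are bounded on the domain, and \<open>\<psi>\<close> is
  bounded on the compact frontier.\<close>

lemma is_trace_smooth_mult:
  fixes \<Omega> :: "('m::euclidean_space \<times> real) set"
  assumes U: "open \<Omega>" "bounded \<Omega>" and v: "v \<in> H1 \<Omega>" and tr: "is_trace \<Omega> v \<tau>" and \<psi>: "smooth \<psi>"
  shows "is_trace \<Omega> (\<lambda>x. \<psi> x * v x) (\<lambda>x. \<psi> x * \<tau> x)"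
proof -
  let ?M = "surface_on (frontier \<Omega>)"
  obtain \<phi> where \<phi>: "\<And>k::nat. smooth (\<phi> k)" "(\<lambda>k. H1_norm \<Omega> (\<lambda>x. \<phi> k x - v x)) \<longlonglongrightarrow> 0"
    "(\<lambda>k. \<integral>\<^sup>+x. ennreal ((\<phi> k x - \<tau> x)\<^sup>2) \<partial>?M) \<longlonglongrightarrow> 0" and \<tau>: "\<tau> \<in> L2 ?M"
    using tr unfolding is_trace_def by blast
  have cont: "f \<in> borel_measurable ?M" if "smooth f" for f
    by (intro measurable_restrict_space1 borel_measurable_surface smooth_continuous_on that)
  have [measurable]: "\<tau> \<in> borel_measurable ?M" "\<And>k. \<phi> k \<in> borel_measurable ?M" "\<psi> \<in> borel_measurable ?M"
    using \<tau> cont \<phi>(1) \<psi> by (auto simp: L2_def)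
  obtain b where b: "0 \<le> b" "\<And>x. x \<in> frontier \<Omega> \<Longrightarrow> norm (\<psi> x) \<le> b"
    using bounded_continuous_on_bounded[OF smooth_continuous_on[OF \<psi>] compact_imp_bounded[OF compact_frontier_bounded[OF U(2)]]] by blast
  have "(\<lambda>x. \<psi> x * \<tau> x) \<in> L2 ?M"
    using b by (intro L2_bounded_mult[OF \<tau>, of _ b]) (auto simp: space_restrict_space)
  moreover have "smooth (\<lambda>x. \<psi> x * \<phi> k x)" for k by (intro smooth_mult \<psi> \<phi>(1))
  moreover have "(\<lambda>k. H1_norm \<Omega> (\<lambda>x. \<psi> x * \<phi> k x - \<psi> x * v x)) \<longlonglongrightarrow> 0"
  proof -
    obtain c where c: "0 \<le> c" "\<And>u. u \<in> H1 \<Omega> \<Longrightarrow> H1_norm \<Omega> (\<lambda>x. \<psi> x * u x) \<le> c * H1_norm \<Omega> u"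
      using H1_norm_smooth_mult_le[OF U \<psi>] by blast
    have "H1_norm \<Omega> (\<lambda>x. \<psi> x * \<phi> k x - \<psi> x * v x) \<le> c * H1_norm \<Omega> (\<lambda>x. \<phi> k x - v x)" for k
      using c(2)[OF H1_diff[OF U smooth_H1[OF U \<phi>(1)] v]] by (simp add: right_diff_distrib)
    moreover have "(\<lambda>k. c * H1_norm \<Omega> (\<lambda>x. \<phi> k x - v x)) \<longlonglongrightarrow> 0"
      using tendsto_mult_right_zero[OF \<phi>(2)] .
    moreover have "0 \<le> H1_norm \<Omega> (\<lambda>x. \<psi> x * \<phi> k x - \<psi> x * v x)" for k
      by (rule H1_norm_nonneg)
    ultimately show ?thesis
      by (rule tendsto_0_le_nonneg)
  qed
  moreover have "(\<lambda>k. \<integral>\<^sup>+x. ennreal ((\<psi> x * \<phi> k x - \<psi> x * \<tau> x)\<^sup>2) \<partial>?M) \<longlonglongrightarrow> 0"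
  proof (rule tendsto_sandwich[where f = "\<lambda>_. 0"])
    have "(\<integral>\<^sup>+x. ennreal ((\<psi> x * \<phi> k x - \<psi> x * \<tau> x)\<^sup>2) \<partial>?M) \<le>
        ennreal (b\<^sup>2) * (\<integral>\<^sup>+x. ennreal ((\<phi> k x - \<tau> x)\<^sup>2) \<partial>?M)" for k
    proof -
      have "(\<integral>\<^sup>+x. ennreal ((\<psi> x * \<phi> k x - \<psi> x * \<tau> x)\<^sup>2) \<partial>?M) \<le>
          (\<integral>\<^sup>+x. ennreal (b\<^sup>2) * ennreal ((\<phi> k x - \<tau> x)\<^sup>2) \<partial>?M)"
      proof (rule nn_integral_mono)
        fix x assume "x \<in> space ?M"
        then have "(\<psi> x)\<^sup>2 \<le> b\<^sup>2"
          using power_mono[OF b(2) norm_ge_zero, of x 2] by (simp add: space_restrict_space)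
        then have "(\<psi> x)\<^sup>2 * (\<phi> k x - \<tau> x)\<^sup>2 \<le> b\<^sup>2 * (\<phi> k x - \<tau> x)\<^sup>2"
          by (rule mult_right_mono) simp
        then show "ennreal ((\<psi> x * \<phi> k x - \<psi> x * \<tau> x)\<^sup>2) \<le> ennreal (b\<^sup>2) * ennreal ((\<phi> k x - \<tau> x)\<^sup>2)"
          by (simp add: ennreal_mult[symmetric] right_diff_distrib[symmetric] power_mult_distrib ennreal_leI)
      qed
      also have "\<dots> = ennreal (b\<^sup>2) * (\<integral>\<^sup>+x. ennreal ((\<phi> k x - \<tau> x)\<^sup>2) \<partial>?M)"
        by (rule nn_integral_cmult) measurable
      finally show ?thesis .
    qed
    then show "\<forall>\<^sub>F k in sequentially. (\<integral>\<^sup>+x. ennreal ((\<psi> x * \<phi> k x - \<psi> x * \<tau> x)\<^sup>2) \<partial>?M) \<le>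
        ennreal (b\<^sup>2) * (\<integral>\<^sup>+x. ennreal ((\<phi> k x - \<tau> x)\<^sup>2) \<partial>?M)" by simp
    show "(\<lambda>k. ennreal (b\<^sup>2) * (\<integral>\<^sup>+x. ennreal ((\<phi> k x - \<tau> x)\<^sup>2) \<partial>?M)) \<longlonglongrightarrow> 0"
      using ennreal_tendsto_cmult[OF _ \<phi>(3), of "ennreal (b\<^sup>2)"] by simp
  qed simp_all
  ultimately show ?thesis
    unfolding is_trace_def by (intro conjI exI[of _ "\<lambda>k x. \<psi> x * \<phi> k x"] allI)
qed

lemma suminf_geometric_ennreal: "(\<Sum>k. ennreal ((1 / 2) ^ k)) < \<infinity>"
proof -
  have "(\<lambda>k. (1 / 2 :: real) ^ k) sums (1 / (1 - 1 / 2))" by (rule geometric_sums) simp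
  then have "(\<Sum>k. ennreal ((1 / 2) ^ k)) = ennreal (1 / (1 - 1 / 2))"
    by (intro suminf_ennreal_eq) auto
  then show ?thesis by simp
qed

text \<open>The difference of two approximating sequences tends to 0 in the domain, while its
  boundary values tend to \<open>\<tau> - \<sigma>\<close>. Along a fast subsequence both statements
  hold pointwise almost everywhere on the boundary.\<close>

lemma trace_unique:
  fixes \<Omega> :: "('m::euclidean_space \<times> real) set"
  assumes \<Omega>: "lipschitz_domain \<Omega>" and v: "v \<in> H1 \<Omega>"
    and \<tau>: "is_trace \<Omega> v \<tau>" and \<sigma>: "is_trace \<Omega> v \<sigma>"
  shows "AE x in surface_on (frontier \<Omega>). \<tau> x = \<sigma> x"
proof -
  let ?M = "surface_on (frontier \<Omega>)"
  have U: "open \<Omega>" "bounded \<Omega>" using \<Omega> by (auto simp: lipschitz_domain_def)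
  obtain \<phi> where \<phi>: "\<And>k::nat. smooth (\<phi> k)" "(\<lambda>k. H1_norm \<Omega> (\<lambda>x. \<phi> k x - v x)) \<longlonglongrightarrow> 0"
    "(\<lambda>k. \<integral>\<^sup>+x. ennreal ((\<phi> k x - \<tau> x)\<^sup>2) \<partial>?M) \<longlonglongrightarrow> 0" and \<tau>2: "\<tau> \<in> L2 ?M"
    using \<tau> unfolding is_trace_def by blast
  obtain \<xi> where \<xi>: "\<And>k::nat. smooth (\<xi> k)" "(\<lambda>k. H1_norm \<Omega> (\<lambda>x. \<xi> k x - v x)) \<longlonglongrightarrow> 0"
    "(\<lambda>k. \<integral>\<^sup>+x. ennreal ((\<xi> k x - \<sigma> x)\<^sup>2) \<partial>?M) \<longlonglongrightarrow> 0" and \<sigma>2: "\<sigma> \<in> L2 ?M"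
    using \<sigma> unfolding is_trace_def by blast
  let ?\<epsilon> = "\<lambda>k. 2 * (H1_norm \<Omega> (\<lambda>x. \<phi> k x - v x))\<^sup>2 + 2 * (H1_norm \<Omega> (\<lambda>x. \<xi> k x - v x))\<^sup>2"
  have \<epsilon>: "?\<epsilon> \<longlonglongrightarrow> 0"
    using tendsto_add[OF tendsto_mult_right_zero[OF tendsto_null_power[OF \<phi>(2), of 2], of 2]
        tendsto_mult_right_zero[OF tendsto_null_power[OF \<xi>(2), of 2], of 2]] by simp
  let ?\<beta> = "\<lambda>k. (\<integral>\<^sup>+x. ennreal ((\<phi> k x - \<tau> x)\<^sup>2) \<partial>?M) + (\<integral>\<^sup>+x. ennreal ((\<xi> k x - \<sigma> x)\<^sup>2) \<partial>?M)"
  have \<beta>: "?\<beta> \<longlonglongrightarrow> 0" using tendsto_add[OF \<phi>(3) \<xi>(3)] by simp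
  \<comment> \<open>One index serves the errors in the domain and on the boundary, so that a single
    sequence \<open>w\<close> is summably small for both.\<close>
  have "\<exists>m. ?\<epsilon> m < (1 / 2) ^ k \<and> ?\<beta> m < ennreal ((1 / 2) ^ k)" for k :: nat
  proof -
    have "\<forall>\<^sub>F m in sequentially. ?\<epsilon> m < (1 / 2) ^ k"
      by (rule order_tendstoD(2)[OF \<epsilon>]) simp
    moreover have "\<forall>\<^sub>F m in sequentially. ?\<beta> m < ennreal ((1 / 2) ^ k)"
      by (rule order_tendstoD(2)[OF \<beta>]) simp
    ultimately have "\<forall>\<^sub>F m in sequentially. ?\<epsilon> m < (1 / 2) ^ k \<and> ?\<beta> m < ennreal ((1 / 2) ^ k)"
      by (rule eventually_conj)
    then show ?thesis by (rule eventually_happens'[rotated]) simp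
  qed
  then have "\<forall>k. \<exists>m. ?\<epsilon> m < (1 / 2) ^ k \<and> ?\<beta> m < ennreal ((1 / 2) ^ k)" ..
  from choice[OF this] obtain m where
    m': "\<forall>k. ?\<epsilon> (m k) < (1 / 2) ^ k \<and> ?\<beta> (m k) < ennreal ((1 / 2) ^ k)" ..
  have m: "?\<epsilon> (m k) < (1 / 2) ^ k" "?\<beta> (m k) < ennreal ((1 / 2) ^ k)" for k
    using m'[THEN spec, of k] by blast+
  define w where "w k x = \<phi> (m k) x - \<xi> (m k) x" for k x
  have sw: "smooth (w k)" for k unfolding w_def by (intro smooth_diff \<phi>(1) \<xi>(1))
  have "\<exists>D. (\<forall>x. GDERIV (w k) x :> D x) \<and> continuous_on UNIV D" for k
    using smooth_gderivE[OF sw[of k]] by metis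
  then have "\<forall>k. \<exists>D. (\<forall>x. GDERIV (w k) x :> D x) \<and> continuous_on UNIV D" ..
  from choice[OF this] obtain D where
    D': "\<forall>k. (\<forall>x. GDERIV (w k) x :> D k x) \<and> continuous_on UNIV (D k)" ..
  have D: "GDERIV (w k) x :> D k x" "continuous_on UNIV (D k)" for k x
    using D'[THEN spec, of k] by blast+
  have energy: "(\<integral>\<^sup>+x. ennreal ((w k x)\<^sup>2 + (norm (D k x))\<^sup>2) * indicator \<Omega> x \<partial>lborel) \<le> ennreal ((1 / 2) ^ k)" for k
  proof -
    have p: "(\<lambda>x. \<phi> (m k) x - v x) \<in> H1 \<Omega>" and q: "(\<lambda>x. \<xi> (m k) x - v x) \<in> H1 \<Omega>"
      by (intro H1_diff[OF U] smooth_H1[OF U] \<phi>(1) \<xi>(1) v)+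
    \<comment> \<open>Written so that \<open>v\<close> cancels and the two approximation errors
      bound \<open>w k\<close>.\<close>
    have weq: "(\<lambda>x. (\<phi> (m k) x - v x) - (\<xi> (m k) x - v x)) = w k" by (simp add: w_def fun_eq_iff)
    note nw = H1_norm_power2[OF U smooth_H1[OF U sw[of k]] weak_gradient_smooth[OF U sw[of k] D(1)[of k] D(2)[of k]]]
    have meas: "(\<lambda>x. ennreal ((w k x)\<^sup>2 + (norm (D k x))\<^sup>2) * indicator \<Omega> x) \<in> borel_measurable lborel"
    proof -
      have [measurable]: "w k \<in> borel_measurable borel" "D k \<in> borel_measurable borel" "\<Omega> \<in> sets borel"
        using D(2) smooth_continuous_on[OF sw] U(1) by (auto intro: borel_measurable_continuous_onI)
      show ?thesis by measurable
    qed
    \<comment> \<open>The slicing argument uses \<open>lborel\<close>, the norm the completed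
      measure; the integrand is Borel, so both integrals agree.\<close>
    have "(\<integral>\<^sup>+x. ennreal ((w k x)\<^sup>2 + (norm (D k x))\<^sup>2) * indicator \<Omega> x \<partial>lborel) =
        (\<integral>\<^sup>+x. ennreal ((w k x)\<^sup>2 + (norm (D k x))\<^sup>2) * indicator \<Omega> x \<partial>lebesgue)"
      using meas by (subst nn_integral_completion) auto
    also have "\<dots> = (\<integral>\<^sup>+x. ennreal ((norm (D k x))\<^sup>2 + (w k x)\<^sup>2) \<partial>lebesgue_on \<Omega>)"
      using U(1) by (subst nn_integral_restrict_space) (auto simp: add.commute)
    also have "\<dots> = ennreal ((H1_norm \<Omega> (w k))\<^sup>2)"
      unfolding nw(1) by (rule nn_integral_eq_integral[OF nw(2)]) simp
    also have "\<dots> \<le> ennreal (?\<epsilon> (m k))"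
      using H1_norm_diff_power2_le[OF U p q] unfolding weq by (rule ennreal_leI)
    also have "\<dots> \<le> ennreal ((1 / 2) ^ k)" using m(1)[of k] by (intro ennreal_leI) simp
    finally show ?thesis .
  qed
  have fin: "(\<Sum>k. \<integral>\<^sup>+x. ennreal ((w k x)\<^sup>2 + (norm (D k x))\<^sup>2) * indicator \<Omega> x \<partial>lborel) < \<infinity>"
    by (rule le_less_trans[OF suminf_le[OF energy] suminf_geometric_ennreal]) auto
  let ?A = "{x \<in> frontier \<Omega>. \<not> (\<lambda>k. w k x) \<longlonglongrightarrow> 0}"
  have "?A \<in> null_sets surface"
  proof (rule frontier_null_setsI[OF \<Omega>])
    fix a R r h \<gamma> assume "lipschitz_chart \<Omega> a R r h \<gamma>"
    from chart_boundary_values_tendsto_0[OF this U(1) D fin]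
    show "AE y in lborel. y \<in> ball 0 r \<longrightarrow> a + R (y, \<gamma> y) \<notin> ?A"
      by eventually_elim simp
  qed auto
  then have "AE x in surface. x \<notin> ?A" by (rule AE_not_in)
  moreover have \<Gamma>: "frontier \<Omega> \<inter> space surface \<in> sets surface"
    using subsetD[OF sets_surface_borel, of "frontier \<Omega>"] by (simp add: space_surface)
  ultimately have lim0: "AE x in ?M. (\<lambda>k. w k x) \<longlonglongrightarrow> 0"
    unfolding AE_restrict_space_iff[OF \<Gamma>] by eventually_elim simp
  have cont: "f \<in> borel_measurable ?M" if "smooth f" for f
    by (intro measurable_restrict_space1 borel_measurable_surface smooth_continuous_on that)
  have [measurable]: "\<tau> \<in> borel_measurable ?M" "\<sigma> \<in> borel_measurable ?M" "\<And>k. w k \<in> borel_measurable ?M"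
    "\<And>k. \<phi> k \<in> borel_measurable ?M" "\<And>k. \<xi> k \<in> borel_measurable ?M"
    using \<tau>2 \<sigma>2 cont sw \<phi>(1) \<xi>(1) by (auto simp: L2_def)
  have bnd: "(\<integral>\<^sup>+x. ennreal ((w k x - (\<tau> x - \<sigma> x))\<^sup>2) \<partial>?M) \<le> 2 * ennreal ((1 / 2) ^ k)" for k
  proof -
    have "(\<integral>\<^sup>+x. ennreal ((w k x - (\<tau> x - \<sigma> x))\<^sup>2) \<partial>?M) \<le>
        (\<integral>\<^sup>+x. 2 * (ennreal ((\<phi> (m k) x - \<tau> x)\<^sup>2) + ennreal ((\<xi> (m k) x - \<sigma> x)\<^sup>2)) \<partial>?M)"
    proof (rule nn_integral_mono)
      fix x
      have "(w k x - (\<tau> x - \<sigma> x))\<^sup>2 \<le> 2 * ((\<phi> (m k) x - \<tau> x)\<^sup>2 + (\<xi> (m k) x - \<sigma> x)\<^sup>2)"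
        using norm_diff_power2_le[of "\<phi> (m k) x - \<tau> x" "\<xi> (m k) x - \<sigma> x"]
        by (simp add: w_def algebra_simps)
      then have "ennreal ((w k x - (\<tau> x - \<sigma> x))\<^sup>2) \<le>
          ennreal (2 * ((\<phi> (m k) x - \<tau> x)\<^sup>2 + (\<xi> (m k) x - \<sigma> x)\<^sup>2))" by (rule ennreal_leI)
      then show "ennreal ((w k x - (\<tau> x - \<sigma> x))\<^sup>2) \<le>
          2 * (ennreal ((\<phi> (m k) x - \<tau> x)\<^sup>2) + ennreal ((\<xi> (m k) x - \<sigma> x)\<^sup>2))"
        by (simp add: ennreal_mult)
    qed
    also have "\<dots> = 2 * ?\<beta> (m k)"
      by (subst nn_integral_cmult, measurable) (subst nn_integral_add, auto)
    also have "\<dots> \<le> 2 * ennreal ((1 / 2) ^ k)"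
      using m(2)[of k] by (intro mult_left_mono less_imp_le) auto
    finally show ?thesis .
  qed
  \<comment> \<open>The boundary errors are summable too, which gives the second pointwise limit of
    \<open>w\<close>.\<close>
  have "(\<Sum>k. \<integral>\<^sup>+x. ennreal ((w k x - (\<tau> x - \<sigma> x))\<^sup>2) \<partial>?M) \<le> (\<Sum>k. 2 * ennreal ((1 / 2) ^ k))"
    by (intro suminf_le bnd) auto
  also have "\<dots> < \<infinity>"
    using suminf_geometric_ennreal by (simp add: ennreal_mult_less_top)
  finally have "(\<Sum>k. \<integral>\<^sup>+x. ennreal ((w k x - (\<tau> x - \<sigma> x))\<^sup>2) \<partial>?M) < \<infinity>" .
  then have "(\<integral>\<^sup>+x. (\<Sum>k. ennreal ((w k x - (\<tau> x - \<sigma> x))\<^sup>2)) \<partial>?M) \<noteq> \<infinity>"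
    by (subst nn_integral_suminf) auto
  then have "AE x in ?M. (\<Sum>k. ennreal ((w k x - (\<tau> x - \<sigma> x))\<^sup>2)) \<noteq> \<infinity>"
    by (intro nn_integral_PInf_AE) auto
  with lim0 show ?thesis
  proof eventually_elim
    case (elim x)
    have "(\<lambda>k. w k x - (\<tau> x - \<sigma> x)) \<longlonglongrightarrow> 0"
      using elim by (intro suminf_power2_finite_imp_tendsto_0) (simp add: less_top)
    moreover have "(\<lambda>k. w k x - (\<tau> x - \<sigma> x)) \<longlonglongrightarrow> 0 - (\<tau> x - \<sigma> x)"
      using elim by (intro tendsto_diff) auto
    ultimately have "0 = 0 - (\<tau> x - \<sigma> x)" by (rule LIMSEQ_unique)
    then show ?case by simp
  qed
qed

section \<open>Identification of the coefficient\<close>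

lemma weak_gradient_cong_AE:
  assumes u: "u \<in> L2 (lebesgue_on U)" and v: "v \<in> L2 (lebesgue_on U)"
    and eq: "AE x in lebesgue_on U. u x = v x" and G: "weak_gradient U u G"
  shows "weak_gradient U v G"
  unfolding weak_gradient_def
proof (intro conjI allI impI ballI)
  fix b :: 'a assume b: "b \<in> Basis"
  show "(\<lambda>x. G x \<bullet> b) \<in> L2 (lebesgue_on U)" using G b by (simp add: weak_gradient_def)
  fix \<phi> D assume \<phi>: "test_fun U \<phi>" and D: "\<forall>x. GDERIV \<phi> x :> D x"
  have "continuous_on UNIV D"
    by (rule smooth_gderiv_continuous_on[OF test_funD(1)[OF \<phi>]]) (use D in blast)
  then have "(\<lambda>x. D x \<bullet> b) \<in> borel_measurable (lebesgue_on U)"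
    by (intro continuous_imp_borel_lebesgue_on continuous_on_inner continuous_on_const)
  then have "(LINT x|lebesgue_on U. u x * (D x \<bullet> b)) = (LINT x|lebesgue_on U. v x * (D x \<bullet> b))"
    using u v eq by (intro integral_cong_AE) (auto simp: L2_def)
  moreover have "(LINT x|lebesgue_on U. u x * (D x \<bullet> b)) = - (LINT x|lebesgue_on U. (G x \<bullet> b) * \<phi> x)"
    using G \<phi> D b unfolding weak_gradient_def by blast
  ultimately show "(LINT x|lebesgue_on U. v x * (D x \<bullet> b)) = - (LINT x|lebesgue_on U. (G x \<bullet> b) * \<phi> x)"
    by simp
qed

lemma a_form_uminus:
  assumes U: "open U" "bounded U" and u: "u \<in> H1 U" and v: "v \<in> H1 U"
  shows "a_form U u (\<lambda>x. - v x) = - a_form U u v"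
proof -
  note G = weak_gradient_grad[OF u] and H = weak_gradient_grad[OF v]
  have v': "(\<lambda>x. - v x) \<in> H1 U"
    using smooth_mult_H1[OF U smooth_const v, of "- 1"] by simp
  have H': "weak_gradient U (\<lambda>x. - v x) (\<lambda>x. - grad U v x)"
    using weak_gradient_smooth_mult[OF U H1_L2[OF v] H smooth_const GDERIV_const, of "- 1"] by simp
  have "(\<lambda>x. grad U u x \<bullet> (- grad U v x) + u x * (- v x)) = (\<lambda>x. - (grad U u x \<bullet> grad U v x + u x * v x))"
    by auto
  then show ?thesis
    unfolding a_form_eq(2)[OF U u v' G H'] a_form_eq(2)[OF U u v G H] by (simp only: integral_minus)
qed

text \<open>\<open>u\<close> and \<open>v\<close> agree only almost everywhere, so
  \<open>grad U u\<close> and \<open>grad U v\<close> are separate choices. \<open>grad U u\<close>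
  is a weak gradient of both, and with it the integrands agree almost everywhere.\<close>

lemma a_form_smooth_mult_cong_AE:
  assumes U: "open U" "bounded U" and u: "u \<in> H1 U" and v: "v \<in> H1 U" and \<psi>: "smooth \<psi>"
    and eq: "AE x in lebesgue_on U. u x = v x"
  shows "a_form U u (\<lambda>x. \<psi> x * u x) = a_form U v (\<lambda>x. \<psi> x * v x)"
proof -
  obtain E where E: "\<And>x. GDERIV \<psi> x :> E x" "continuous_on UNIV E"
    using smooth_gderivE[OF \<psi>] by blast
  note G = weak_gradient_grad[OF u]
  have G': "weak_gradient U v (grad U u)"
    by (rule weak_gradient_cong_AE[OF H1_L2[OF u] H1_L2[OF v] eq G])
  note w = weak_gradient_smooth_mult[OF U H1_L2[OF u] G \<psi> E]
    and w' = weak_gradient_smooth_mult[OF U H1_L2[OF v] G' \<psi> E]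
  note a = a_form_eq[OF U u smooth_mult_H1[OF U \<psi> u] G w]
    and a' = a_form_eq[OF U v smooth_mult_H1[OF U \<psi> v] G' w']
  have "AE x in lebesgue_on U. grad U u x \<bullet> (\<psi> x *\<^sub>R grad U u x + u x *\<^sub>R E x) + u x * (\<psi> x * u x) =
      grad U u x \<bullet> (\<psi> x *\<^sub>R grad U u x + v x *\<^sub>R E x) + v x * (\<psi> x * v x)"
    using eq by eventually_elim simp
  then show ?thesis
    unfolding a(2) a'(2)
    by (rule integral_cong_AE[OF borel_measurable_integrable[OF a(1)] borel_measurable_integrable[OF a'(1)]])
qed

lemma load_uminus: "load U f (\<lambda>x. - v x) = - load U f v"
  unfolding load_def by (simp only: mult_minus_right integral_minus)

lemma sobolev_trace_is_trace:
  assumes "v \<in> V_space \<Omega> \<Gamma>0"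
  shows "is_trace \<Omega> v (sobolev_trace \<Omega> v)"
proof -
  have "\<exists>\<tau>. is_trace \<Omega> v \<tau>" using assms by (auto simp: V_space_def)
  then show ?thesis unfolding sobolev_trace_def by (rule someI_ex)
qed

text \<open>Multiplying a function by smooth functions stays inside \<^term>\<open>V_space \<Omega> \<Gamma>0\<close> however irregular
  \<^term>\<open>\<Gamma>0\<close> is, which makes the multiples of the solution admissible test functions.\<close>

lemma smooth_mult_V_space:
  fixes \<Omega> :: "('m::euclidean_space \<times> real) set"
  assumes \<Omega>: "lipschitz_domain \<Omega>" and v: "v \<in> V_space \<Omega> \<Gamma>0" and \<psi>: "smooth \<psi>"
  shows "(\<lambda>x. \<psi> x * v x) \<in> V_space \<Omega> \<Gamma>0"
    and "AE x in surface_on (frontier \<Omega>).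
      sobolev_trace \<Omega> (\<lambda>x. \<psi> x * v x) x = \<psi> x * sobolev_trace \<Omega> v x"
proof -
  have U: "open \<Omega>" "bounded \<Omega>" using \<Omega> by (auto simp: lipschitz_domain_def)
  have H: "v \<in> H1 \<Omega>" using v by (simp add: V_space_def)
  \<comment> \<open>This witness may differ from \<open>sobolev_trace \<Omega> v\<close>;
    multiplying the witness itself preserves its zero values on \<open>\<Gamma>0\<close>.\<close>
  obtain \<tau> where \<tau>: "is_trace \<Omega> v \<tau>" "AE x in surface_on \<Gamma>0. \<tau> x = 0"
    using v by (auto simp: V_space_def)
  have "AE x in surface_on \<Gamma>0. \<psi> x * \<tau> x = 0"
    using \<tau>(2) by eventually_elim simp
  with is_trace_smooth_mult[OF U H \<tau>(1) \<psi>] smooth_mult_H1[OF U \<psi> H]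
  show V: "(\<lambda>x. \<psi> x * v x) \<in> V_space \<Omega> \<Gamma>0" unfolding V_space_def by blast
  show "AE x in surface_on (frontier \<Omega>).
      sobolev_trace \<Omega> (\<lambda>x. \<psi> x * v x) x = \<psi> x * sobolev_trace \<Omega> v x"
    by (rule trace_unique[OF \<Omega> smooth_mult_H1[OF U \<psi> H] sobolev_trace_is_trace[OF V]
          is_trace_smooth_mult[OF U H sobolev_trace_is_trace[OF v] \<psi>]])
qed

lemma L2_restrict_space_subset:
  assumes S: "S \<in> sets M" and T: "T \<in> sets M" "T \<subseteq> S" and u: "u \<in> L2 (restrict_space M S)"
  shows "u \<in> L2 (restrict_space M T)"
proof -
  let ?N = "restrict_space M S"
  have eq: "restrict_space ?N T = restrict_space M T"
    using S T sets.sets_into_space by (subst restrict_restrict_space) (auto simp: Int_absorb1)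
  have sp: "space ?N = S"
    using sets.sets_into_space[OF S] by (auto simp: space_restrict_space)
  have TN: "T \<in> sets ?N"
    using S T sets.Int_space_eq2[OF S] by (subst sets_restrict_space_iff) auto
  then have TS: "T \<inter> space ?N \<in> sets ?N" using T(2) sp by (simp add: Int_absorb2)
  have "u \<in> borel_measurable (restrict_space ?N T)"
    using u unfolding L2_def by (intro measurable_restrict_space1[of u ?N]) simp
  moreover have "integrable (restrict_space ?N T) (\<lambda>x. (u x)\<^sup>2)"
    unfolding integrable_restrict_space[OF TS]
    using u TN unfolding L2_def by (intro integrable_mult_indicator) simp_all
  ultimately show ?thesis unfolding eq L2_def by simp
qed

text \<open>Testing with \<open>(1 \<plusminus> \<psi>) u\<close> for \<open>0 \<le> \<psi> \<le> 1\<close>, where \<open>\<bar>(1 \<plusminus> \<psi>) u\<bar> = (1 \<plusminus> \<psi>) \<bar>u\<bar>\<close>, turns the variational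
  inequality into an equation.\<close>

lemma VI_solution_smooth_multiple:
  fixes \<Omega> :: "('m::euclidean_space \<times> real) set"
  assumes \<Omega>: "lipschitz_domain \<Omega>" and \<Gamma>: "\<Gamma> = frontier \<Omega> - \<Gamma>0" "\<Gamma> \<in> sets borel"
    and g: "g \<in> L2 (surface_on \<Gamma>)" and VI: "VI_solution \<Omega> \<Gamma>0 f g u"
    and \<psi>: "smooth \<psi>" "\<And>x. 0 \<le> \<psi> x \<and> \<psi> x \<le> 1"
  shows "a_form \<Omega> u (\<lambda>x. \<psi> x * u x)
      + (LINT x|surface_on \<Gamma>. (g x * \<bar>sobolev_trace \<Omega> u x\<bar>) * \<psi> x) = load \<Omega> f (\<lambda>x. \<psi> x * u x)"
    and "integrable (surface_on \<Gamma>) (\<lambda>x. g x * \<bar>sobolev_trace \<Omega> u x\<bar>)"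
proof -
  let ?t = "sobolev_trace \<Omega> u"
  let ?M = "surface_on \<Gamma>"
  have U: "open \<Omega>" "bounded \<Omega>" using \<Omega> by (auto simp: lipschitz_domain_def)
  have u: "u \<in> V_space \<Omega> \<Gamma>0" using VI by (simp add: VI_solution_def)
  have H: "u \<in> H1 \<Omega>" using u by (simp add: V_space_def)
  have sets: "frontier \<Omega> \<in> sets surface" "\<Gamma> \<in> sets surface" "\<Gamma> \<subseteq> frontier \<Omega>"
    using \<Gamma> sets_surface_borel by auto
  have "?t \<in> L2 (surface_on (frontier \<Omega>))"
    using sobolev_trace_is_trace[OF u] by (simp add: is_trace_def)
  then have t: "?t \<in> L2 ?M"
    by (rule L2_restrict_space_subset[OF sets])
  show int: "integrable ?M (\<lambda>x. g x * \<bar>?t x\<bar>)"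
    by (rule L2_mult_integrable[OF g L2_abs[OF t]])
  have m\<psi>: "\<psi> \<in> borel_measurable ?M"
    by (intro measurable_restrict_space1 borel_measurable_surface smooth_continuous_on \<psi>)
  have int\<psi>: "integrable ?M (\<lambda>x. (g x * \<bar>?t x\<bar>) * \<psi> x)"
  proof (rule Bochner_Integration.integrable_bound[OF int])
    show "(\<lambda>x. (g x * \<bar>?t x\<bar>) * \<psi> x) \<in> borel_measurable ?M"
      by (rule borel_measurable_times[OF borel_measurable_integrable[OF int] m\<psi>])
    show "AE x in ?M. norm ((g x * \<bar>?t x\<bar>) * \<psi> x) \<le> norm (g x * \<bar>?t x\<bar>)"
      using \<psi>(2) by (intro AE_I2) (simp add: abs_mult mult_left_le)
  qed
  let ?J = "LINT x|?M. (g x * \<bar>?t x\<bar>) * \<psi> x"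
  have test: "a_form \<Omega> u (\<lambda>x. s * (\<psi> x * u x)) + s * ?J \<ge> load \<Omega> f (\<lambda>x. s * (\<psi> x * u x))"
    if s: "s \<in> {1, - 1}" for s :: real
  proof -
    let ?\<xi> = "\<lambda>x. 1 + s * \<psi> x"
    let ?v = "\<lambda>x. ?\<xi> x * u x"
    have \<xi>: "smooth ?\<xi>" by (intro smooth_add smooth_mult smooth_const \<psi>(1))
    note V = smooth_mult_V_space[OF \<Omega> u \<xi>]
    have j: "j_fun \<Omega> \<Gamma> g ?v = j_fun \<Omega> \<Gamma> g u + s * ?J"
    proof -
      have v2: "sobolev_trace \<Omega> ?v \<in> L2 ?M"
        using sobolev_trace_is_trace[OF V(1)] L2_restrict_space_subset[OF sets] by (simp add: is_trace_def)
      have "AE x in surface. x \<in> frontier \<Omega> \<longrightarrow> sobolev_trace \<Omega> ?v x = ?\<xi> x * ?t x"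
        using V(2) sets(1) by (subst (asm) AE_restrict_space_iff) (auto simp: space_surface)
      then have "AE x in surface. x \<in> \<Gamma> \<longrightarrow> sobolev_trace \<Omega> ?v x = ?\<xi> x * ?t x"
        by eventually_elim (use sets(3) in blast)
      then have "AE x in ?M. sobolev_trace \<Omega> ?v x = ?\<xi> x * ?t x"
        using sets(2) by (subst AE_restrict_space_iff) (auto simp: space_surface)
      then have ae: "AE x in ?M. g x * \<bar>sobolev_trace \<Omega> ?v x\<bar> = g x * \<bar>?t x\<bar> + s * ((g x * \<bar>?t x\<bar>) * \<psi> x)"
      proof eventually_elim
        case (elim x)
        \<comment> \<open>Here \<open>\<psi> \<le> 1\<close> enters: for \<open>s = - 1\<close> a
          larger \<open>\<psi>\<close> would reverse the sign of the factor.\<close>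
        have "0 \<le> ?\<xi> x" using s \<psi>(2)[of x] by auto
        then have "\<bar>sobolev_trace \<Omega> ?v x\<bar> = ?\<xi> x * \<bar>?t x\<bar>" using elim by (simp add: abs_mult)
        then show ?case by (simp add: algebra_simps)
      qed
      have "j_fun \<Omega> \<Gamma> g ?v = (LINT x|?M. g x * \<bar>?t x\<bar> + s * ((g x * \<bar>?t x\<bar>) * \<psi> x))"
        unfolding j_fun_def
        by (rule integral_cong_AE[OF borel_measurable_integrable[OF L2_mult_integrable[OF g L2_abs[OF v2]]]
              borel_measurable_integrable ae])
           (intro Bochner_Integration.integrable_add integrable_mult_right int int\<psi>)
      also have "\<dots> = j_fun \<Omega> \<Gamma> g u + s * ?J"
        unfolding j_fun_def
        by (simp add: Bochner_Integration.integral_add[OF int integrable_mult_right[OF int\<psi>]] del: mult_minus_left)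
      finally show ?thesis .
    qed
    have "(\<lambda>x. ?v x - u x) = (\<lambda>x. s * (\<psi> x * u x))" by (simp add: algebra_simps)
    moreover have "a_form \<Omega> u (\<lambda>x. ?v x - u x) + j_fun \<Omega> \<Gamma> g ?v - j_fun \<Omega> \<Gamma> g u \<ge> load \<Omega> f (\<lambda>x. ?v x - u x)"
      using VI[unfolded VI_solution_def, THEN conjunct2, THEN bspec, OF V(1)] unfolding \<Gamma>(1) .
    ultimately show ?thesis unfolding j by simp
  qed
  \<comment> \<open>By oddness of the form and the load, \<open>s = 1\<close> and
    \<open>s = - 1\<close> yield opposite inequalities.\<close>
  have "a_form \<Omega> u (\<lambda>x. - (\<psi> x * u x)) = - a_form \<Omega> u (\<lambda>x. \<psi> x * u x)"
    by (rule a_form_uminus[OF U H smooth_mult_H1[OF U \<psi>(1) H]])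
  with test[of 1] test[of "- 1"] load_uminus[of \<Omega> f "\<lambda>x. \<psi> x * u x"]
  show "a_form \<Omega> u (\<lambda>x. \<psi> x * u x) + ?J = load \<Omega> f (\<lambda>x. \<psi> x * u x)" by simp
qed

text \<open>Each inequality carries only its own coefficient, and with equal traces its two boundary
  terms cancel. Hence the coefficients may differ.\<close>

lemma VI_solutions_eq_AE:
  fixes \<Omega> :: "('m::euclidean_space \<times> real) set"
  assumes \<Omega>: "lipschitz_domain \<Omega>" and \<Gamma>: "\<Gamma> = frontier \<Omega> - \<Gamma>0" "\<Gamma> \<in> sets borel"
    and g: "g1 \<in> L2 (surface_on \<Gamma>)" "g2 \<in> L2 (surface_on \<Gamma>)"
    and VI: "VI_solution \<Omega> \<Gamma>0 f g1 u1" "VI_solution \<Omega> \<Gamma>0 f g2 u2"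
    and eq: "AE x in surface_on \<Gamma>. sobolev_trace \<Omega> u1 x = sobolev_trace \<Omega> u2 x"
  shows "AE x in lebesgue_on \<Omega>. u1 x = u2 x"
proof -
  have U: "open \<Omega>" "bounded \<Omega>" using \<Omega> by (auto simp: lipschitz_domain_def)
  have V: "u1 \<in> V_space \<Omega> \<Gamma>0" "u2 \<in> V_space \<Omega> \<Gamma>0" using VI by (auto simp: VI_solution_def)
  then have H: "u1 \<in> H1 \<Omega>" "u2 \<in> H1 \<Omega>" by (auto simp: V_space_def)
  have sets: "frontier \<Omega> \<in> sets surface" "\<Gamma> \<in> sets surface" "\<Gamma> \<subseteq> frontier \<Omega>"
    using \<Gamma> sets_surface_borel by auto
  have t: "sobolev_trace \<Omega> u \<in> L2 (surface_on \<Gamma>)" if "u \<in> V_space \<Omega> \<Gamma>0" for u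
    using sobolev_trace_is_trace[OF that] L2_restrict_space_subset[OF sets] by (simp add: is_trace_def)
  have j: "j_fun \<Omega> \<Gamma> g u1 = j_fun \<Omega> \<Gamma> g u2" if "g \<in> L2 (surface_on \<Gamma>)" for g
    unfolding j_fun_def
  proof (rule integral_cong_AE)
    show "AE x in surface_on \<Gamma>. g x * \<bar>sobolev_trace \<Omega> u1 x\<bar> = g x * \<bar>sobolev_trace \<Omega> u2 x\<bar>"
      using eq by eventually_elim simp
  qed (intro borel_measurable_integrable L2_mult_integrable that L2_abs t V)+
  let ?w = "\<lambda>x. u2 x - u1 x"
  have w: "?w \<in> H1 \<Omega>" by (rule H1_diff[OF U H(2,1)])
  have "a_form \<Omega> u1 ?w + j_fun \<Omega> \<Gamma> g1 u2 - j_fun \<Omega> \<Gamma> g1 u1 \<ge> load \<Omega> f ?w"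
    using VI(1)[unfolded VI_solution_def, THEN conjunct2, THEN bspec, OF V(2)] unfolding \<Gamma>(1) .
  moreover have "a_form \<Omega> u2 (\<lambda>x. - ?w x) + j_fun \<Omega> \<Gamma> g2 u1 - j_fun \<Omega> \<Gamma> g2 u2 \<ge> load \<Omega> f (\<lambda>x. - ?w x)"
    using VI(2)[unfolded VI_solution_def, THEN conjunct2, THEN bspec, OF V(1)]
    unfolding \<Gamma>(1) minus_diff_eq .
  ultimately have "a_form \<Omega> u2 ?w \<le> a_form \<Omega> u1 ?w"
    using j[OF g(1)] j[OF g(2)] unfolding load_uminus a_form_uminus[OF U H(2) w] by linarith
  \<comment> \<open>\<open>a_form\<close> is the inner product of \<open>H1\<close>, so the two
    values at \<open>?w\<close> differ by its squared norm.\<close>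
  moreover have "a_form \<Omega> u2 ?w - a_form \<Omega> u1 ?w = (H1_norm \<Omega> ?w)\<^sup>2"
  proof -
    note G1 = weak_gradient_grad[OF H(1)] and G2 = weak_gradient_grad[OF H(2)]
    note W = weak_gradient_diff[OF U H1_L2[OF H(2)] H1_L2[OF H(1)] G2 G1]
    note a1 = a_form_eq[OF U H(1) w G1 W] and a2 = a_form_eq[OF U H(2) w G2 W]
    show ?thesis
      unfolding a1(2) a2(2) H1_norm_power2(1)[OF U w W]
      by (subst Bochner_Integration.integral_diff[OF a2(1) a1(1), symmetric])
         (simp add: power2_norm_eq_inner power2_eq_square[of "u2 _ - u1 _"] inner_diff_left left_diff_distrib algebra_simps)
  qed
  ultimately have "(H1_norm \<Omega> ?w)\<^sup>2 = 0"
    using zero_le_power2[of "H1_norm \<Omega> ?w"] by linarith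
  then have "(LINT x|lebesgue_on \<Omega>. (norm (grad \<Omega> ?w x))\<^sup>2 + (?w x)\<^sup>2) = 0"
    using H1_norm_power2(1)[OF U w weak_gradient_grad[OF w]] by simp
  then have "AE x in lebesgue_on \<Omega>. (norm (grad \<Omega> ?w x))\<^sup>2 + (?w x)\<^sup>2 = 0"
    by (subst (asm) integral_nonneg_eq_0_iff_AE[OF H1_norm_power2(2)[OF U w weak_gradient_grad[OF w]]]) auto
  then show ?thesis
    by eventually_elim (simp add: add_nonneg_eq_0_iff)
qed

theorem proposition1:
  fixes \<Omega> \<Gamma>0 \<Gamma>f :: "('m::euclidean_space \<times> real) set"
    and f g1 g2 u1 u2 :: "'m \<times> real \<Rightarrow> real"
    and g0 :: real
  assumes "DIM('m \<times> real) \<in> {2, 3}"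
    and "lipschitz_domain \<Omega>"
    and "openin (top_of_set (frontier \<Omega>)) \<Gamma>0"
    and "\<Gamma>f = frontier \<Omega> - \<Gamma>0"
    and "f \<in> L2 (lebesgue_on \<Omega>)"
    and "g0 > 0"
    and "g1 \<in> admissible \<Omega> \<Gamma>f g0"
    and "g2 \<in> admissible \<Omega> \<Gamma>f g0"
    and "VI_solution \<Omega> \<Gamma>0 f g1 u1"
    and "VI_solution \<Omega> \<Gamma>0 f g2 u2"
    and "{x \<in> \<Gamma>f. sobolev_trace \<Omega> u1 x = 0} \<in> null_sets surface"
    and "{x \<in> \<Gamma>f. sobolev_trace \<Omega> u2 x = 0} \<in> null_sets surface"
    and "AE x in surface_on \<Gamma>f. sobolev_trace \<Omega> u1 x = sobolev_trace \<Omega> u2 x"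
  shows "AE x in surface_on \<Gamma>f. g1 x = g2 x"
proof -
  let ?M = "surface_on \<Gamma>f"
  let ?t = "\<lambda>u x. \<bar>sobolev_trace \<Omega> u x\<bar>"
  have U: "open \<Omega>" "bounded \<Omega>" using assms(2) by (auto simp: lipschitz_domain_def)
  obtain T where T: "open T" "\<Gamma>0 = frontier \<Omega> \<inter> T"
    using assms(3) by (auto simp: openin_open)
  \<comment> \<open>Removing a relatively open part from the closed frontier leaves a closed set,
    hence a Borel one.\<close>
  have "\<Gamma>f = frontier \<Omega> - T" using assms(4) T(2) by blast
  then have "closed \<Gamma>f" using T(1) by (simp add: closed_Diff)
  then have \<Gamma>b: "\<Gamma>f \<in> sets borel" by simp
  then have \<Gamma>s: "\<Gamma>f \<inter> space surface \<in> sets surface" using sets_surface_borel by (auto simp: space_surface)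
  have g: "g1 \<in> L2 ?M" "g2 \<in> L2 ?M"
    using assms(7,8) by (auto simp: admissible_def H1_surface_def)
  have eq: "AE x in lebesgue_on \<Omega>. u1 x = u2 x"
    by (rule VI_solutions_eq_AE[OF assms(2,4) \<Gamma>b g assms(9,10,13)])
  have H: "u1 \<in> H1 \<Omega>" "u2 \<in> H1 \<Omega>"
    using assms(9,10) by (auto simp: VI_solution_def V_space_def)
  note T1 = VI_solution_smooth_multiple[OF assms(2,4) \<Gamma>b g(1) assms(9)]
    and T2 = VI_solution_smooth_multiple[OF assms(2,4) \<Gamma>b g(2) assms(10)]
  \<comment> \<open>The integrability claim is independent of the multiplier, so it is read off with
    \<open>\<psi> = 0\<close>.\<close>
  have i1: "integrable ?M (\<lambda>x. g1 x * ?t u1 x)" and i2: "integrable ?M (\<lambda>x. g2 x * ?t u2 x)"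
    by (rule T1(2)[OF smooth_const[of 0]] T2(2)[OF smooth_const[of 0]]; simp)+
  let ?q = "\<lambda>x. g1 x * ?t u1 x - g2 x * ?t u2 x"
  have iq: "integrable ?M ?q" by (rule Bochner_Integration.integrable_diff[OF i1 i2])
  have zero: "(LINT x|?M. ?q x * \<psi> x) = 0" if \<psi>: "smooth \<psi>" "\<And>x. 0 \<le> \<psi> x \<and> \<psi> x \<le> 1" for \<psi>
  proof -
    have m\<psi>: "\<psi> \<in> borel_measurable ?M"
      by (intro measurable_restrict_space1 borel_measurable_surface smooth_continuous_on \<psi>)
    have int: "integrable ?M (\<lambda>x. p x * \<psi> x)" if "integrable ?M p" for p
    proof (rule Bochner_Integration.integrable_bound[OF that])
      show "(\<lambda>x. p x * \<psi> x) \<in> borel_measurable ?M"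
        by (rule borel_measurable_times[OF borel_measurable_integrable[OF that] m\<psi>])
      show "AE x in ?M. norm (p x * \<psi> x) \<le> norm (p x)"
        using \<psi>(2) by (intro AE_I2) (simp add: abs_mult mult_left_le)
    qed
    \<comment> \<open>The solutions agree almost everywhere in the domain, so the load and form
      terms cancel and only boundary integrals remain.\<close>
    have "load \<Omega> f (\<lambda>x. \<psi> x * u1 x) = load \<Omega> f (\<lambda>x. \<psi> x * u2 x)"
      unfolding load_def
    proof (rule integral_cong_AE)
      show "AE x in lebesgue_on \<Omega>. f x * (\<psi> x * u1 x) = f x * (\<psi> x * u2 x)"
        using eq by eventually_elim simp
    qed (intro borel_measurable_integrable L2_mult_integrable assms(5) H1_L2
        smooth_mult_H1[OF U \<psi>(1)] H)+
    with T1(1)[OF \<psi>] T2(1)[OF \<psi>] a_form_smooth_mult_cong_AE[OF U H \<psi>(1) eq]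
    have "(LINT x|?M. (g1 x * ?t u1 x) * \<psi> x) = (LINT x|?M. (g2 x * ?t u2 x) * \<psi> x)"
      by linarith
    then show ?thesis
      unfolding left_diff_distrib by (simp only: Bochner_Integration.integral_diff[OF int[OF i1] int[OF i2]])
  qed
  \<comment> \<open>The criterion lives on the whole space, so the integrand is extended by zero off
    \<open>\<Gamma>f\<close>.\<close>
  have "AE x in surface. indicator \<Gamma>f x * ?q x = 0"
  proof (rule AE_zero_of_box_bumps[OF sets_surface_borel space_surface])
    show "\<exists>B\<in>sets borel. E \<subseteq> B \<and> emeasure surface (B - E) = 0"
      if "E \<in> sets surface" "emeasure surface E < \<infinity>" for E :: "('m \<times> real) set"
      using that unfolding surface_def by (intro hausdorff_borel_hull) simp_all
    show "integrable surface (\<lambda>x. indicator \<Gamma>f x * ?q x)"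
      using iq unfolding integrable_restrict_space[OF \<Gamma>s] by simp
    show "(LINT x|surface. indicator \<Gamma>f x * ?q x * \<psi> x) = 0"
      if "smooth \<psi>" "\<And>x. 0 \<le> \<psi> x \<and> \<psi> x \<le> 1" for \<psi>
      using zero[OF that] unfolding integral_restrict_space[OF \<Gamma>s] by (simp add: mult.assoc)
  qed
  then have "AE x in ?M. ?q x = 0"
    unfolding AE_restrict_space_iff[OF \<Gamma>s] by eventually_elim (simp add: indicator_def)
  moreover have "AE x in ?M. sobolev_trace \<Omega> u1 x \<noteq> 0"
    using AE_not_in[OF assms(11)] unfolding AE_restrict_space_iff[OF \<Gamma>s] by eventually_elim simp
  ultimately show ?thesis
    using assms(13)
  proof eventually_elim
    case (elim x)
    \<comment> \<open>Equality of the traces allows the common factor \<open>?t u1 x\<close>,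
      nonzero at this point, to be taken out.\<close>
    then have "(g1 x - g2 x) * ?t u1 x = 0" by (simp add: left_diff_distrib)
    with elim(2) show ?case by simp
  qed
qed

end
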